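(* Let $\mathcal L_0$ be the generator on $L^2(\pi)$ of an ergodic time-reversible Markov process with invariant probability measure $\pi$, having a spectral gap $\lambda_0<0$. Let $\mathcal S$ be a reversible perturbation and $\mathcal A$ an irreversible perturbation (as defined in the context), and let $\mathcal L=\mathcal L_0+\mathcal S+\mathcal A$. Then the spectral gap $\lambda$ of $\mathcal L$ is smaller than (i.e. at most) the spectral gap $\lambda_0$ of $\mathcal L_0$: $$\lambda:=\sup\{\operatorname{Re}(z): z\in\sigma(\mathcal L),\ z\neq 0\}\ \le\ \lambda_0 .$$
   Context: Reference process. $X_0(t)$ is an ergodic time-reversible continuous-time Markov process on a state space $E$ with invariant probability measure $\pi$. $L^2_{\mathbb R}(\pi)$ is the real Hilbert space with scalar product $\langle f,g\rangle=\int f g\,d\pi$, and $L^2_{\mathbb C}(\pi)$ is the complex Hilbert space with scalar product $\langle f,g\rangle=\int f\bar g\,d\pi$; all operators are real and extend to $L^2_{\mathbb C}(\pi)$, where spectra $\sigma(\cdot)$ are taken. The semigroup $T^0_t$ of $X_0$ is strongly continuous on $L^2(\pi)$ with self-adjoint generator $\mathcal L_0$ of domain $D(\mathcal L_0)$. It has a spectral gap: $\lambda_0=\sup(\sigma(\mathcal L_0)\setminus\{0\})<0$; in particular $\langle f,\mathcal L_0 f\rangle\le 0$. Reversible perturbation $\mathcal S$: $D(\mathcal L_0)\subset D(\mathcal S)$; $\mathcal L_0+\mathcal S$ is the (self-adjoint) generator of a Markov process with invariant measure $\pi$; $\mathcal S$ is self-adjoint, $\langle f,\mathcal S g\rangle=\langle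 \mathcal S f,g\rangle$ for $f,g\in D(\mathcal S)$; and $\mathcal S$ is negative definite in the sense that $\langle f,\mathcal S f\rangle\le 0$ for all $f\in D(\mathcal S)$. Irreversible perturbation $\mathcal A$: $D(\mathcal L_0+\mathcal S)\subset D(\mathcal A)$; $\mathcal L=\mathcal L_0+\mathcal S+\mathcal A$ is the generator of a Markov process with invariant measure $\pi$ (a strongly continuous semigroup $T_t$ on $L^2(\pi)$); and $\langle f,\mathcal A g\rangle=-\langle\mathcal A f,g\rangle$ for $f,g\in D(\mathcal A)$. Note that with this convention spectral gaps are negative numbers, and a smaller (more negative) value corresponds to faster convergence. *)

theory Defs
  imports "HOL-Probability.Probability"
begin

section \<open>The space of square integrable functions\<close>

text \<open>
  Elements of the Hilbert space are represented by square integrable functions, and equality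
  in the Hilbert space by equality almost everywhere. The value type is \<^typ>\<open>real\<close> for the
  real and \<^typ>\<open>complex\<close> for the complex Hilbert space.
\<close>

definition L2 :: "'e measure \<Rightarrow> ('e \<Rightarrow> 'b::real_normed_vector) set" where
  "L2 \<pi> = {f \<in> borel_measurable \<pi>. integrable \<pi> (\<lambda>x. (norm (f x))\<^sup>2)}"

definition L2_norm :: "'e measure \<Rightarrow> ('e \<Rightarrow> 'b::real_normed_vector) \<Rightarrow> real" where
  "L2_norm \<pi> f = sqrt (\<integral>x. (norm (f x))\<^sup>2 \<partial>\<pi>)"

definition L2_inner :: "'e measure \<Rightarrow> ('e \<Rightarrow> real) \<Rightarrow> ('e \<Rightarrow> real) \<Rightarrow> real" where
  "L2_inner \<pi> f g = (\<integral>x. f x * g x \<partial>\<pi>)"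

section \<open>Unbounded operators\<close>

text \<open>
  An unbounded operator is given by its domain \<open>D\<close> and a function \<open>L\<close> whose values outside
  of \<open>D\<close> are irrelevant; both must respect equality almost everywhere.
\<close>

definition linear_operator ::
  "'e measure \<Rightarrow> ('e \<Rightarrow> real) set \<Rightarrow> (('e \<Rightarrow> real) \<Rightarrow> 'e \<Rightarrow> real) \<Rightarrow> bool" where
  "linear_operator \<pi> D L \<longleftrightarrow>
     D \<subseteq> L2 \<pi> \<and>
     (\<forall>f\<in>D. L f \<in> L2 \<pi>) \<and>
     (\<forall>f\<in>D. \<forall>g\<in>L2 \<pi>. (AE x in \<pi>. f x = g x) \<longrightarrow> g \<in> D \<and> (AE x in \<pi>. L f x = L g x)) \<and>
     (\<lambda>x. 0) \<in> D \<and>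
     (\<forall>f\<in>D. \<forall>g\<in>D. (\<lambda>x. f x + g x) \<in> D \<and>
        (AE x in \<pi>. L (\<lambda>x. f x + g x) x = L f x + L g x)) \<and>
     (\<forall>c. \<forall>f\<in>D. (\<lambda>x. c * f x) \<in> D \<and> (AE x in \<pi>. L (\<lambda>x. c * f x) x = c * L f x))"

definition densely_defined :: "'e measure \<Rightarrow> ('e \<Rightarrow> real) set \<Rightarrow> bool" where
  "densely_defined \<pi> D \<longleftrightarrow>
     (\<forall>f\<in>L2 \<pi>. \<forall>\<epsilon>>0. \<exists>u\<in>D. L2_norm \<pi> (\<lambda>x. f x - u x) < \<epsilon>)"

text \<open>
  The pair \<open>(u, v)\<close> is in the graph of the adjoint iff \<open>\<langle>L f, u\<rangle> = \<langle>f, v\<rangle>\<close> for all \<open>f\<close> in the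
  domain. Self-adjointness is equality, domains included, of the operator and its adjoint.
\<close>

definition self_adjoint ::
  "'e measure \<Rightarrow> ('e \<Rightarrow> real) set \<Rightarrow> (('e \<Rightarrow> real) \<Rightarrow> 'e \<Rightarrow> real) \<Rightarrow> bool" where
  "self_adjoint \<pi> D L \<longleftrightarrow>
     linear_operator \<pi> D L \<and> densely_defined \<pi> D \<and>
     (\<forall>u\<in>L2 \<pi>. \<forall>v\<in>L2 \<pi>.
        (\<forall>f\<in>D. L2_inner \<pi> (L f) u = L2_inner \<pi> f v) \<longleftrightarrow> (u \<in> D \<and> (AE x in \<pi>. v x = L u x)))"

section \<open>Spectrum\<close>

definition complex_domain :: "('e \<Rightarrow> real) set \<Rightarrow> ('e \<Rightarrow> complex) set" where
  "complex_domain D = {f. (\<lambda>x. Re (f x)) \<in> D \<and> (\<lambda>x. Im (f x)) \<in> D}"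

definition complex_extension ::
  "(('e \<Rightarrow> real) \<Rightarrow> 'e \<Rightarrow> real) \<Rightarrow> ('e \<Rightarrow> complex) \<Rightarrow> 'e \<Rightarrow> complex" where
  "complex_extension L f = (\<lambda>x. Complex (L (\<lambda>x. Re (f x)) x) (L (\<lambda>x. Im (f x)) x))"

text \<open>
  \<open>z\<close> is in the resolvent set iff \<open>z - L\<close>, with \<open>L\<close> extended to the complex Hilbert space, is a
  bijection of the domain onto the whole space with bounded inverse.
\<close>

definition resolvent_set ::
  "'e measure \<Rightarrow> ('e \<Rightarrow> real) set \<Rightarrow> (('e \<Rightarrow> real) \<Rightarrow> 'e \<Rightarrow> real) \<Rightarrow> complex set" where
  "resolvent_set \<pi> D L = {z.
     (let R = (\<lambda>f x. z * f x - complex_extension L f x) in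
       (\<forall>f\<in>complex_domain D. (AE x in \<pi>. R f x = 0) \<longrightarrow> (AE x in \<pi>. f x = 0)) \<and>
       (\<forall>h\<in>L2 \<pi>. \<exists>f\<in>complex_domain D. AE x in \<pi>. R f x = h x) \<and>
       (\<exists>C. \<forall>f\<in>complex_domain D. L2_norm \<pi> f \<le> C * L2_norm \<pi> (R f)))}"

definition spectrum ::
  "'e measure \<Rightarrow> ('e \<Rightarrow> real) set \<Rightarrow> (('e \<Rightarrow> real) \<Rightarrow> 'e \<Rightarrow> real) \<Rightarrow> complex set" where
  "spectrum \<pi> D L = - resolvent_set \<pi> D L"

text \<open>
  The supremum is taken in the extended reals, so that it is \<open>-\<infinity>\<close> if the spectrum is
  contained in \<open>{0}\<close>. The spectrum of a self-adjoint operator is real, hence this is also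
  the supremum of the spectrum without \<open>0\<close> in that case.
\<close>

definition spectral_gap ::
  "'e measure \<Rightarrow> ('e \<Rightarrow> real) set \<Rightarrow> (('e \<Rightarrow> real) \<Rightarrow> 'e \<Rightarrow> real) \<Rightarrow> ereal" where
  "spectral_gap \<pi> D L = (SUP z \<in> spectrum \<pi> D L - {0}. ereal (Re z))"

section \<open>Markov processes\<close>

text \<open>
  A time-homogeneous Markov process \<open>(X\<^sub>t)\<^sub>t\<^sub>\<ge>\<^sub>0\<close> on the measurable space \<open>W\<close> with state space
  \<open>E\<close>; the measure \<open>Q x\<close> on \<open>W\<close> is the law of the process started in \<open>x\<close>. Only the measurable
  space structure of \<open>E\<close> and \<open>W\<close> is used, not their measures.
\<close>

definition trans_prob ::
  "('e \<Rightarrow> 'w measure) \<Rightarrow> (real \<Rightarrow> 'w \<Rightarrow> 'e) \<Rightarrow> real \<Rightarrow> 'e \<Rightarrow> 'e set \<Rightarrow> real" where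
  "trans_prob Q X t x B = measure (Q x) {\<omega> \<in> space (Q x). X t \<omega> \<in> B}"

definition natural_filtration ::
  "'e measure \<Rightarrow> 'w measure \<Rightarrow> (real \<Rightarrow> 'w \<Rightarrow> 'e) \<Rightarrow> real \<Rightarrow> 'w measure" where
  "natural_filtration E W X s =
     sigma (space W) {{\<omega> \<in> space W. X u \<omega> \<in> B} | u B. 0 \<le> u \<and> u \<le> s \<and> B \<in> sets E}"

definition markov_process ::
  "'e measure \<Rightarrow> 'w measure \<Rightarrow> ('e \<Rightarrow> 'w measure) \<Rightarrow> (real \<Rightarrow> 'w \<Rightarrow> 'e) \<Rightarrow> bool" where
  "markov_process E W Q X \<longleftrightarrow>
     (\<forall>x\<in>space E. prob_space (Q x) \<and> sets (Q x) = sets W) \<and>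
     (\<forall>t\<ge>0. X t \<in> measurable W E) \<and>
     (\<forall>t\<ge>0. \<forall>B\<in>sets E. (\<lambda>x. trans_prob Q X t x B) \<in> borel_measurable E) \<and>
     (\<forall>x\<in>space E. \<forall>B\<in>sets E. trans_prob Q X 0 x B = indicator B x) \<and>
     (\<forall>x\<in>space E. \<forall>s\<ge>0. \<forall>t\<ge>0. \<forall>B\<in>sets E. AE \<omega> in Q x.
        real_cond_exp (Q x) (natural_filtration E W X s)
          (indicator {\<omega> \<in> space W. X (s + t) \<omega> \<in> B}) \<omega> = trans_prob Q X t (X s \<omega>) B)"

definition invariant_measure ::
  "'e measure \<Rightarrow> ('e \<Rightarrow> 'w measure) \<Rightarrow> (real \<Rightarrow> 'w \<Rightarrow> 'e) \<Rightarrow> bool" where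
  "invariant_measure \<pi> Q X \<longleftrightarrow>
     (\<forall>t\<ge>0. \<forall>B\<in>sets \<pi>. (\<integral>x. trans_prob Q X t x B \<partial>\<pi>) = measure \<pi> B)"

definition time_reversible ::
  "'e measure \<Rightarrow> ('e \<Rightarrow> 'w measure) \<Rightarrow> (real \<Rightarrow> 'w \<Rightarrow> 'e) \<Rightarrow> bool" where
  "time_reversible \<pi> Q X \<longleftrightarrow>
     (\<forall>t\<ge>0. \<forall>B\<in>sets \<pi>. \<forall>C\<in>sets \<pi>.
        (\<integral>x\<in>B. trans_prob Q X t x C \<partial>\<pi>) = (\<integral>x\<in>C. trans_prob Q X t x B \<partial>\<pi>))"

text \<open>Ergodicity of the invariant measure: all invariant sets are trivial.\<close>

definition ergodic ::
  "'e measure \<Rightarrow> ('e \<Rightarrow> 'w measure) \<Rightarrow> (real \<Rightarrow> 'w \<Rightarrow> 'e) \<Rightarrow> bool" where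
  "ergodic \<pi> Q X \<longleftrightarrow>
     (\<forall>B\<in>sets \<pi>. (\<forall>t\<ge>0. AE x in \<pi>. trans_prob Q X t x B = indicator B x) \<longrightarrow>
        measure \<pi> B = 0 \<or> measure \<pi> B = 1)"

text \<open>
  If \<open>\<pi>\<close> is invariant and \<open>f\<close> is square integrable, then the expectation
  below exists for almost every \<open>x\<close> and depends on \<open>f\<close> only up to equality almost everywhere.
\<close>

definition semigroup ::
  "('e \<Rightarrow> 'w measure) \<Rightarrow> (real \<Rightarrow> 'w \<Rightarrow> 'e) \<Rightarrow> real \<Rightarrow> ('e \<Rightarrow> real) \<Rightarrow> 'e \<Rightarrow> real" where
  "semigroup Q X t f x = (\<integral>\<omega>. f (X t \<omega>) \<partial>Q x)"

definition strongly_continuous ::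
  "'e measure \<Rightarrow> (real \<Rightarrow> ('e \<Rightarrow> real) \<Rightarrow> 'e \<Rightarrow> real) \<Rightarrow> bool" where
  "strongly_continuous \<pi> T \<longleftrightarrow>
     (\<forall>f\<in>L2 \<pi>. ((\<lambda>t. L2_norm \<pi> (\<lambda>x. T t f x - f x)) \<longlongrightarrow> 0) (at_right 0))"

definition has_L2_derivative ::
  "'e measure \<Rightarrow> (real \<Rightarrow> ('e \<Rightarrow> real) \<Rightarrow> 'e \<Rightarrow> real) \<Rightarrow> ('e \<Rightarrow> real) \<Rightarrow> ('e \<Rightarrow> real) \<Rightarrow> bool" where
  "has_L2_derivative \<pi> T f g \<longleftrightarrow>
     ((\<lambda>t. L2_norm \<pi> (\<lambda>x. (T t f x - f x) / t - g x)) \<longlongrightarrow> 0) (at_right 0)"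

definition is_generator ::
  "'e measure \<Rightarrow> (real \<Rightarrow> ('e \<Rightarrow> real) \<Rightarrow> 'e \<Rightarrow> real) \<Rightarrow>
   ('e \<Rightarrow> real) set \<Rightarrow> (('e \<Rightarrow> real) \<Rightarrow> 'e \<Rightarrow> real) \<Rightarrow> bool" where
  "is_generator \<pi> T D L \<longleftrightarrow>
     D = {f \<in> L2 \<pi>. \<exists>g\<in>L2 \<pi>. has_L2_derivative \<pi> T f g} \<and>
     (\<forall>f\<in>D. L f \<in> L2 \<pi> \<and> has_L2_derivative \<pi> T f (L f))"

text \<open>
  The operator \<open>L\<close> with domain \<open>D\<close> is the generator of the strongly continuous semigroup of the
  Markov process \<open>X\<close> with invariant measure \<open>\<pi>\<close>.
\<close>

definition markov_generator ::
  "'e measure \<Rightarrow> 'w measure \<Rightarrow> ('e \<Rightarrow> 'w measure) \<Rightarrow> (real \<Rightarrow> 'w \<Rightarrow> 'e) \<Rightarrow>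
   ('e \<Rightarrow> real) set \<Rightarrow> (('e \<Rightarrow> real) \<Rightarrow> 'e \<Rightarrow> real) \<Rightarrow> bool" where
  "markov_generator \<pi> W Q X D L \<longleftrightarrow>
     markov_process \<pi> W Q X \<and> invariant_measure \<pi> Q X \<and>
     strongly_continuous \<pi> (semigroup Q X) \<and> is_generator \<pi> (semigroup Q X) D L"

section \<open>Perturbations\<close>

text \<open>
  \<open>D\<^sub>0\<close> is the domain of the unperturbed operator. Sums of operators are defined on the intersection
  of the domains.
\<close>

definition reversible_perturbation ::
  "'e measure \<Rightarrow> 'w measure \<Rightarrow> ('e \<Rightarrow> 'w measure) \<Rightarrow> (real \<Rightarrow> 'w \<Rightarrow> 'e) \<Rightarrow>
   ('e \<Rightarrow> real) set \<Rightarrow> (('e \<Rightarrow> real) \<Rightarrow> 'e \<Rightarrow> real) \<Rightarrow>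
   ('e \<Rightarrow> real) set \<Rightarrow> (('e \<Rightarrow> real) \<Rightarrow> 'e \<Rightarrow> real) \<Rightarrow> bool" where
  "reversible_perturbation \<pi> W Q X D\<^sub>0 L\<^sub>0 D\<^sub>S S \<longleftrightarrow>
     linear_operator \<pi> D\<^sub>S S \<and> D\<^sub>0 \<subseteq> D\<^sub>S \<and>
     markov_generator \<pi> W Q X (D\<^sub>0 \<inter> D\<^sub>S) (\<lambda>f x. L\<^sub>0 f x + S f x) \<and>
     self_adjoint \<pi> (D\<^sub>0 \<inter> D\<^sub>S) (\<lambda>f x. L\<^sub>0 f x + S f x) \<and>
     (\<forall>f\<in>D\<^sub>S. \<forall>g\<in>D\<^sub>S. L2_inner \<pi> f (S g) = L2_inner \<pi> (S f) g) \<and>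
     (\<forall>f\<in>D\<^sub>S. L2_inner \<pi> f (S f) \<le> 0)"

text \<open>Here \<open>D\<^sub>1\<close> and \<open>L\<^sub>1\<close> stand for \<open>L\<^sub>0 + S\<close>.\<close>

definition irreversible_perturbation ::
  "'e measure \<Rightarrow> 'w measure \<Rightarrow> ('e \<Rightarrow> 'w measure) \<Rightarrow> (real \<Rightarrow> 'w \<Rightarrow> 'e) \<Rightarrow>
   ('e \<Rightarrow> real) set \<Rightarrow> (('e \<Rightarrow> real) \<Rightarrow> 'e \<Rightarrow> real) \<Rightarrow>
   ('e \<Rightarrow> real) set \<Rightarrow> (('e \<Rightarrow> real) \<Rightarrow> 'e \<Rightarrow> real) \<Rightarrow> bool" where
  "irreversible_perturbation \<pi> W Q X D\<^sub>1 L\<^sub>1 D\<^sub>A A \<longleftrightarrow>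
     linear_operator \<pi> D\<^sub>A A \<and> D\<^sub>1 \<subseteq> D\<^sub>A \<and>
     markov_generator \<pi> W Q X (D\<^sub>1 \<inter> D\<^sub>A) (\<lambda>f x. L\<^sub>1 f x + A f x) \<and>
     (\<forall>f\<in>D\<^sub>A. \<forall>g\<in>D\<^sub>A. L2_inner \<pi> f (A g) = - L2_inner \<pi> (A f) g)"

end

theory Submission
  imports Defs "HOL-Library.Function_Algebras"
begin

text \<open>
  By self-adjointness, the absence of spectrum in \<open>(\<lambda>\<^sub>0, 0)\<close> and ergodicity (which makes the kernel of
  \<open>L\<^sub>0\<close> the constants), every \<open>d\<close> between \<open>\<lambda>\<^sub>0\<close> and \<open>0\<close> satisfies the Poincare inequality
  \<open>\<langle>f, L\<^sub>0 f\<rangle> \<le> d \<parallel>f\<parallel>\<^sup>2\<close> for \<open>f\<close> orthogonal to the constants. It is inherited by \<open>L\<close>, since \<open>S\<close> is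
  negative and \<open>A\<close> does not contribute to the quadratic form. Hence \<open>z - L\<close> is bounded below on the
  complement of the constants if \<open>Re z > d\<close>, and it is onto because this is true for large real \<open>z\<close>,
  \<open>L\<close> being the generator of a contraction semigroup. The constants contribute the spectral value
  \<open>0\<close> only.

  Unbounded operators are treated as graphs, that is, subspaces of \<open>H \<times> H\<close>, on a space \<open>H\<close> that is
  complete with respect to a positive semidefinite form; thus functions need not be replaced by their
  classes modulo null sets.
\<close>

section \<open>Spaces with a complete semidefinite inner product\<close>

text \<open>The form yields lower bounds for \<open>z - L\<close>, but \<open>L\<close> is not
  symmetric and its adjoint is never described, so a lower bound alone does not give dense range.
  Some point with dense range must be known beforehand, and the semigroup supplies it. If the real
  number \<open>w\<close> is so large that |z - w| < w - d, one perturbation step leads from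
  \<open>w\<close> to \<open>z\<close>, without continuation along a path. The spectral theorem for
  \<open>L\<^sub>0\<close> is replaced by two elementary arguments: positivity of (L - c)^2 - \<rho>
  as a form, and Cauchy-Schwarz for the form of - L. Both use only real points of the resolvent set.
  Linearity of the semigroup and the semigroup law hold only almost everywhere. Hence equalities of
  vectors are tested against all vectors of \<open>H\<close>, and generators are relations. Complex
  functions appear as pairs of real ones. The auxiliary real \<open>d\<close> is needed because
  \<open>spectral_gap\<close> is an extended real that may be minus infinity.\<close>

lemma quadratic_form_discriminant:
  fixes A B C :: real
  assumes "\<And>t. 0 \<le> A + 2 * t * B + t\<^sup>2 * C"
  shows "B\<^sup>2 \<le> A * C"
proof (cases "C = 0")
  case True
  have "B = 0"
  proof (rule ccontr)
    assume "B \<noteq> 0"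
    \<comment> \<open>With \<open>C = 0\<close> the polynomial is linear, and this is the point
      where it equals -1.\<close>
    with assms[of "- (A + 1) / (2 * B)"] True show False
      by (simp add: field_simps)
  qed
  with True show ?thesis by simp
next
  case False
  have "C \<ge> 0"
  proof (rule ccontr)
    assume "\<not> C \<ge> 0"
    then have C: "C < 0" by simp
    \<comment> \<open>So large that the quadratic term outweighs the others; the final 1 ensures t
      \<ge> 1, so that \<open>\<bar>A\<bar>\<close> is at most
      \<open>t * \<bar>A\<bar>\<close>.\<close>
    define t where "t = (1 + \<bar>A\<bar> + 2 * \<bar>B\<bar>) / - C + 1"
    have t: "t \<ge> 1" using C by (simp add: t_def field_simps)
    have "t * - C \<ge> 1 + \<bar>A\<bar> + 2 * \<bar>B\<bar>"
      using C by (simp add: t_def field_simps)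
    then have "t * (t * - C) \<ge> t * (1 + \<bar>A\<bar> + 2 * \<bar>B\<bar>)"
      using t by (intro mult_left_mono) auto
    moreover have "t * (1 + \<bar>A\<bar>) \<ge> 1 * (1 + \<bar>A\<bar>)"
      using t by (intro mult_right_mono) auto
    moreover have "t * B \<le> t * \<bar>B\<bar>" using t by (intro mult_left_mono) auto
    ultimately have "A + 2 * t * B + t\<^sup>2 * C < 0"
      by (simp add: power2_eq_square algebra_simps)
    with assms[of t] show False by simp
  qed
  with False have "C > 0" by simp
  then show ?thesis
    using assms[of "- B / C"] by (simp add: field_simps power2_eq_square)
qed

text \<open>Symmetry and nonnegativity are required on the whole type, linearity only on
  \<open>H\<close>. This fits \<open>L2_inner\<close>: outside the square integrable functions the
  integral may take its default value 0, which keeps the first two but can destroy additivity.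
  Limits are unique only up to vectors of norm 0.\<close>

locale semi_hilbert =
  fixes H :: "'v::real_vector set" and ip :: "'v \<Rightarrow> 'v \<Rightarrow> real"
  assumes subspace_H: "subspace H"
    and ip_commute: "ip x y = ip y x"
    and ip_nonneg [simp]: "0 \<le> ip x x"
    and ip_add_left: "\<lbrakk>x \<in> H; y \<in> H; z \<in> H\<rbrakk> \<Longrightarrow> ip (x + y) z = ip x z + ip y z"
    and ip_scaleR_left: "\<lbrakk>x \<in> H; y \<in> H\<rbrakk> \<Longrightarrow> ip (c *\<^sub>R x) y = c * ip x y"
    and complete_H: "\<lbrakk>\<And>n. X n \<in> H; \<And>e. 0 < e \<Longrightarrow> \<exists>N::nat. \<forall>m\<ge>N. \<forall>n\<ge>N. sqrt (ip (X m - X n) (X m - X n)) < e\<rbrakk>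
      \<Longrightarrow> \<exists>x\<in>H. (\<lambda>n. sqrt (ip (X n - x) (X n - x))) \<longlonglongrightarrow> 0"
begin

section \<open>Calculus of the seminorm\<close>

definition nrm :: "'v \<Rightarrow> real" where
  "nrm x = sqrt (ip x x)"

lemma nrm_nonneg [simp]: "0 \<le> nrm x"
  by (simp add: nrm_def)

lemma nrm_sq: "(nrm x)\<^sup>2 = ip x x"
  by (simp add: nrm_def)

lemma mem_H [simp, intro]:
  "0 \<in> H"
  "\<lbrakk>x \<in> H; y \<in> H\<rbrakk> \<Longrightarrow> x + y \<in> H"
  "\<lbrakk>x \<in> H; y \<in> H\<rbrakk> \<Longrightarrow> x - y \<in> H"
  "x \<in> H \<Longrightarrow> c *\<^sub>R x \<in> H"
  "x \<in> H \<Longrightarrow> - x \<in> H"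
  using subspace_H by (auto intro: subspace_0 subspace_add subspace_diff subspace_scale subspace_neg)

lemma ip_zero [simp]: "x \<in> H \<Longrightarrow> ip 0 x = 0" "x \<in> H \<Longrightarrow> ip x 0 = 0"
  using ip_scaleR_left[of x x 0] ip_scaleR_left[of 0 x 0] by (auto simp: ip_commute)

lemma ip_minus_left: "\<lbrakk>x \<in> H; y \<in> H\<rbrakk> \<Longrightarrow> ip (- x) y = - ip x y"
  using ip_scaleR_left[of x y "-1"] by simp

lemma ip_diff_left: "\<lbrakk>x \<in> H; y \<in> H; z \<in> H\<rbrakk> \<Longrightarrow> ip (x - y) z = ip x z - ip y z"
  using ip_add_left[of x "- y" z] by (simp add: ip_minus_left)

lemma ip_right:
  "\<lbrakk>x \<in> H; y \<in> H; z \<in> H\<rbrakk> \<Longrightarrow> ip z (x + y) = ip z x + ip z y"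
  "\<lbrakk>x \<in> H; y \<in> H; z \<in> H\<rbrakk> \<Longrightarrow> ip z (x - y) = ip z x - ip z y"
  "\<lbrakk>x \<in> H; z \<in> H\<rbrakk> \<Longrightarrow> ip z (c *\<^sub>R x) = c * ip z x"
  "\<lbrakk>x \<in> H; z \<in> H\<rbrakk> \<Longrightarrow> ip z (- x) = - ip z x"
  by (simp_all add: ip_commute[of z] ip_add_left ip_diff_left ip_scaleR_left ip_minus_left)

lemmas ip_simps = ip_add_left ip_diff_left ip_scaleR_left ip_minus_left ip_right

lemma expand_sq:
  "\<lbrakk>x \<in> H; y \<in> H\<rbrakk> \<Longrightarrow> ip (x + t *\<^sub>R y) (x + t *\<^sub>R y) = ip x x + 2 * t * ip x y + t\<^sup>2 * ip y y"
  by (simp add: ip_simps power2_eq_square algebra_simps ip_commute[of y x])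

lemma Cauchy_Schwarz_sq: "\<lbrakk>x \<in> H; y \<in> H\<rbrakk> \<Longrightarrow> (ip x y)\<^sup>2 \<le> ip x x * ip y y"
  by (rule quadratic_form_discriminant) (simp flip: expand_sq)

lemma Cauchy_Schwarz: assumes "x \<in> H" "y \<in> H" shows "\<bar>ip x y\<bar> \<le> nrm x * nrm y"
proof -
  have "\<bar>ip x y\<bar> = sqrt ((ip x y)\<^sup>2)" by simp
  also have "\<dots> \<le> sqrt (ip x x * ip y y)"
    using Cauchy_Schwarz_sq[OF assms] by (simp only: real_sqrt_le_iff)
  finally show ?thesis by (simp add: nrm_def real_sqrt_mult)
qed

lemma Cauchy_Schwarz_le: "\<lbrakk>x \<in> H; y \<in> H\<rbrakk> \<Longrightarrow> ip x y \<le> nrm x * nrm y"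
  using Cauchy_Schwarz by force

lemma nrm_zero [simp]: "nrm 0 = 0"
  by (simp add: nrm_def)

lemma nrm_scaleR: "x \<in> H \<Longrightarrow> nrm (c *\<^sub>R x) = \<bar>c\<bar> * nrm x"
  by (simp add: nrm_def ip_simps real_sqrt_mult flip: mult.assoc power2_eq_square)

lemma nrm_minus: "x \<in> H \<Longrightarrow> nrm (- x) = nrm x"
  using nrm_scaleR[of x "-1"] by simp

lemma nrm_triangle: assumes "x \<in> H" "y \<in> H" shows "nrm (x + y) \<le> nrm x + nrm y"
proof (rule power2_le_imp_le)
  show "(nrm (x + y))\<^sup>2 \<le> (nrm x + nrm y)\<^sup>2"
    using assms Cauchy_Schwarz_le[OF assms]
    by (simp add: nrm_sq power2_sum ip_simps ip_commute[of y x])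
qed simp

lemma nrm_triangle_diff: "\<lbrakk>x \<in> H; y \<in> H\<rbrakk> \<Longrightarrow> nrm (x - y) \<le> nrm x + nrm y"
  using nrm_triangle[of x "- y"] by (simp add: nrm_minus)

lemma nrm_diff_commute: "\<lbrakk>x \<in> H; y \<in> H\<rbrakk> \<Longrightarrow> nrm (x - y) = nrm (y - x)"
  using nrm_minus[of "x - y"] by simp

lemma nrm_triangle_mid: "\<lbrakk>x \<in> H; y \<in> H; z \<in> H\<rbrakk> \<Longrightarrow> nrm (x - z) \<le> nrm (x - y) + nrm (y - z)"
  using nrm_triangle[of "x - y" "y - z"] by simp

lemma nrm_le_add_diff: "\<lbrakk>x \<in> H; y \<in> H\<rbrakk> \<Longrightarrow> nrm x \<le> nrm y + nrm (x - y)"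
  using nrm_triangle[of y "x - y"] by simp

lemma nrm_null: "nrm x = 0 \<longleftrightarrow> ip x x = 0"
  by (simp add: nrm_def)

text \<open>The bridge from identities tested against \<open>H\<close> to norms: \<open>x\<close>,
  \<open>y\<close> and \<open>x - y\<close> are themselves admissible test vectors.\<close>

lemma nrm_cong_weak:
  assumes "x \<in> H" "y \<in> H" "\<And>u. u \<in> H \<Longrightarrow> ip x u = ip y u"
  shows "nrm x = nrm y" "nrm (x - y) = 0"
  using assms(3)[of x] assms(3)[of y] assms(3)[of "x - y"] assms
  by (simp_all add: nrm_def ip_commute[of x y] ip_simps)

lemma complete: "\<lbrakk>\<And>n. X n \<in> H; \<And>e. 0 < e \<Longrightarrow> \<exists>N::nat. \<forall>m\<ge>N. \<forall>n\<ge>N. nrm (X m - X n) < e\<rbrakk>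
      \<Longrightarrow> \<exists>x\<in>H. (\<lambda>n. nrm (X n - x)) \<longlonglongrightarrow> 0"
  using complete_H[of X] unfolding nrm_def by blast

lemma tendsto_nrm_diff:
  assumes X: "\<And>n. X n \<in> H" and x: "x \<in> H" and y: "y \<in> H" and lim: "((\<lambda>n. nrm (X n - x)) \<longlongrightarrow> 0) F"
  shows "((\<lambda>n. nrm (X n - y)) \<longlongrightarrow> nrm (x - y)) F"
proof (rule LIM_zero_cancel, rule Lim_null_comparison)
  show "\<forall>\<^sub>F n in F. norm (nrm (X n - y) - nrm (x - y)) \<le> nrm (X n - x)"
  proof (intro always_eventually allI)
    fix n
    have "nrm (X n - y) \<le> nrm (X n - x) + nrm (x - y)"
      using X x y by (intro nrm_triangle_mid)
    moreover have "nrm (x - y) \<le> nrm (X n - x) + nrm (X n - y)"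
      using nrm_triangle_mid[of x "X n" y] X x y by (simp add: nrm_diff_commute)
    ultimately show "norm (nrm (X n - y) - nrm (x - y)) \<le> nrm (X n - x)" by auto
  qed
qed (rule lim)

text \<open>A minimizing sequence in \<open>R\<close> for the distance to \<open>h\<close> is Cauchy
  by the parallelogram law. Its limit \<open>p\<close> represents the projection onto the closure of
  \<open>R\<close>, so \<open>h - p\<close> is orthogonal to \<open>R\<close> and therefore
  null.\<close>

lemma dense_of_trivial_complement:
  assumes R: "subspace R" "R \<subseteq> H"
    and triv: "\<And>u. \<lbrakk>u \<in> H; \<And>r. r \<in> R \<Longrightarrow> ip r u = 0\<rbrakk> \<Longrightarrow> ip u u = 0"
    and h: "h \<in> H" and e: "0 < e"
  shows "\<exists>r\<in>R. nrm (h - r) < e"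
proof -
  have RH: "r \<in> H" if "r \<in> R" for r using that R by auto
  define d where "d = (INF r\<in>R. ip (h - r) (h - r))"
  have ne: "R \<noteq> {}" using R subspace_0 by auto
  have bdd: "bdd_below ((\<lambda>r. ip (h - r) (h - r)) ` R)"
    by (rule bdd_belowI[of _ 0]) auto
  have d_le: "d \<le> ip (h - r) (h - r)" if "r \<in> R" for r
    unfolding d_def by (rule cINF_lower[OF bdd that])
  have "\<exists>r\<in>R. ip (h - r) (h - r) < d + 1 / Suc n" for n
    using cINF_less_iff[OF ne bdd, of "d + 1 / Suc n"] unfolding d_def by simp
  then obtain X where X: "\<And>n. X n \<in> R" and Xd: "\<And>n. ip (h - X n) (h - X n) < d + 1 / Suc n"
    by metis
  have XH: "X n \<in> H" for n using X RH by auto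
  \<comment> \<open>Parallelogram law; the midpoint of \<open>X m\<close> and \<open>X n\<close>
    lies in \<open>R\<close>, hence is at squared distance at least \<open>d\<close> from
    \<open>h\<close>.\<close>
  have par: "ip (X m - X n) (X m - X n) \<le> 2 / Suc m + 2 / Suc n" for m n
  proof -
    have "(1/2) *\<^sub>R (X m + X n) \<in> R"
      using X R by (intro subspace_scale subspace_add)
    from d_le[OF this]
    have "4 * d \<le> 4 * ip (h - (1/2) *\<^sub>R (X m + X n)) (h - (1/2) *\<^sub>R (X m + X n))" by simp
    also have "\<dots> = 2 * ip (h - X m) (h - X m) + 2 * ip (h - X n) (h - X n) - ip (X m - X n) (X m - X n)"
      using h XH[of m] XH[of n]
      by (simp add: ip_simps algebra_simps ip_commute[of "X m" h] ip_commute[of "X n" h] ip_commute[of "X n" "X m"])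
    finally show ?thesis using Xd[of m] Xd[of n] by simp
  qed
  have "\<exists>x\<in>H. (\<lambda>n. nrm (X n - x)) \<longlonglongrightarrow> 0"
  proof (rule complete[OF XH])
    fix e :: real assume e: "e > 0"
    then obtain N where N: "1 / real (Suc N) < e\<^sup>2 / 4"
      using nat_approx_posE[of "e\<^sup>2/4"] by auto
    have "nrm (X m - X n) < e" if "m \<ge> N" "n \<ge> N" for m n
    proof -
      have "2 / real (Suc m) \<le> 2 / real (Suc N)" "2 / real (Suc n) \<le> 2 / real (Suc N)"
        using that by (auto intro!: divide_left_mono)
      then have "(nrm (X m - X n))\<^sup>2 < e\<^sup>2"
        using par[of m n] N unfolding nrm_sq by simp
      then show ?thesis using e by (simp add: power2_less_imp_less)
    qed
    then show "\<exists>N. \<forall>m\<ge>N. \<forall>n\<ge>N. nrm (X m - X n) < e" by blast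
  qed
  then obtain p where p: "p \<in> H" "(\<lambda>n. nrm (X n - p)) \<longlonglongrightarrow> 0" by auto
  have lim: "(\<lambda>n. nrm (h - X n - y)) \<longlonglongrightarrow> nrm (h - p - y)" if "y \<in> H" for y
  proof -
    have "(\<lambda>n. nrm (X n - (h - y))) \<longlonglongrightarrow> nrm (p - (h - y))"
      using XH p h that by (intro tendsto_nrm_diff) auto
    moreover have "nrm (X n - (h - y)) = nrm (h - X n - y)" for n
      using nrm_minus[of "X n - (h - y)"] XH h that by (simp add: algebra_simps)
    moreover have "nrm (p - (h - y)) = nrm (h - p - y)"
      using nrm_minus[of "p - (h - y)"] p h that by (simp add: algebra_simps)
    ultimately show ?thesis by simp
  qed
  have "(\<lambda>n. (nrm (h - X n))\<^sup>2) \<longlonglongrightarrow> (nrm (h - p))\<^sup>2"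
    using lim[of 0] by (auto intro: tendsto_power)
  moreover have "(\<lambda>n. d + 1 / Suc n) \<longlonglongrightarrow> d + 0"
    by (intro tendsto_intros LIMSEQ_Suc[OF lim_1_over_n])
  ultimately have up: "ip (h - p) (h - p) \<le> d"
    using Xd by (intro LIMSEQ_le[of "\<lambda>n. (nrm (h - X n))\<^sup>2" _ "\<lambda>n. d + 1 / Suc n"])
      (auto simp: nrm_sq intro!: less_imp_le)
  have "ip (h - p) (h - p) = 0"
  proof (rule triv)
    fix r assume r: "r \<in> R"
    \<comment> \<open>Moving from \<open>p\<close> along \<open>r\<close> cannot lower the squared
      distance, so the quadratic polynomial in \<open>t\<close> without constant term is nonnegative
      and its linear coefficient vanishes.\<close>
    have "(ip (h - p) r)\<^sup>2 \<le> 0 * ip r r"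
    proof (rule quadratic_form_discriminant)
      fix t :: real
      have "(\<lambda>n. (nrm (h - X n - (-t) *\<^sub>R r))\<^sup>2) \<longlonglongrightarrow> (nrm (h - p - (-t) *\<^sub>R r))\<^sup>2"
        using RH[OF r] by (intro tendsto_power lim) auto
      moreover have "d \<le> (nrm (h - X n - (-t) *\<^sub>R r))\<^sup>2" for n
        using d_le[of "X n + (-t) *\<^sub>R r"] X r R
        by (simp add: nrm_sq subspace_diff subspace_scale algebra_simps)
      ultimately have "d \<le> (nrm (h - p - (-t) *\<^sub>R r))\<^sup>2"
        by (intro LIMSEQ_le_const) auto
      also have "\<dots> = ip (h - p) (h - p) + 2 * t * ip (h - p) r + t\<^sup>2 * ip r r"
        using expand_sq[of "h - p" r t] h p(1) RH[OF r] by (simp add: nrm_sq)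
      finally show "0 \<le> 0 + 2 * t * ip (h - p) r + t\<^sup>2 * ip r r" using up by simp
    qed
    then show "ip r (h - p) = 0" by (simp add: ip_commute)
  qed (use h p in auto)
  then have "(\<lambda>n. nrm (h - X n)) \<longlonglongrightarrow> 0"
    using lim[of 0] by (simp add: nrm_def)
  from order_tendstoD(2)[OF this e] obtain n where "nrm (h - X n) < e"
    by (auto dest: eventually_happens)
  then show ?thesis using X by auto
qed

end

section \<open>Quadratic forms and spectral gaps of symmetric operators\<close>

context semi_hilbert
begin

text \<open>Applied with \<open>V\<close> a graph: a form such as - <f, L f> is then bilinear in the
  pairs (f, L f), and no value of \<open>L\<close> has to be chosen.\<close>

lemma Cauchy_Schwarz_form:
  assumes V: "subspace V"
    and add: "\<And>x y z. \<lbrakk>x \<in> V; y \<in> V; z \<in> V\<rbrakk> \<Longrightarrow> b (x + y) z = b x z + b y z"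
    and scale: "\<And>x y c. \<lbrakk>x \<in> V; y \<in> V\<rbrakk> \<Longrightarrow> b (c *\<^sub>R x) y = c * b x y"
    and sym: "\<And>x y. \<lbrakk>x \<in> V; y \<in> V\<rbrakk> \<Longrightarrow> b x y = b y x"
    and pos: "\<And>x. x \<in> V \<Longrightarrow> 0 \<le> b x x"
    and xy: "x \<in> V" "y \<in> V"
  shows "(b x y)\<^sup>2 \<le> b x x * (b y y :: real)"
proof (rule quadratic_form_discriminant)
  fix t :: real
  have V': "t *\<^sub>R y \<in> V" "x + t *\<^sub>R y \<in> V"
    using V xy by (auto intro: subspace_add subspace_scale)
  have "b (x + t *\<^sub>R y) (x + t *\<^sub>R y) = b x (x + t *\<^sub>R y) + t * b y (x + t *\<^sub>R y)"
    using xy V' by (simp add: add scale)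
  also have "\<dots> = b x x + t * b y x + t * (b x y + t * b y y)"
    using xy V' by (simp add: sym[of _ "x + t *\<^sub>R y"] add scale)
  finally show "0 \<le> b x x + 2 * t * b x y + t\<^sup>2 * b y y"
    using pos[OF V'(2)] sym[OF xy] by (simp add: power2_eq_square algebra_simps)
qed

text \<open>
  For \<open>L\<close> symmetric and \<open>\<rho>\<close> the infimum of \<open>\<parallel>(L - c) f\<parallel>\<^sup>2 / \<parallel>f\<parallel>\<^sup>2\<close>, the form
  \<open>\<langle>(L - c) f, (L - c) g\<rangle> - \<rho> \<langle>f, g\<rangle>\<close> is positive. If both \<open>c - \<surd>\<rho>\<close> and \<open>c + \<surd>\<rho>\<close> were in the
  resolvent set, then evaluating it at \<open>f\<close> and the two resolvents applied to \<open>f\<close> would bound it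
  away from \<open>0\<close>.
\<close>

lemma symmetric_graph_bound:
  assumes G: "subspace G" "G \<subseteq> H \<times> H"
    and sym: "\<And>f g f' g'. \<lbrakk>(f, g) \<in> G; (f', g') \<in> G\<rbrakk> \<Longrightarrow> ip g f' = ip f g'"
    and surj: "\<And>s h. \<lbrakk>\<bar>s - c\<bar> < \<delta>; h \<in> H\<rbrakk> \<Longrightarrow> \<exists>(f, g)\<in>G. s *\<^sub>R f - g = h"
    and bdd: "\<And>s. \<bar>s - c\<bar> < \<delta> \<Longrightarrow> \<exists>C. \<forall>(f, g)\<in>G. nrm f \<le> C * nrm (s *\<^sub>R f - g)"
    and fg: "(f, g) \<in> G" and \<delta>: "0 < \<delta>"
  shows "\<delta>\<^sup>2 * ip f f \<le> ip (g - c *\<^sub>R f) (g - c *\<^sub>R f)"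
proof -
  have GH: "f \<in> H" "g \<in> H" if "(f, g) \<in> G" for f g using that G by auto
  have Gs: "(t *\<^sub>R f, t *\<^sub>R g) \<in> G" if "(f, g) \<in> G" for f g t
    using subspace_scale[OF G(1) that] by simp
  define U where "U = {(f, g). (f, g) \<in> G \<and> ip f f = 1}"
  define q where "q = (\<lambda>(f, g). ip (g - c *\<^sub>R f) (g - c *\<^sub>R f))"
  define \<rho> where "\<rho> = (INF x\<in>U. q x)"
  have bddU: "bdd_below (q ` U)" by (rule bdd_belowI[of _ 0]) (auto simp: q_def)
  have \<rho>_le: "\<rho> * ip f f \<le> q (f, g)" if "(f, g) \<in> G" for f g
  proof (cases "ip f f = 0")
    case False
    then have pos: "ip f f > 0" using ip_nonneg[of f] by linarith
    let ?t = "1 / nrm f"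
    have t: "?t * (?t * ip f f) = 1" using pos nrm_sq[of f] by (simp add: field_simps power2_eq_square)
    have "ip (?t *\<^sub>R f) (?t *\<^sub>R f) = ?t * (?t * ip f f)"
      using GH[OF that] by (simp only: ip_scaleR_left ip_right(3) mem_H)
    with t have "(?t *\<^sub>R f, ?t *\<^sub>R g) \<in> U"
      using that by (simp only: U_def Gs mem_Collect_eq case_prod_conv)
    then have "\<rho> \<le> q (?t *\<^sub>R f, ?t *\<^sub>R g)"
      unfolding \<rho>_def by (intro cINF_lower bddU)
    also have "\<dots> = ip (?t *\<^sub>R (g - c *\<^sub>R f)) (?t *\<^sub>R (g - c *\<^sub>R f))"
      by (simp add: q_def scaleR_diff_right)
    also have "\<dots> = ?t * (?t * q (f, g))"
      using GH[OF that] by (simp add: q_def ip_scaleR_left ip_right(3))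
    finally show ?thesis
      using pos nrm_sq[of f] by (simp add: field_simps power2_eq_square)
  qed (simp add: q_def)
  \<comment> \<open>The infimum over an empty \<open>U\<close> is unspecified, hence the premise;
    \<open>U\<close> is empty only if all vectors in the domain are null.\<close>
  have "\<delta>\<^sup>2 \<le> \<rho>" if ne: "U \<noteq> {}"
  proof (rule ccontr)
    assume "\<not> \<delta>\<^sup>2 \<le> \<rho>"
    moreover have "\<rho> \<ge> 0" unfolding \<rho>_def by (rule cINF_greatest[OF ne]) (auto simp: q_def)
    ultimately have "sqrt \<rho> < \<delta>" "sqrt \<rho> \<ge> 0"
      using \<delta> by (simp_all add: real_less_lsqrt)
    then obtain r where r: "0 \<le> r" "r < \<delta>" "r\<^sup>2 = \<rho>" using \<open>\<rho> \<ge> 0\<close> by (metis real_sqrt_pow2)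
    obtain C1 where C1: "\<And>f g. (f, g) \<in> G \<Longrightarrow> nrm f \<le> C1 * nrm ((c - r) *\<^sub>R f - g)"
      using bdd[of "c - r"] r by fastforce
    obtain C2 where C2: "\<And>f g. (f, g) \<in> G \<Longrightarrow> nrm f \<le> C2 * nrm ((c + r) *\<^sub>R f - g)"
      using bdd[of "c + r"] r by fastforce
    \<comment> \<open>Bounds \<open>b\<close> at the twofold resolvent of a unit vector, uniformly
      in that vector; the last 1 makes it positive.\<close>
    define M where "M = \<bar>C1\<bar>\<^sup>2 + 2 * r * (\<bar>C2\<bar> * \<bar>C1\<bar>) * \<bar>C1\<bar> + 1"
    have M: "M > 0" using r by (simp add: M_def add_nonneg_pos)
    define b where "b = (\<lambda>(x :: 'v \<times> 'v) (y :: 'v \<times> 'v). ip (snd x - c *\<^sub>R fst x) (snd y - c *\<^sub>R fst y) - \<rho> * ip (fst x) (fst y))"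
    have GH': "fst x \<in> H" "snd x \<in> H" if "x \<in> G" for x using that GH[of "fst x" "snd x"] by auto
    have b_CS: "(b x y)\<^sup>2 \<le> b x x * b y y" if "x \<in> G" "y \<in> G" for x y
    proof (rule Cauchy_Schwarz_form[OF G(1) _ _ _ _ that])
      fix x y z assume "x \<in> G" "y \<in> G" "z \<in> G"
      note * = this[THEN GH'(1)] this[THEN GH'(2)]
      show "b (x + y) z = b x z + b y z"
        using * by (simp add: b_def ip_simps algebra_simps)
    next
      fix x y t assume "x \<in> G" "y \<in> G"
      note * = this[THEN GH'(1)] this[THEN GH'(2)]
      show "b (t *\<^sub>R x) y = t * b x y"
        using * by (simp add: b_def ip_simps algebra_simps)
    next
      fix x y assume "x \<in> G" "y \<in> G"
      show "b x y = b y x" by (simp add: b_def ip_commute)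
    next
      fix x assume "x \<in> G"
      then show "0 \<le> b x x" using \<rho>_le[of "fst x" "snd x"] by (simp add: b_def q_def case_prod_beta)
    qed
    have low: "\<rho> + 1 / M \<le> q x" if x: "x \<in> U" for x
    proof -
      obtain f g where fg: "x = (f, g)" "(f, g) \<in> G" "ip f f = 1" using x by (auto simp: U_def)
      note fgH = GH[OF fg(2)]
      obtain y y' where y: "(y, y') \<in> G" "(c - r) *\<^sub>R y - y' = f"
        using surj[of "c - r" f] r fgH by fastforce
      note yH = GH[OF y(1)]
      obtain k k' where k: "(k, k') \<in> G" "(c + r) *\<^sub>R k - k' = y"
        using surj[of "c + r" y] r yH by fastforce
      note kH = GH[OF k(1)]
      have y': "y' - c *\<^sub>R y = - (r *\<^sub>R y) - f" using y(2) by (auto simp: algebra_simps)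
      have k': "k' - c *\<^sub>R k = r *\<^sub>R k - y" using k(2) by (auto simp: algebra_simps)
      have shift: "ip (g - c *\<^sub>R f) u = ip f (u' - c *\<^sub>R u)" if "(u, u') \<in> G" for u u'
        using sym[OF fg(2) that] GH[OF that] fgH by (simp add: ip_simps)
      \<comment> \<open>\<open>b\<close> is the form of (L - c)^2 - r^2 = (c - r - L) (c + r - L),
        an operator that maps \<open>k\<close> to \<open>f\<close>; so the value will be <f, f> =
        1.\<close>
      have "b (f, g) (k, k') = r * ip (g - c *\<^sub>R f) k - ip (g - c *\<^sub>R f) y - r\<^sup>2 * ip f k"
        using fgH kH yH by (simp add: b_def k' r ip_right)
      also have "\<dots> = r * ip f (r *\<^sub>R k - y) - ip f (- (r *\<^sub>R y) - f) - r\<^sup>2 * ip f k"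
        by (simp add: shift[OF k(1)] shift[OF y(1)] k' y')
      also have "\<dots> = 1"
        using fgH kH yH fg(3) by (simp add: ip_right power2_eq_square algebra_simps)
      finally have b1: "b (f, g) (k, k') = 1" .
      have nf: "nrm f = 1" using fg(3) by (simp add: nrm_def)
      have "nrm y \<le> C1 * 1" using C1[OF y(1)] y(2) nf by simp
      then have ny: "nrm y \<le> \<bar>C1\<bar>" by simp
      have "nrm k \<le> C2 * nrm y" using C2[OF k(1)] k(2) by simp
      also have "\<dots> \<le> \<bar>C2\<bar> * nrm y" by (intro mult_right_mono) auto
      also have "\<dots> \<le> \<bar>C2\<bar> * \<bar>C1\<bar>" using ny by (intro mult_left_mono) auto
      finally have nk: "nrm k \<le> \<bar>C2\<bar> * \<bar>C1\<bar>" .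
      have "b (k, k') (k, k') = ip y y - 2 * r * ip k y"
        using kH yH by (simp add: b_def k' r(3)[symmetric] ip_simps ip_commute[of y k] power2_eq_square algebra_simps)
      also have "\<dots> \<le> (nrm y)\<^sup>2 + 2 * r * (nrm k * nrm y)"
      proof -
        have "r * - ip k y \<le> r * (nrm k * nrm y)"
          using Cauchy_Schwarz[OF kH(1) yH(1)] r by (intro mult_left_mono) auto
        then show ?thesis by (simp add: nrm_sq)
      qed
      also have "\<dots> \<le> \<bar>C1\<bar>\<^sup>2 + 2 * r * ((\<bar>C2\<bar> * \<bar>C1\<bar>) * \<bar>C1\<bar>)"
        using ny nk r by (intro add_mono power_mono mult_left_mono mult_mono) auto
      finally have bk: "b (k, k') (k, k') \<le> M" by (simp add: M_def)
      have "b (f, g) (f, g) \<ge> 0" using \<rho>_le[OF fg(2)] by (simp add: b_def q_def)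
      have "1 \<le> b (f, g) (f, g) * b (k, k') (k, k')"
        using b_CS[OF fg(2) k(1)] b1 by simp
      also have "\<dots> \<le> b (f, g) (f, g) * M"
        using bk \<open>b (f, g) (f, g) \<ge> 0\<close> by (rule mult_left_mono)
      finally have "1 / M \<le> b (f, g) (f, g)" using M by (simp add: field_simps)
      then show ?thesis by (simp add: b_def q_def fg)
    qed
    then have "\<rho> + 1 / M \<le> \<rho>" unfolding \<rho>_def by (intro cINF_greatest[OF ne])
    then show False using M by simp
  qed
  moreover have "U \<noteq> {}" if nz: "ip f f \<noteq> 0"
  proof -
    have "(1 / nrm f) * ((1 / nrm f) * ip f f) = 1"
      using nz nrm_sq[of f] nrm_null[of f] by (simp add: field_simps power2_eq_square)
    moreover have "ip ((1 / nrm f) *\<^sub>R f) ((1 / nrm f) *\<^sub>R f) = (1 / nrm f) * ((1 / nrm f) * ip f f)"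
      using GH[OF fg] by (simp only: ip_scaleR_left ip_right(3) mem_H)
    ultimately have "((1 / nrm f) *\<^sub>R f, (1 / nrm f) *\<^sub>R g) \<in> U"
      using fg by (simp only: U_def Gs mem_Collect_eq case_prod_conv)
    then show ?thesis by blast
  qed
  ultimately have "\<delta>\<^sup>2 * ip f f \<le> \<rho> * ip f f"
    by (cases "ip f f = 0") (auto intro!: mult_right_mono)
  also have "\<dots> \<le> q (f, g)" by (rule \<rho>_le[OF fg])
  finally show ?thesis by (simp add: q_def)
qed

text \<open>
  The bound \<open>\<parallel>L f\<parallel>\<^sup>2 \<ge> d \<langle>f, L f\<rangle>\<close> (\<open>L\<close> has no spectrum in \<open>(d, 0)\<close>) turns into a bound on the
  quadratic form since, \<open>0\<close> not being an eigenvalue on the complement of \<open>e\<close>, a given \<open>f\<close> orthogonal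
  to \<open>e\<close> is close to some \<open>- L k\<close>; then apply Cauchy-Schwarz to \<open>\<langle>f, - L k\<rangle>\<close>.
\<close>

lemma spectral_gap_form_bound:
  assumes G: "subspace G" "G \<subseteq> H \<times> H"
    and sa: "\<And>u v. \<lbrakk>u \<in> H; v \<in> H; \<And>f g. (f, g) \<in> G \<Longrightarrow> ip g u = ip f v\<rbrakk> \<Longrightarrow> (u, v) \<in> G"
    and sym: "\<And>f g f' g'. \<lbrakk>(f, g) \<in> G; (f', g') \<in> G\<rbrakk> \<Longrightarrow> ip g f' = ip f g'"
    and neg: "\<And>f g. (f, g) \<in> G \<Longrightarrow> ip f g \<le> 0"
    and e: "(e, 0) \<in> G" "ip e e = 1"
    and ker: "\<And>f. \<lbrakk>(f, 0) \<in> G; ip f e = 0\<rbrakk> \<Longrightarrow> ip f f = 0"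
    and surj: "\<And>s h. \<lbrakk>d < s; s < 0; h \<in> H\<rbrakk> \<Longrightarrow> \<exists>(f, g)\<in>G. s *\<^sub>R f - g = h"
    and bdd: "\<And>s. \<lbrakk>d < s; s < 0\<rbrakk> \<Longrightarrow> \<exists>C. \<forall>(f, g)\<in>G. nrm f \<le> C * nrm (s *\<^sub>R f - g)"
    and d: "d < 0" and fg: "(f, g) \<in> G" "ip f e = 0"
  shows "ip f g \<le> d * ip f f"
proof -
  have GH: "f \<in> H" "g \<in> H" if "(f, g) \<in> G" for f g using that G by auto
  have eH: "e \<in> H" using GH[OF e(1)] by simp
  have L1: "d * ip f g \<le> ip g g" if fg: "(f, g) \<in> G" for f g
  proof -
    \<comment> \<open>The interval (d, 0) has centre d/2 and radius - d/2; when the square is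
      expanded, the terms in \<open>ip f f\<close> cancel.\<close>
    have "(- d / 2)\<^sup>2 * ip f f \<le> ip (g - (d / 2) *\<^sub>R f) (g - (d / 2) *\<^sub>R f)"
    proof (rule symmetric_graph_bound[OF G sym _ _ fg])
      fix s h assume "\<bar>s - d / 2\<bar> < - d / 2" "h \<in> H"
      then show "\<exists>(f, g)\<in>G. s *\<^sub>R f - g = h" by (intro surj) (auto simp: abs_less_iff)
    next
      fix s assume "\<bar>s - d / 2\<bar> < - d / 2"
      then show "\<exists>C. \<forall>(f, g)\<in>G. nrm f \<le> C * nrm (s *\<^sub>R f - g)"
        by (intro bdd) (auto simp: abs_less_iff)
    qed (use d in auto)
    then show ?thesis
      using GH[OF fg] by (simp add: ip_simps ip_commute[of g f] power2_eq_square algebra_simps)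
  qed
  have ge: "ip g e = 0" if "(f, g) \<in> G" for f g
    using sym[OF that e(1)] GH[OF that] by simp
  define R where "R = {m *\<^sub>R e - g | m k g. (k, g) \<in> G}"
  have RH: "R \<subseteq> H" using GH eH by (auto simp: R_def)
  have R: "subspace R"
  proof (rule subspaceI)
    show "0 \<in> R" using subspace_0[OF G(1)] unfolding R_def
      by (force simp: zero_prod_def intro!: exI[of _ 0])
  next
    fix x y assume "x \<in> R" "y \<in> R"
    then obtain m k g m' k' g' where "x = m *\<^sub>R e - g" "(k, g) \<in> G" "y = m' *\<^sub>R e - g'" "(k', g') \<in> G"
      by (auto simp: R_def)
    moreover from this have "(k + k', g + g') \<in> G" using subspace_add[OF G(1)] by fastforce
    ultimately show "x + y \<in> R" unfolding R_def
      by (intro CollectI exI[of _ "m + m'"] exI[of _ "k + k'"] exI[of _ "g + g'"]) (simp add: scaleR_add_left)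
  next
    fix t x assume "x \<in> R"
    then obtain m k g where "x = m *\<^sub>R e - g" "(k, g) \<in> G"
      by (auto simp: R_def)
    moreover from this have "(t *\<^sub>R k, t *\<^sub>R g) \<in> G" using subspace_scale[OF G(1)] by fastforce
    ultimately show "t *\<^sub>R x \<in> R" unfolding R_def
      by (intro CollectI exI[of _ "t * m"] exI[of _ "t *\<^sub>R k"] exI[of _ "t *\<^sub>R g"]) (simp add: scaleR_diff_right)
  qed
  \<comment> \<open>Orthogonality to the range of \<open>L\<close> puts (u, 0) into the graph by
    self-adjointness, and orthogonality to \<open>e\<close> then leaves only null vectors by
    \<open>ker\<close>.\<close>
  have triv: "ip u u = 0" if u: "u \<in> H" "\<And>r. r \<in> R \<Longrightarrow> ip r u = 0" for u
  proof (rule ker)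
    have "1 *\<^sub>R e - 0 \<in> R" unfolding R_def using e(1) by blast
    from u(2)[OF this] show ue: "ip u e = 0" by (simp add: ip_commute)
    show "(u, 0) \<in> G"
    proof (rule sa)
      fix f g assume fg: "(f, g) \<in> G"
      then have "0 *\<^sub>R e - g \<in> R" unfolding R_def by blast
      from u(2)[OF this] show "ip g u = ip f 0" using GH[OF fg] u eH by (simp add: ip_simps)
    qed (use u in auto)
  qed
  note fgH = GH[OF fg(1)]
  define a where "a = - ip f g"
  define \<mu> where "\<mu> = - d"
  have \<mu>: "\<mu> > 0" using d by (simp add: \<mu>_def)
  have a: "a \<ge> 0" using neg[OF fg(1)] by (simp add: a_def)
  have appr: "ip f f \<le> nrm f * \<epsilon> + sqrt (a / \<mu>) * (nrm f + \<epsilon>)" if \<epsilon>: "\<epsilon> > 0" for \<epsilon>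
  proof -
    obtain m k k' where k: "(k, k') \<in> G" and kf: "nrm (f - (m *\<^sub>R e - k')) < \<epsilon>"
      using dense_of_trivial_complement[OF R RH triv fgH(1) \<epsilon>] unfolding R_def by blast
    note kH = GH[OF k]
    define p where "p = f - (m *\<^sub>R e - k')"
    have pH: "p \<in> H" using fgH kH eH by (simp add: p_def)
    \<comment> \<open>Both \<open>f\<close> and \<open>k'\<close> are orthogonal to
      \<open>e\<close>, so dropping the multiple of \<open>e\<close> only improves the
      approximation.\<close>
    have "ip (f + k') (f + k') \<le> ip (f + k') (f + k') + m * m" by simp
    also have "\<dots> = ip p p"
    proof -
      have p_eq: "p = (f + k') - m *\<^sub>R e" by (simp add: p_def)
      have "ip (f + k') e = 0" using fg(2) ge[OF k] fgH kH eH by (simp add: ip_simps)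
      then show ?thesis
        unfolding p_eq using fgH kH eH e(2)
        by (simp add: ip_diff_left ip_scaleR_left ip_right(2,3) ip_commute[of e "f + k'"])
    qed
    finally have "nrm (f + k') \<le> nrm p" by (simp add: nrm_def)
    then have n: "nrm (f + k') < \<epsilon>" using kf by (simp add: p_def)
    have nk: "nrm k' \<le> nrm f + \<epsilon>"
      using nrm_triangle_diff[of "f + k'" f] n fgH kH by simp
    have "ip f f = ip f (f + k') + - ip f k'" using fgH kH by (simp add: ip_simps)
    moreover have "ip f (f + k') \<le> nrm f * \<epsilon>"
    proof -
      have "ip f (f + k') \<le> nrm f * nrm (f + k')" using fgH kH by (intro Cauchy_Schwarz_le) auto
      also have "\<dots> \<le> nrm f * \<epsilon>" using n by (intro mult_left_mono) auto
      finally show ?thesis .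
    qed
    moreover have "- ip f k' \<le> sqrt (a / \<mu>) * (nrm f + \<epsilon>)"
    proof -
      define b where "b = (\<lambda>(x :: 'v \<times> 'v) (y :: 'v \<times> 'v). - ip (fst x) (snd y))"
      have GH': "fst x \<in> H" "snd x \<in> H" if "x \<in> G" for x using that GH[of "fst x" "snd x"] by auto
      have "(b (f, g) (k, k'))\<^sup>2 \<le> b (f, g) (f, g) * b (k, k') (k, k')"
      proof (rule Cauchy_Schwarz_form[OF G(1) _ _ _ _ fg(1) k])
        fix x y z assume "x \<in> G" "y \<in> G" "z \<in> G"
        note * = this[THEN GH'(1)] this[THEN GH'(2)]
        show "b (x + y) z = b x z + b y z" using * by (simp add: b_def ip_simps)
      next
        fix x y t assume "x \<in> G" "y \<in> G"
        note * = this[THEN GH'(1)] this[THEN GH'(2)]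
        show "b (t *\<^sub>R x) y = t * b x y" using * by (simp add: b_def ip_simps)
      next
        fix x y assume "x \<in> G" "y \<in> G"
        then show "b x y = b y x"
          using sym[of "fst x" "snd x" "fst y" "snd y"] by (simp add: b_def ip_commute)
      next
        fix x assume "x \<in> G"
        then show "0 \<le> b x x" using neg[of "fst x" "snd x"] by (simp add: b_def)
      qed
      then have "(ip f k')\<^sup>2 \<le> a * - ip k k'" by (simp add: b_def a_def)
      also have "\<dots> \<le> a * ((nrm f + \<epsilon>)\<^sup>2 / \<mu>)"
      proof (rule mult_left_mono[OF _ a])
        \<comment> \<open>Only \<open>k'\<close> is controlled by the approximation, not
          \<open>k\<close>; the bound \<open>L1\<close> trades the form at \<open>k\<close> for the
          norm of \<open>k'\<close>.\<close>
        have "\<mu> * - ip k k' \<le> (nrm k')\<^sup>2" using L1[OF k] by (simp add: nrm_sq \<mu>_def)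
        also have "\<dots> \<le> (nrm f + \<epsilon>)\<^sup>2" using nk by (intro power_mono) auto
        finally show "- ip k k' \<le> (nrm f + \<epsilon>)\<^sup>2 / \<mu>" using \<mu> by (simp add: field_simps)
      qed
      also have "\<dots> = (sqrt (a / \<mu>) * (nrm f + \<epsilon>))\<^sup>2"
        using a \<mu> by (simp add: power_mult_distrib)
      finally have "\<bar>ip f k'\<bar> \<le> \<bar>sqrt (a / \<mu>) * (nrm f + \<epsilon>)\<bar>"
        by (simp add: abs_le_square_iff)
      moreover have "sqrt (a / \<mu>) * (nrm f + \<epsilon>) \<ge> 0" using a \<mu> \<epsilon> by simp
      ultimately show ?thesis by linarith
    qed
    ultimately show ?thesis by linarith
  qed
  have "ip f f \<le> sqrt (a / \<mu>) * nrm f"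
  proof (rule field_le_epsilon)
    fix \<eta> :: real assume \<eta>: "\<eta> > 0"
    define K where "K = nrm f + sqrt (a / \<mu>) + 1"
    have K: "K > 0" using a \<mu> by (simp add: K_def add_nonneg_pos)
    have "ip f f \<le> sqrt (a / \<mu>) * nrm f + (\<eta> / K) * (nrm f + sqrt (a / \<mu>))"
      using appr[of "\<eta> / K"] \<eta> K by (simp add: algebra_simps)
    also have "(\<eta> / K) * (nrm f + sqrt (a / \<mu>)) \<le> (\<eta> / K) * K"
      using \<eta> K by (intro mult_left_mono) (auto simp: K_def)
    finally show "ip f f \<le> sqrt (a / \<mu>) * nrm f + \<eta>" using K by simp
  qed
  then have "nrm f * nrm f \<le> sqrt (a / \<mu>) * nrm f" using nrm_sq[of f] by (simp add: power2_eq_square)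
  then have "nrm f \<le> sqrt (a / \<mu>) \<or> nrm f = 0"
    using nrm_nonneg[of f] by (meson linorder_neqE_linordered_idom mult_le_cancel_right not_less)
  then have "nrm f \<le> sqrt (a / \<mu>)" using a \<mu> by auto
  then have "(nrm f)\<^sup>2 \<le> (sqrt (a / \<mu>))\<^sup>2" by (rule power_mono) simp
  then have "ip f f * \<mu> \<le> a" using a \<mu> by (simp add: nrm_sq field_simps)
  then show ?thesis by (simp add: a_def \<mu>_def algebra_simps)
qed

end

section \<open>Generators of contraction semigroups\<close>

text \<open>The algebraic laws are tested against \<open>u\<close> because \<open>T t\<close> acts
  on representatives, where they may fail on null sets. Contraction and continuity involve only the
  seminorm and are stated with it.\<close>

locale contraction_semigroup = semi_hilbert H ip
  for H :: "'v::real_vector set" and ip +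
  fixes T :: "real \<Rightarrow> 'v \<Rightarrow> 'v"
  assumes T_mem [simp]: "\<lbrakk>0 \<le> t; f \<in> H\<rbrakk> \<Longrightarrow> T t f \<in> H"
    and T_add: "\<lbrakk>0 \<le> t; f \<in> H; g \<in> H; u \<in> H\<rbrakk> \<Longrightarrow> ip (T t (f + g)) u = ip (T t f) u + ip (T t g) u"
    and T_scaleR: "\<lbrakk>0 \<le> t; f \<in> H; u \<in> H\<rbrakk> \<Longrightarrow> ip (T t (c *\<^sub>R f)) u = c * ip (T t f) u"
    and T_contraction: "\<lbrakk>0 \<le> t; f \<in> H\<rbrakk> \<Longrightarrow> nrm (T t f) \<le> nrm f"
    and T_T: "\<lbrakk>0 \<le> s; 0 \<le> t; f \<in> H; u \<in> H\<rbrakk> \<Longrightarrow> ip (T s (T t f)) u = ip (T (s + t) f) u"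
    and T_0: "\<lbrakk>f \<in> H; u \<in> H\<rbrakk> \<Longrightarrow> ip (T 0 f) u = ip f u"
    and T_cont: "f \<in> H \<Longrightarrow> ((\<lambda>t. nrm (T t f - f)) \<longlongrightarrow> 0) (at_right 0)"
begin

section \<open>The generator as a closed dissipative graph\<close>

definition quot_err :: "real \<Rightarrow> 'v \<Rightarrow> 'v \<Rightarrow> 'v" where
  "quot_err t f g = (1 / t) *\<^sub>R (T t f - f) - g"

definition generator :: "('v \<times> 'v) set" where
  "generator = {(f, g). f \<in> H \<and> g \<in> H \<and> ((\<lambda>t. nrm (quot_err t f g)) \<longlongrightarrow> 0) (at_right 0)}"

lemma generator_mem: "(f, g) \<in> generator \<Longrightarrow> f \<in> H" "(f, g) \<in> generator \<Longrightarrow> g \<in> H"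
  by (auto simp: generator_def)

lemma T_minus: "\<lbrakk>0 \<le> t; f \<in> H; u \<in> H\<rbrakk> \<Longrightarrow> ip (T t (- f)) u = - ip (T t f) u"
  using T_scaleR[of t f u "-1"] by simp

lemma T_diff: "\<lbrakk>0 \<le> t; f \<in> H; g \<in> H; u \<in> H\<rbrakk> \<Longrightarrow> ip (T t (f - g)) u = ip (T t f) u - ip (T t g) u"
  using T_add[of t f "- g" u] by (simp add: T_minus)

lemmas T_simps = T_add T_diff T_scaleR T_minus T_T T_0

lemma quot_err_mem [simp]: "\<lbrakk>0 \<le> t; f \<in> H; g \<in> H\<rbrakk> \<Longrightarrow> quot_err t f g \<in> H"
  by (simp add: quot_err_def)

lemma at_right_0_pos: "\<forall>\<^sub>F t in at_right 0. (0::real) < t"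
  by (simp add: eventually_at_right_less)

lemma generatorI:
  assumes "f \<in> H" "g \<in> H" "(b \<longlongrightarrow> 0) (at_right 0)" "\<And>t. 0 < t \<Longrightarrow> nrm (quot_err t f g) \<le> b t"
  shows "(f, g) \<in> generator"
proof -
  have "((\<lambda>t. nrm (quot_err t f g)) \<longlongrightarrow> 0) (at_right 0)"
    by (rule tendsto_sandwich[OF _ _ tendsto_const assms(3)])
      (auto intro: eventually_mono[OF at_right_0_pos] assms(4))
  with assms(1,2) show ?thesis by (simp add: generator_def)
qed

lemma generator_lim: "(f, g) \<in> generator \<Longrightarrow> ((\<lambda>t. nrm (quot_err t f g)) \<longlongrightarrow> 0) (at_right 0)"
  by (simp add: generator_def)

lemma subspace_generator: "subspace generator"
proof (rule subspaceI)
  have "(0, 0) \<in> generator"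
  proof (rule generatorI)
    fix t :: real assume t: "0 < t"
    have "nrm (quot_err t 0 0) = nrm 0"
      by (rule nrm_cong_weak) (use t T_scaleR[of t 0 _ 0] in \<open>auto simp: quot_err_def ip_simps\<close>)
    then show "nrm (quot_err t 0 0) \<le> 0" by simp
  qed auto
  then show "0 \<in> generator" by (simp add: zero_prod_def)
next
  fix x y assume xy: "x \<in> generator" "y \<in> generator"
  obtain f g f' g' where eq: "x = (f, g)" "y = (f', g')" by (cases x, cases y)
  note m = generator_mem[OF xy(1)[unfolded eq]] generator_mem[OF xy(2)[unfolded eq]]
  have "(f + f', g + g') \<in> generator"
  proof (rule generatorI)
    show "((\<lambda>t. nrm (quot_err t f g) + nrm (quot_err t f' g')) \<longlongrightarrow> 0) (at_right 0)"
      using tendsto_add[OF xy[unfolded eq, THEN generator_lim]] by simp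
    fix t :: real assume t: "0 < t"
    have "nrm (quot_err t (f + f') (g + g')) = nrm (quot_err t f g + quot_err t f' g')"
      by (rule nrm_cong_weak) (use t m in \<open>auto simp: quot_err_def ip_simps T_simps algebra_simps\<close>)
    also have "\<dots> \<le> nrm (quot_err t f g) + nrm (quot_err t f' g')"
      using t m by (intro nrm_triangle) auto
    finally show "nrm (quot_err t (f + f') (g + g')) \<le> nrm (quot_err t f g) + nrm (quot_err t f' g')" .
  qed (use m in auto)
  then show "x + y \<in> generator" by (simp add: eq)
next
  fix c x assume x: "x \<in> generator"
  obtain f g where eq: "x = (f, g)" by (cases x)
  note m = generator_mem[OF x[unfolded eq]]
  have "(c *\<^sub>R f, c *\<^sub>R g) \<in> generator"
  proof (rule generatorI)
    show "((\<lambda>t. \<bar>c\<bar> * nrm (quot_err t f g)) \<longlongrightarrow> 0) (at_right 0)"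
      using tendsto_mult_right_zero[OF x[unfolded eq, THEN generator_lim]] by simp
    fix t :: real assume t: "0 < t"
    have "nrm (quot_err t (c *\<^sub>R f) (c *\<^sub>R g)) = nrm (c *\<^sub>R quot_err t f g)"
      by (rule nrm_cong_weak) (use t m in \<open>auto simp: quot_err_def ip_simps T_simps algebra_simps\<close>)
    then show "nrm (quot_err t (c *\<^sub>R f) (c *\<^sub>R g)) \<le> \<bar>c\<bar> * nrm (quot_err t f g)"
      using t m by (simp add: nrm_scaleR)
  qed (use m in auto)
  then show "c *\<^sub>R x \<in> generator" by (simp add: eq)
qed

lemma generator_unique:
  assumes "(f, g) \<in> generator" "(f, g') \<in> generator"
  shows "nrm (g - g') = 0"
proof -
  note m = generator_mem[OF assms(1)] generator_mem[OF assms(2)]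
  have "nrm (g - g') \<le> nrm (quot_err t f g') + nrm (quot_err t f g)" if "t > 0" for t
  proof -
    have "g - g' = quot_err t f g' - quot_err t f g" by (simp add: quot_err_def)
    also have "nrm \<dots> \<le> nrm (quot_err t f g') + nrm (quot_err t f g)"
      using m that by (intro nrm_triangle_diff) auto
    finally show ?thesis .
  qed
  then have "nrm (g - g') \<le> 0 + 0"
    by (intro tendsto_lowerbound[OF tendsto_add[OF assms(2,1)[THEN generator_lim]]])
      (auto intro: eventually_mono[OF at_right_0_pos])
  then show ?thesis using nrm_nonneg[of "g - g'"] by simp
qed

lemma generator_cong:
  assumes "(f, g) \<in> generator" "g' \<in> H" "nrm (g - g') = 0"
  shows "(f, g') \<in> generator"
proof (rule generatorI)
  note m = generator_mem[OF assms(1)]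
  fix t :: real assume t: "0 < t"
  have "quot_err t f g' = quot_err t f g + (g - g')" by (simp add: quot_err_def)
  also have "nrm \<dots> \<le> nrm (quot_err t f g) + nrm (g - g')"
    using m t assms(2) by (intro nrm_triangle) auto
  finally show "nrm (quot_err t f g') \<le> nrm (quot_err t f g)" using assms(3) by simp
qed (use assms generator_mem generator_lim in auto)

text \<open>Up to null vectors \<open>T s\<close> commutes with the difference quotients, and it
  does not increase their error.\<close>

lemma generator_T: 
  assumes "(f, g) \<in> generator" "0 \<le> s"
  shows "(T s f, T s g) \<in> generator"
proof (rule generatorI[OF _ _ generator_lim[OF assms(1)]])
  note m = generator_mem[OF assms(1)]
  show "T s f \<in> H" "T s g \<in> H" using m assms by auto
  fix t :: real assume t: "0 < t"
  have "nrm (quot_err t (T s f) (T s g)) = nrm (T s (quot_err t f g))"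
    by (rule nrm_cong_weak) (use t m assms in \<open>auto simp: quot_err_def ip_simps T_simps algebra_simps\<close>)
  also have "\<dots> \<le> nrm (quot_err t f g)" using t m assms by (intro T_contraction) auto
  finally show "nrm (quot_err t (T s f) (T s g)) \<le> nrm (quot_err t f g)" .
qed

text \<open>
  Telescoping \<open>T t f - f\<close> over \<open>n\<close> steps of length \<open>t / n\<close> replaces
  \<open>T t f - f = \<integral>\<^sub>0\<^sup>t T s g ds\<close>, so that no integration of vector valued functions is needed.
\<close>

lemma T_increment_bound:
  assumes fg: "(f, g) \<in> generator" and k: "k \<in> H" and t: "0 \<le> t"
    and \<epsilon>: "\<And>s. \<lbrakk>0 \<le> s; s \<le> t\<rbrakk> \<Longrightarrow> nrm (T s g - k) \<le> \<epsilon>"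
  shows "nrm (T t f - f - t *\<^sub>R k) \<le> t * \<epsilon>"
proof (cases "t = 0")
  case True
  have "nrm (T 0 f - f) = nrm 0"
    by (rule nrm_cong_weak) (use generator_mem[OF fg] in \<open>auto simp: ip_simps T_simps\<close>)
  then show ?thesis using True by simp
next
  case False
  then have t: "t > 0" using t by simp
  note m = generator_mem[OF fg]
  have step: "nrm (T (real i * h) f - f - (real i * h) *\<^sub>R k) \<le> real i * h * (nrm (quot_err h f g) + \<epsilon>)"
    if h: "h > 0" "real n * h = t" and i: "i \<le> n" for h n i
    using i
  proof (induction i)
    case 0
    have "nrm (T 0 f - f) = nrm 0"
      by (rule nrm_cong_weak) (use m in \<open>auto simp: ip_simps T_simps\<close>)
    then show ?case by simp
  next
    case (Suc i)
    define s where "s = real i * h"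
    have "real i * h \<le> real n * h" using Suc.prems h by (intro mult_right_mono) auto
    then have s: "0 \<le> s" "s \<le> t" using h by (auto simp: s_def)
    let ?x = "T s f - f - s *\<^sub>R k" and ?y = "h *\<^sub>R T s (quot_err h f g)" and ?z = "h *\<^sub>R (T s g - k)"
    have mem: "?x \<in> H" "?y \<in> H" "?z \<in> H" using m s h k by auto
    \<comment> \<open>One step adds \<open>T s\<close> applied to \<open>h\<close> times the
      difference quotient of \<open>f\<close>, which is \<open>g\<close> plus the error:
      \<open>?y\<close> carries the error and \<open>?z\<close> the deviation of
      \<open>T s g\<close> from \<open>k\<close>.\<close>
    have "nrm (T (s + h) f - f - (s + h) *\<^sub>R k) = nrm (?x + ?y + ?z)"
      by (rule nrm_cong_weak)
        (use m s h k in \<open>auto simp: quot_err_def ip_simps T_simps algebra_simps\<close>)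
    also have "\<dots> \<le> nrm ?x + nrm ?y + nrm ?z"
      using mem by (meson add_mono order.refl mem_H(2) nrm_triangle order.trans)
    also have "\<dots> \<le> s * (nrm (quot_err h f g) + \<epsilon>) + h * nrm (quot_err h f g) + h * \<epsilon>"
    proof (intro add_mono)
      show "nrm ?x \<le> s * (nrm (quot_err h f g) + \<epsilon>)" using Suc by (simp add: s_def)
      show "nrm ?y \<le> h * nrm (quot_err h f g)"
        using s m h T_contraction[of s "quot_err h f g"] by (simp add: nrm_scaleR)
      show "nrm ?z \<le> h * \<epsilon>" using s m h k \<epsilon>[OF s] by (simp add: nrm_scaleR)
    qed
    finally show ?case by (simp add: s_def algebra_simps)
  qed
  have "nrm (T t f - f - t *\<^sub>R k) \<le> t * (nrm (quot_err (t / Suc n) f g) + \<epsilon>)" for n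
    using step[of "t / Suc n" "Suc n" "Suc n"] t by simp
  moreover have "(\<lambda>n. t * (nrm (quot_err (t / Suc n) f g) + \<epsilon>)) \<longlonglongrightarrow> t * (0 + \<epsilon>)"
  proof (intro tendsto_intros filterlim_compose[OF generator_lim[OF fg]])
    have "(\<lambda>n. t / Suc n) \<longlonglongrightarrow> 0"
      using tendsto_mult[OF tendsto_const[of t] LIMSEQ_Suc[OF lim_1_over_n]] by simp
    then show "filterlim (\<lambda>n. t / Suc n) (at_right 0) sequentially"
      using t by (auto simp: filterlim_at)
  qed
  ultimately have "nrm (T t f - f - t *\<^sub>R k) \<le> t * (0 + \<epsilon>)"
    by (intro LIMSEQ_le_const) auto
  then show ?thesis by simp
qed

lemma T_fixed_of_kernel:
  assumes "(f, 0) \<in> generator" "0 \<le> t"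
  shows "nrm (T t f - f) = 0"
proof -
  have "nrm (T s 0 - 0) \<le> 0" if "0 \<le> s" for s
    using T_contraction[OF that, of 0] by simp
  then have "nrm (T t f - f - t *\<^sub>R 0) \<le> t * 0"
    by (intro T_increment_bound[OF assms(1)]) (use assms in auto)
  then show ?thesis using nrm_nonneg[of "T t f - f"] by simp
qed

text \<open>The increment bound for \<open>F n\<close> is taken around the fixed vector
  \<open>g\<close> instead of \<open>K n\<close>. For fixed \<open>t\<close> it survives the limit
  in \<open>n\<close>, and strong continuity at \<open>g\<close> makes the remaining error small
  relative to \<open>t\<close>.\<close>

lemma generator_closed:
  assumes F: "\<And>n. (F n, K n) \<in> generator" and fg: "f \<in> H" "g \<in> H"
    and lim: "(\<lambda>n. nrm (F n - f)) \<longlonglongrightarrow> 0" "(\<lambda>n. nrm (K n - g)) \<longlonglongrightarrow> 0"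
  shows "(f, g) \<in> generator"
proof -
  note m = generator_mem[OF F]
  have "((\<lambda>t. nrm (quot_err t f g)) \<longlongrightarrow> 0) (at_right 0)"
  proof (rule order_tendstoI)
    fix \<epsilon> :: real assume \<epsilon>: "0 < \<epsilon>"
    from order_tendstoD(2)[OF T_cont[OF fg(2)], of "\<epsilon> / 2"] \<epsilon>
    obtain b where b: "b > 0" "\<And>s. \<lbrakk>0 < s; s < b\<rbrakk> \<Longrightarrow> nrm (T s g - g) < \<epsilon> / 2"
      by (auto simp: eventually_at_right)
    have 0: "nrm (T 0 g - g) = nrm 0"
      by (rule nrm_cong_weak) (use fg in \<open>auto simp: ip_simps T_simps\<close>)
    have *: "nrm (T s g - g) \<le> \<epsilon> / 2" if "0 \<le> s" "s < b" for s
      using b(2)[of s] 0 that \<epsilon> by (cases "s = 0") auto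
    have "nrm (quot_err t f g) < \<epsilon>" if t: "0 < t" "t < b" for t
    proof -
      have "nrm (T t f - f - t *\<^sub>R g) \<le> 2 * nrm (F n - f) + t * (\<epsilon> / 2 + nrm (K n - g))" for n
      proof -
        let ?x = "T t (F n) - F n - t *\<^sub>R g"
        have "nrm ?x \<le> t * (\<epsilon> / 2 + nrm (K n - g))"
        proof (rule T_increment_bound[OF F fg(2)])
          fix s assume s: "0 \<le> s" "s \<le> t"
          have "nrm (T s (K n) - g) = nrm (T s (K n - g) + (T s g - g))"
            by (rule nrm_cong_weak) (use m fg s in \<open>auto simp: ip_simps T_simps\<close>)
          also have "\<dots> \<le> nrm (T s (K n - g)) + nrm (T s g - g)"
            using m fg s by (intro nrm_triangle) auto
          also have "\<dots> \<le> nrm (K n - g) + \<epsilon> / 2"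
            using m fg s t by (intro add_mono T_contraction *) auto
          finally show "nrm (T s (K n) - g) \<le> \<epsilon> / 2 + nrm (K n - g)" by simp
        qed (use t in auto)
        moreover have "nrm (T t f - f - t *\<^sub>R g) = nrm (?x - T t (F n - f) + (F n - f))"
          by (rule nrm_cong_weak) (use m fg t in \<open>auto simp: ip_simps T_simps\<close>)
        moreover have "nrm (?x - T t (F n - f) + (F n - f)) \<le> nrm (?x - T t (F n - f)) + nrm (F n - f)"
          using m fg t by (intro nrm_triangle) auto
        moreover have "nrm (?x - T t (F n - f)) \<le> nrm ?x + nrm (T t (F n - f))"
          using m fg t by (intro nrm_triangle_diff) auto
        moreover have "nrm (T t (F n - f)) \<le> nrm (F n - f)"
          using m fg t by (intro T_contraction) auto
        ultimately show ?thesis by linarith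
      qed
      moreover have "(\<lambda>n. 2 * nrm (F n - f) + t * (\<epsilon> / 2 + nrm (K n - g))) \<longlonglongrightarrow> 2 * 0 + t * (\<epsilon> / 2 + 0)"
        by (intro tendsto_intros lim)
      ultimately have "nrm (T t f - f - t *\<^sub>R g) \<le> 2 * 0 + t * (\<epsilon> / 2 + 0)"
        by (intro LIMSEQ_le_const) auto
      moreover have "T t f - f - t *\<^sub>R g = t *\<^sub>R quot_err t f g"
        using t by (simp add: quot_err_def scaleR_diff_right)
      ultimately have "t * nrm (quot_err t f g) \<le> t * (\<epsilon> / 2)"
        using t fg by (simp add: nrm_scaleR)
      then show ?thesis using t \<epsilon> by simp
    qed
    then show "\<forall>\<^sub>F t in at_right 0. nrm (quot_err t f g) < \<epsilon>"
      using b(1) by (auto simp: eventually_at_right)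
  next
    fix \<epsilon> :: real assume "\<epsilon> < 0"
    then show "\<forall>\<^sub>F t in at_right 0. \<epsilon> < nrm (quot_err t f g)"
      by (intro always_eventually allI less_le_trans[OF _ nrm_nonneg])
  qed
  with fg show ?thesis by (simp add: generator_def)
qed

text \<open>Contraction gives <T t f - f, f> \<le> 0; divide by \<open>t\<close> and let
  \<open>t\<close> tend to 0.\<close>

lemma generator_dissipative:
  assumes fg: "(f, g) \<in> generator"
  shows "ip f g \<le> 0"
proof -
  note m = generator_mem[OF fg]
  have "ip f g \<le> nrm f * nrm (quot_err t f g)" if t: "t > 0" for t
  proof -
    have "ip (T t f) f \<le> nrm (T t f) * nrm f" using t m by (intro Cauchy_Schwarz_le) auto
    also have "\<dots> \<le> nrm f * nrm f" using t m by (intro mult_right_mono T_contraction) auto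
    finally have "ip (T t f - f) f \<le> 0" using t m nrm_sq[of f] by (simp add: ip_simps power2_eq_square)
    then have le: "(1 / t) * ip (T t f - f) f \<le> 0" using t by (simp add: divide_nonpos_pos)
    have "ip f g = (1 / t) * ip (T t f - f) f - ip f (quot_err t f g)"
      using t m by (simp add: quot_err_def ip_simps ip_commute[of f "T t f"] algebra_simps)
    also have "\<dots> \<le> nrm f * nrm (quot_err t f g)"
      using le Cauchy_Schwarz[of f "quot_err t f g"] t m by (simp add: abs_le_iff)
    finally show ?thesis .
  qed
  then have "ip f g \<le> nrm f * 0"
    by (intro tendsto_lowerbound[OF tendsto_mult[OF tendsto_const generator_lim[OF fg]]])
      (auto intro: eventually_mono[OF at_right_0_pos])
  then show ?thesis by simp
qed

text \<open>
  If \<open>u\<close> is orthogonal to the range of \<open>w - L\<close>, then \<open>\<langle>T t f, u\<rangle>\<close> grows like \<open>exp (w t)\<close>, which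
  is impossible for a bounded function unless it vanishes.
\<close>

lemma generator_range_orth:
  assumes w: "0 < w" and u: "u \<in> H"
    and orth: "\<And>f g. (f, g) \<in> generator \<Longrightarrow> ip (w *\<^sub>R f - g) u = 0"
    and fg: "(f, g) \<in> generator"
  shows "ip f u = 0"
proof -
  note m = generator_mem[OF fg]
  \<comment> \<open>Discrete form of the exponential growth with step \<open>h\<close>; the
    right-hand side vanishes as \<open>h\<close> tends to 0.\<close>
  have bound: "\<bar>ip f u\<bar> \<le> nrm (quot_err h f g) * nrm u / w" if h: "h > 0" for h
  proof (rule ccontr)
    define \<delta> where "\<delta> = nrm (quot_err h f g) * nrm u"
    assume "\<not> \<bar>ip f u\<bar> \<le> nrm (quot_err h f g) * nrm u / w"
    then have gr: "\<bar>ip f u\<bar> - \<delta> / w > 0" by (simp add: \<delta>_def)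
    define a where "a = (\<lambda>i :: nat. ip (T (real i * h) f) u)"
    have a_Suc: "\<bar>a (Suc i)\<bar> \<ge> (1 + h * w) * \<bar>a i\<bar> - h * \<delta>" for i
    proof -
      define s where "s = real i * h"
      have s: "s \<ge> 0" using h by (simp add: s_def)
      define q where "q = ip (T s (quot_err h f g)) u"
      note TG = generator_T[OF fg s]
      \<comment> \<open>Orthogonality is used at the pair \<open>(T s f, T s g)\<close>, which stays
        in the generator.\<close>
      have "ip (T s g) u = w * a i"
        using orth[OF TG] generator_mem[OF TG] u by (simp add: ip_simps a_def s_def)
      moreover have "a (Suc i) = ip (T (s + h) f) u" by (simp add: a_def s_def algebra_simps)
      moreover have "h * q = ip (T (s + h) f) u - a i - h * ip (T s g) u"
        using h s u m unfolding q_def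
        by (simp add: quot_err_def ip_simps T_simps right_diff_distrib a_def s_def[symmetric])
      ultimately have "a (Suc i) = (1 + h * w) * a i + h * q" by (simp add: algebra_simps)
      moreover have "\<bar>q\<bar> \<le> \<delta>"
      proof -
        have "\<bar>q\<bar> \<le> nrm (T s (quot_err h f g)) * nrm u"
          unfolding q_def using s h m u by (intro Cauchy_Schwarz) auto
        also have "\<dots> \<le> \<delta>" unfolding \<delta>_def
          using s h m u by (intro mult_right_mono T_contraction) auto
        finally show ?thesis .
      qed
      then have "h * \<bar>q\<bar> \<le> h * \<delta>" using h by simp
      moreover have "\<bar>(1 + h * w) * a i\<bar> = (1 + h * w) * \<bar>a i\<bar>" using h w by (simp add: abs_mult)
      moreover have "\<bar>h * q\<bar> = h * \<bar>q\<bar>" using h by (simp add: abs_mult)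
      ultimately show ?thesis by linarith
    qed
    \<comment> \<open>\<delta> / w is the fixed point of x \<mapsto> (1 + h w) x - h \<delta>, so
      any excess over it is multiplied by at least 1 + h w in each step.\<close>
    have "(1 + h * w) ^ i * (\<bar>ip f u\<bar> - \<delta> / w) \<le> \<bar>a i\<bar> - \<delta> / w" for i
    proof (induction i)
      case 0
      then show ?case using m u by (simp add: a_def T_0)
    next
      case (Suc i)
      have "(1 + h * w) ^ Suc i * (\<bar>ip f u\<bar> - \<delta> / w) = (1 + h * w) * ((1 + h * w) ^ i * (\<bar>ip f u\<bar> - \<delta> / w))"
        by simp
      also have "\<dots> \<le> (1 + h * w) * (\<bar>a i\<bar> - \<delta> / w)"
        using Suc h w by (intro mult_left_mono) auto
      also have "\<dots> = (1 + h * w) * \<bar>a i\<bar> - h * \<delta> - \<delta> / w" using w by (simp add: field_simps)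
      also have "\<dots> \<le> \<bar>a (Suc i)\<bar> - \<delta> / w" using a_Suc[of i] by simp
      finally show ?case .
    qed
    moreover have "\<bar>a i\<bar> \<le> nrm f * nrm u" for i
    proof -
      have "\<bar>a i\<bar> \<le> nrm (T (real i * h) f) * nrm u"
        unfolding a_def using h m u by (intro Cauchy_Schwarz) auto
      also have "\<dots> \<le> nrm f * nrm u"
        using h m u by (intro mult_right_mono T_contraction) auto
      finally show ?thesis .
    qed
    moreover have "\<delta> / w \<ge> 0" using w by (simp add: \<delta>_def)
    ultimately have "(1 + h * w) ^ i * (\<bar>ip f u\<bar> - \<delta> / w) \<le> nrm f * nrm u" for i
      by (meson diff_left_mono diff_zero order_trans dual_order.trans le_diff_eq add_increasing2 diff_le_eq)
    moreover obtain i where "(nrm f * nrm u) / (\<bar>ip f u\<bar> - \<delta> / w) < (1 + h * w) ^ i"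
      using real_arch_pow[of "1 + h * w"] h w by auto
    ultimately show False using gr by (simp add: field_simps) (meson not_less)
  qed
  have "\<bar>ip f u\<bar> \<le> 0 * nrm u / w"
    by (rule tendsto_lowerbound[OF tendsto_divide[OF tendsto_mult[OF generator_lim[OF fg] tendsto_const] tendsto_const]])
      (use w in \<open>auto intro: eventually_mono[OF at_right_0_pos] bound\<close>)
  then show ?thesis by simp
qed

end

section \<open>Resolvents of non-symmetric generators\<close>

text \<open>The pair (x, y) stands for x + i y, and the form is the real part of the complex inner
  product. Real orthogonality to a complex subspace agrees with complex orthogonality, so the
  density criterion carries over.\<close>

lemma (in semi_hilbert) semi_hilbert_Times:
  "semi_hilbert (H \<times> H) (\<lambda>x y. ip (fst x) (fst y) + ip (snd x) (snd y))"
proof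
  show "subspace (H \<times> H)"
    by (intro subspace_Times subspace_H)
next
  fix X :: "nat \<Rightarrow> 'v \<times> 'v"
  assume X: "\<And>n. X n \<in> H \<times> H"
    and C: "\<And>e. 0 < e \<Longrightarrow> \<exists>N. \<forall>m\<ge>N. \<forall>n\<ge>N. sqrt (ip (fst (X m - X n)) (fst (X m - X n)) + ip (snd (X m - X n)) (snd (X m - X n))) < e"
  have XH: "fst (X n) \<in> H" "snd (X n) \<in> H" for n using X[of n] by (auto simp: mem_Times_iff)
  have le: "nrm x \<le> sqrt (ip x x + ip y y)" "nrm y \<le> sqrt (ip x x + ip y y)" for x y
    by (auto simp: nrm_def)
  have C': "\<exists>N. \<forall>m\<ge>N. \<forall>n\<ge>N. nrm (fst (X m) - fst (X n)) < e"
    "\<exists>N. \<forall>m\<ge>N. \<forall>n\<ge>N. nrm (snd (X m) - snd (X n)) < e" if e: "0 < e" for e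
  proof -
    obtain N where N: "\<And>m n. \<lbrakk>m \<ge> N; n \<ge> N\<rbrakk> \<Longrightarrow>
      sqrt (ip (fst (X m - X n)) (fst (X m - X n)) + ip (snd (X m - X n)) (snd (X m - X n))) < e"
      using C[OF e] by blast
    then have "nrm (fst (X m) - fst (X n)) < e" "nrm (snd (X m) - snd (X n)) < e" if "m \<ge> N" "n \<ge> N" for m n
      using that le_less_trans[OF le(1) N] le_less_trans[OF le(2) N] by (simp_all only: fst_diff snd_diff)
    then show "\<exists>N. \<forall>m\<ge>N. \<forall>n\<ge>N. nrm (fst (X m) - fst (X n)) < e"
      "\<exists>N. \<forall>m\<ge>N. \<forall>n\<ge>N. nrm (snd (X m) - snd (X n)) < e" by blast+
  qed
  obtain x where x: "x \<in> H" "(\<lambda>n. nrm (fst (X n) - x)) \<longlonglongrightarrow> 0"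
    using complete[OF XH(1) C'(1)] by blast
  obtain y where y: "y \<in> H" "(\<lambda>n. nrm (snd (X n) - y)) \<longlonglongrightarrow> 0"
    using complete[OF XH(2) C'(2)] by blast
  have "(\<lambda>n. sqrt ((nrm (fst (X n) - x))\<^sup>2 + (nrm (snd (X n) - y))\<^sup>2)) \<longlonglongrightarrow> sqrt (0\<^sup>2 + 0\<^sup>2)"
    using x y by (intro tendsto_intros)
  then show "\<exists>x\<in>H \<times> H. (\<lambda>n. sqrt (ip (fst (X n - x)) (fst (X n - x)) + ip (snd (X n - x)) (snd (X n - x)))) \<longlonglongrightarrow> 0"
    using x y by (intro bexI[of _ "(x, y)"]) (auto simp: nrm_sq)
next
  fix x y :: "'v \<times> 'v"
  show "ip (fst x) (fst y) + ip (snd x) (snd y) = ip (fst y) (fst x) + ip (snd y) (snd x)"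
    by (simp only: ip_commute)
qed (auto simp: ip_add_left ip_scaleR_left algebra_simps)



context semi_hilbert
begin

lemma pythagoras: "\<lbrakk>x \<in> H; e \<in> H; ip e e = 1; ip x e = 0\<rbrakk> \<Longrightarrow> ip (x + m *\<^sub>R e) (x + m *\<^sub>R e) = ip x x + m\<^sup>2"
  by (simp add: expand_sq)

text \<open>The two combinations are the real and imaginary parts of (c + i b) (x + i y).\<close>

lemma ip_complex_mult:
  assumes "x \<in> H" "y \<in> H"
  shows "ip (c *\<^sub>R x - b *\<^sub>R y) (c *\<^sub>R x - b *\<^sub>R y) + ip (b *\<^sub>R x + c *\<^sub>R y) (b *\<^sub>R x + c *\<^sub>R y)
    = (c\<^sup>2 + b\<^sup>2) * (ip x x + ip y y)"
  using assms by (simp add: ip_simps ip_commute[of y x] power2_eq_square algebra_simps)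

end

text \<open>What remains of a perturbed generator once symmetry is lost: the inequality
  \<open>gap\<close> on the complement of \<open>e\<close>, a closed graph, and a dense range of
  \<open>w - L\<close> for real \<open>w > 0\<close> as the semigroup provides it.\<close>

locale coercive_generator = semi_hilbert H ip
    for H :: "'v::real_vector set" and ip +
  fixes G :: "('v \<times> 'v) set" and e :: 'v and d :: real
  assumes G_subspace: "subspace G" and G_subset: "G \<subseteq> H \<times> H"
    and e_graph: "(e, 0) \<in> G" and e_unit: "ip e e = 1"
    and range_orth: "(f, g) \<in> G \<Longrightarrow> ip g e = 0"
    and gap_neg: "d < 0"
    and gap: "\<lbrakk>(f, g) \<in> G; ip f e = 0\<rbrakk> \<Longrightarrow> ip f g \<le> d * ip f f"
    and graph_closed: "\<lbrakk>\<And>n. (F n, K n) \<in> G; f \<in> H; g \<in> H; (\<lambda>n. nrm (F n - f)) \<longlonglongrightarrow> 0; (\<lambda>n. nrm (K n - g)) \<longlonglongrightarrow> 0\<rbrakk>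
      \<Longrightarrow> (f, g) \<in> G"
    and range_dense: "\<lbrakk>0 < w; u \<in> H; \<And>f g. (f, g) \<in> G \<Longrightarrow> ip (w *\<^sub>R f - g) u = 0\<rbrakk> \<Longrightarrow> ip u u = 0"
begin

lemma G_mem: "(f, g) \<in> G \<Longrightarrow> f \<in> H" "(f, g) \<in> G \<Longrightarrow> g \<in> H"
  using G_subset by auto

lemma e_mem [simp]: "e \<in> H"
  using G_mem(1)[OF e_graph] .

lemma G_add: "\<lbrakk>(f, g) \<in> G; (f', g') \<in> G\<rbrakk> \<Longrightarrow> (f + f', g + g') \<in> G"
  using subspace_add[OF G_subspace] by fastforce

lemma G_scale: "(f, g) \<in> G \<Longrightarrow> (c *\<^sub>R f, c *\<^sub>R g) \<in> G"
  using subspace_scale[OF G_subspace] by fastforce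

lemma G_center: "(f, g) \<in> G \<Longrightarrow> (f - m *\<^sub>R e, g) \<in> G"
  using G_add[OF _ G_scale[OF e_graph, of "- m"]] by fastforce

text \<open>With f = f1 + i f2 and r = (z - L) f, the terms in \<open>b\<close> cancel in Re <f, r>,
  which is therefore at least (a - d) times the squared norm of \<open>f\<close>; Cauchy-Schwarz in
  the pair space finishes.\<close>

lemma centered_coercive:
  assumes f: "(f1, g1) \<in> G" "(f2, g2) \<in> G" "ip f1 e = 0" "ip f2 e = 0" and a: "d < a"
    and r: "r1 = a *\<^sub>R f1 - b *\<^sub>R f2 - g1" "r2 = b *\<^sub>R f1 + a *\<^sub>R f2 - g2"
  shows "(a - d)\<^sup>2 * (ip f1 f1 + ip f2 f2) \<le> ip r1 r1 + ip r2 r2"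
proof -
  interpret K: semi_hilbert "H \<times> H" "\<lambda>x y. ip (fst x) (fst y) + ip (snd x) (snd y)"
    by (rule semi_hilbert_Times)
  note m = G_mem[OF f(1)] G_mem[OF f(2)]
  define q where "q = ip f1 f1 + ip f2 f2"
  have "ip f1 r1 + ip f2 r2 = a * q - ip f1 g1 - ip f2 g2"
    using m by (simp add: r q_def ip_right ip_commute[of f2 f1] algebra_simps)
  then have le: "(a - d) * q \<le> ip f1 r1 + ip f2 r2"
    using gap[OF f(1,3)] gap[OF f(2,4)] by (simp add: q_def algebra_simps)
  have q: "q \<ge> 0" by (simp add: q_def)
  have "((a - d) * q)\<^sup>2 \<le> (ip f1 r1 + ip f2 r2)\<^sup>2"
    using le q a by (intro power_mono) auto
  also have "\<dots> \<le> q * (ip r1 r1 + ip r2 r2)"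
    using K.Cauchy_Schwarz_sq[of "(f1, f2)" "(r1, r2)"] m by (simp add: r q_def)
  finally have "q * ((a - d)\<^sup>2 * q) \<le> q * (ip r1 r1 + ip r2 r2)"
    by (simp add: power2_eq_square algebra_simps)
  then have "(a - d)\<^sup>2 * q \<le> ip r1 r1 + ip r2 r2" if "q \<noteq> 0"
    using q that by (simp add: mult_le_cancel_left)
  then show ?thesis unfolding q_def[symmetric] by (cases "q = 0") auto
qed

text \<open>\<open>z - L\<close> respects the orthogonal splitting into multiples of
  \<open>e\<close> and their complement. On the first part it is multiplication by \<open>z\<close>,
  the origin of \<open>1 / (a\<^sup>2 + b\<^sup>2)\<close>; the second part contributes the
  coercivity constant.\<close>

lemma resolvent_bound:
  assumes f: "(f1, g1) \<in> G" "(f2, g2) \<in> G" and a: "d < a" and z: "a \<noteq> 0 \<or> b \<noteq> 0"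
    and r: "r1 = a *\<^sub>R f1 - b *\<^sub>R f2 - g1" "r2 = b *\<^sub>R f1 + a *\<^sub>R f2 - g2"
  shows "ip f1 f1 + ip f2 f2 \<le> (1 / (a\<^sup>2 + b\<^sup>2) + 1 / (a - d)\<^sup>2) * (ip r1 r1 + ip r2 r2)"
proof -
  define m1 where "m1 = ip f1 e"
  define m2 where "m2 = ip f2 e"
  define h1 where "h1 = f1 - m1 *\<^sub>R e"
  define h2 where "h2 = f2 - m2 *\<^sub>R e"
  define s1 where "s1 = a *\<^sub>R h1 - b *\<^sub>R h2 - g1"
  define s2 where "s2 = b *\<^sub>R h1 + a *\<^sub>R h2 - g2"
  note m = G_mem[OF f(1)] G_mem[OF f(2)]
  have h: "(h1, g1) \<in> G" "(h2, g2) \<in> G" using f by (auto simp: h1_def h2_def G_center)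
  have he: "ip h1 e = 0" "ip h2 e = 0"
    using m e_unit by (auto simp: h1_def h2_def m1_def m2_def ip_simps)
  note mh = G_mem[OF h(1)] G_mem[OF h(2)]
  have se: "ip s1 e = 0" "ip s2 e = 0"
    using mh he range_orth[OF h(1)] range_orth[OF h(2)] by (auto simp: s1_def s2_def ip_simps)
  have sH: "s1 \<in> H" "s2 \<in> H" using mh by (auto simp: s1_def s2_def)
  have f_eq: "f1 = h1 + m1 *\<^sub>R e" "f2 = h2 + m2 *\<^sub>R e" by (auto simp: h1_def h2_def)
  have r_eq: "r1 = s1 + (a * m1 - b * m2) *\<^sub>R e" "r2 = s2 + (b * m1 + a * m2) *\<^sub>R e"
    by (auto simp: r s1_def s2_def f_eq algebra_simps)
  define M where "M = m1\<^sup>2 + m2\<^sup>2"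
  define N where "N = a\<^sup>2 + b\<^sup>2"
  have N: "N > 0" using z by (auto simp: N_def sum_power2_gt_zero_iff)
  have F: "ip f1 f1 + ip f2 f2 = ip h1 h1 + ip h2 h2 + M"
    using mh he e_unit by (simp add: f_eq pythagoras M_def)
  have Rr: "ip r1 r1 + ip r2 r2 = ip s1 s1 + ip s2 s2 + N * M"
    unfolding r_eq pythagoras[OF sH(1) e_mem e_unit se(1)] pythagoras[OF sH(2) e_mem e_unit se(2)]
    by (simp add: M_def N_def power2_eq_square algebra_simps)
  have c: "(a - d)\<^sup>2 * (ip h1 h1 + ip h2 h2) \<le> ip s1 s1 + ip s2 s2"
    by (rule centered_coercive[OF h he a s1_def s2_def])
  have "ip h1 h1 + ip h2 h2 \<le> 1 / (a - d)\<^sup>2 * (ip s1 s1 + ip s2 s2)"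
    using c a by (simp add: field_simps)
  also have "\<dots> \<le> 1 / (a - d)\<^sup>2 * (ip r1 r1 + ip r2 r2)"
    unfolding Rr using N by (intro mult_left_mono) (auto simp: M_def)
  finally have 1: "ip h1 h1 + ip h2 h2 \<le> 1 / (a - d)\<^sup>2 * (ip r1 r1 + ip r2 r2)" .
  have "M = 1 / N * (N * M)" using N by simp
  also have "\<dots> \<le> 1 / N * (ip r1 r1 + ip r2 r2)"
    unfolding Rr using N by (intro mult_left_mono) auto
  finally show ?thesis using 1 unfolding F N_def[symmetric] distrib_right by simp
qed

text \<open>
  If \<open>u\<close> is orthogonal to the range of \<open>z - L\<close>, pick \<open>f\<close> with \<open>(w - L) f\<close> close to \<open>u\<close>
  for a large real \<open>w\<close>. Then \<open>\<parallel>u\<parallel>\<^sup>2 \<approx> \<langle>(w - z) f, u\<rangle> \<le> \<bar>w - z\<bar> / (w - d) \<parallel>u\<parallel>\<^sup>2\<close>, and the quotient is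
  smaller than \<open>1\<close>.
\<close>

lemma resolvent_range_dense:
  assumes a: "d < a" and z: "a \<noteq> 0 \<or> b \<noteq> 0" and u: "u1 \<in> H" "u2 \<in> H"
    and orth: "\<And>f1 g1 f2 g2. \<lbrakk>(f1, g1) \<in> G; (f2, g2) \<in> G\<rbrakk> \<Longrightarrow>
      ip (a *\<^sub>R f1 - b *\<^sub>R f2 - g1) u1 + ip (b *\<^sub>R f1 + a *\<^sub>R f2 - g2) u2 = 0"
  shows "ip u1 u1 + ip u2 u2 = 0"
proof -
  interpret K: semi_hilbert "H \<times> H" "\<lambda>x y. ip (fst x) (fst y) + ip (snd x) (snd y)"
    by (rule semi_hilbert_Times)
  have G0: "(0, 0) \<in> G" using subspace_0[OF G_subspace] by (simp add: zero_prod_def)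
  \<comment> \<open>Testing with \<open>e\<close> and i \<open>e\<close> gives a linear system of
    determinant |z|^2, which is nonzero.\<close>
  have ue: "ip e u1 = 0" "ip e u2 = 0"
  proof -
    define x where "x = ip e u1"
    define y where "y = ip e u2"
    have 1: "a * x + b * y = 0" "- b * x + a * y = 0"
      using orth[OF e_graph G0] orth[OF G0 e_graph] u by (simp_all add: x_def y_def ip_simps)
    have "(a\<^sup>2 + b\<^sup>2) * x = a * (a * x + b * y) - b * (- b * x + a * y)"
      "(a\<^sup>2 + b\<^sup>2) * y = b * (a * x + b * y) + a * (- b * x + a * y)"
      by (simp_all add: power2_eq_square algebra_simps)
    then have "(a\<^sup>2 + b\<^sup>2) * x = 0" "(a\<^sup>2 + b\<^sup>2) * y = 0" unfolding 1 by simp_all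
    then show "ip e u1 = 0" "ip e u2 = 0"
      using z by (auto simp: x_def y_def sum_power2_eq_zero_iff)
  qed
  \<comment> \<open>The condition |z - w| < w - d is equivalent to |z|^2 - d^2 < 2 w (a -
    d).\<close>
  define w where "w = \<bar>(a\<^sup>2 + b\<^sup>2 - d\<^sup>2) / (2 * (a - d))\<bar> + 1"
  have w: "w > 0" unfolding w_def by (rule add_nonneg_pos) auto
  have "(a\<^sup>2 + b\<^sup>2 - d\<^sup>2) / (2 * (a - d)) < w" unfolding w_def by linarith
  then have "a\<^sup>2 + b\<^sup>2 - d\<^sup>2 < 2 * w * (a - d)" using a by (simp add: field_simps)
  then have "(a - w)\<^sup>2 + b\<^sup>2 < (w - d)\<^sup>2" by (simp add: power2_eq_square algebra_simps)
  define \<kappa> where "\<kappa> = sqrt ((a - w)\<^sup>2 + b\<^sup>2) / (w - d)"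
  have wd: "w - d > 0" using w gap_neg by simp
  have \<kappa>: "0 \<le> \<kappa>" "\<kappa> < 1"
    using \<open>(a - w)\<^sup>2 + b\<^sup>2 < (w - d)\<^sup>2\<close> wd by (auto simp: \<kappa>_def real_less_lsqrt)
  define n where "n = sqrt (ip u1 u1 + ip u2 u2)"
  have n: "n \<ge> 0" "n * n = ip u1 u1 + ip u2 u2" by (simp_all add: n_def)
  have appr: "n * n \<le> \<epsilon> * n + \<kappa> * (n + \<epsilon>) * n" if \<epsilon>: "\<epsilon> > 0" for \<epsilon>
  proof -
    have ex: "\<exists>f g. (f, g) \<in> G \<and> ip f e = 0 \<and> nrm (v - (w *\<^sub>R f - g)) < \<epsilon> / 2"
      if v: "v \<in> H" "ip e v = 0" for v
    proof -
      define R where "R = (\<lambda>(f, g). w *\<^sub>R f - g) ` G"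
      have "linear (\<lambda>(f :: 'v, g). w *\<^sub>R f - g)"
        by (rule linearI) (auto simp: algebra_simps)
      then have "subspace R" unfolding R_def by (rule linear_subspace_image) (rule G_subspace)
      moreover have "R \<subseteq> H" using G_mem by (auto simp: R_def)
      moreover have "ip u u = 0" if "u \<in> H" "\<And>r. r \<in> R \<Longrightarrow> ip r u = 0" for u
        using that by (intro range_dense[OF w]) (auto simp: R_def)
      ultimately have "\<exists>r\<in>R. nrm (v - r) < \<epsilon> / 2"
        using v \<epsilon> by (intro dense_of_trivial_complement) auto
      then obtain f g where fg: "(f, g) \<in> G" "nrm (v - (w *\<^sub>R f - g)) < \<epsilon> / 2"
        by (auto simp: R_def)
      note m = G_mem[OF fg(1)]
      \<comment> \<open>Centering \<open>f\<close> removes just the \<open>e\<close>-component of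
        the residual, because \<open>v\<close> and \<open>g\<close> are orthogonal to
        \<open>e\<close>; the residual does not grow, and coercivity becomes applicable.\<close>
      define h where "h = f - ip f e *\<^sub>R e"
      have h: "(h, g) \<in> G" using fg by (simp add: h_def G_center)
      have he: "ip h e = 0" using m e_unit by (simp add: h_def ip_simps)
      note mh = G_mem[OF h]
      define p where "p = v - (w *\<^sub>R h - g)"
      have pH: "p \<in> H" using v mh by (simp add: p_def)
      have "ip p e = 0"
        using v mh he range_orth[OF h] by (simp add: p_def ip_simps ip_commute[of v e])
      moreover have "v - (w *\<^sub>R f - g) = p + (- w * ip f e) *\<^sub>R e"
        by (simp add: p_def h_def algebra_simps)
      ultimately have "ip (v - (w *\<^sub>R f - g)) (v - (w *\<^sub>R f - g)) = ip p p + (- w * ip f e)\<^sup>2"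
        using pH e_unit by (simp only: pythagoras e_mem)
      then have "nrm p \<le> nrm (v - (w *\<^sub>R f - g))" by (simp add: nrm_def)
      then have "nrm (v - (w *\<^sub>R h - g)) < \<epsilon> / 2" using fg(2) by (simp add: p_def)
      then show ?thesis using h he by blast
    qed
    obtain f1 g1 where f1: "(f1, g1) \<in> G" "ip f1 e = 0" "nrm (u1 - (w *\<^sub>R f1 - g1)) < \<epsilon> / 2"
      using ex[OF u(1) ue(1)] by blast
    obtain f2 g2 where f2: "(f2, g2) \<in> G" "ip f2 e = 0" "nrm (u2 - (w *\<^sub>R f2 - g2)) < \<epsilon> / 2"
      using ex[OF u(2) ue(2)] by blast
    note m = G_mem[OF f1(1)] G_mem[OF f2(1)]
    define U where "U = (u1, u2)"
    define F where "F = (f1, f2)"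
    define S where "S = (w *\<^sub>R f1 - g1, w *\<^sub>R f2 - g2)"
    \<comment> \<open>\<open>Z\<close> is (z - w) F and \<open>S\<close> is (w - L) F, so
      \<open>S + Z\<close> is (z - L) F and thus orthogonal to \<open>U\<close>.\<close>
    define Z where "Z = ((a - w) *\<^sub>R f1 - b *\<^sub>R f2, b *\<^sub>R f1 + (a - w) *\<^sub>R f2)"
    have mem: "U \<in> H \<times> H" "F \<in> H \<times> H" "S \<in> H \<times> H" "Z \<in> H \<times> H"
      using u m by (auto simp: U_def F_def S_def Z_def)
    have nU: "K.nrm U = n" by (simp add: U_def n_def K.nrm_def)
    have "(K.nrm (U - S))\<^sup>2 = (nrm (u1 - (w *\<^sub>R f1 - g1)))\<^sup>2 + (nrm (u2 - (w *\<^sub>R f2 - g2)))\<^sup>2"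
      by (simp add: U_def S_def K.nrm_sq nrm_sq)
    also have "\<dots> \<le> (\<epsilon> / 2)\<^sup>2 + (\<epsilon> / 2)\<^sup>2"
      using f1(3) f2(3) by (intro add_mono power_mono) auto
    also have "\<dots> \<le> \<epsilon>\<^sup>2" by (simp add: power2_eq_square)
    finally have US: "K.nrm (U - S) \<le> \<epsilon>" by (rule power2_le_imp_le) (use \<epsilon> in simp)
    have "(w - d)\<^sup>2 * (ip f1 f1 + ip f2 f2) \<le> ip (fst S) (fst S) + ip (snd S) (snd S)"
      using centered_coercive[OF f1(1) f2(1) f1(2) f2(2), of w "fst S" 0 "snd S"] gap_neg w by (simp add: S_def)
    then have "((w - d) * K.nrm F)\<^sup>2 \<le> (K.nrm S)\<^sup>2"
      by (simp add: power_mult_distrib K.nrm_sq F_def)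
    then have "(w - d) * K.nrm F \<le> K.nrm S"
      by (rule power2_le_imp_le) (rule K.nrm_nonneg)
    also have "K.nrm S \<le> n + \<epsilon>"
      using K.nrm_le_add_diff[OF mem(3,1)] US by (simp add: nU K.nrm_diff_commute[OF mem(3,1)])
    finally have nF: "(w - d) * K.nrm F \<le> n + \<epsilon>" .
    have "(K.nrm Z)\<^sup>2 = ((a - w)\<^sup>2 + b\<^sup>2) * (K.nrm F)\<^sup>2"
      unfolding K.nrm_sq Z_def F_def fst_conv snd_conv by (rule ip_complex_mult[OF m(1,3)])
    then have "sqrt ((K.nrm Z)\<^sup>2) = sqrt (((a - w)\<^sup>2 + b\<^sup>2) * (K.nrm F)\<^sup>2)" by (simp only:)
    moreover have "K.nrm Z = sqrt ((K.nrm Z)\<^sup>2)" by simp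
    ultimately have "K.nrm Z = sqrt (((a - w)\<^sup>2 + b\<^sup>2) * (K.nrm F)\<^sup>2)" by (simp only:)
    also have "\<dots> = \<kappa> * ((w - d) * K.nrm F)" using wd by (simp add: \<kappa>_def real_sqrt_mult)
    also have "\<dots> \<le> \<kappa> * (n + \<epsilon>)" using nF \<kappa> by (intro mult_left_mono)
    finally have nZ: "K.nrm Z \<le> \<kappa> * (n + \<epsilon>)" .
    let ?I = "\<lambda>x y. ip (fst x) (fst y) + ip (snd x) (snd y)"
    have "?I (S + Z) U = 0"
    proof -
      have "S + Z = (a *\<^sub>R f1 - b *\<^sub>R f2 - g1, b *\<^sub>R f1 + a *\<^sub>R f2 - g2)"
        by (simp add: S_def Z_def algebra_simps)
      then show ?thesis using orth[OF f1(1) f2(1)] by (simp add: U_def)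
    qed
    then have "?I S U + ?I Z U = 0" using K.ip_add_left[OF mem(3,4,1)] by simp
    moreover have "?I (U - S) U = ?I U U - ?I S U" by (rule K.ip_diff_left[OF mem(1,3,1)])
    moreover have "?I U U = n * n" using n by (simp add: U_def)
    ultimately have "n * n = ?I (U - S) U - ?I Z U" by simp
    also have "\<dots> \<le> K.nrm (U - S) * K.nrm U + K.nrm Z * K.nrm U"
      using K.Cauchy_Schwarz[of "U - S" U] K.Cauchy_Schwarz[of Z U] mem K.mem_H(3)[OF mem(1,3)]
      by (simp add: abs_le_iff)
    also have "\<dots> \<le> \<epsilon> * n + \<kappa> * (n + \<epsilon>) * n"
      unfolding nU using US nZ n by (intro add_mono mult_right_mono) auto
    finally show ?thesis .
  qed
  have "n = 0"
  proof (rule ccontr)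
    assume "n \<noteq> 0"
    with n have np: "n > 0" by simp
    \<comment> \<open>Letting \<epsilon> tend to 0 would give n \<le> \<kappa> n; a value with 2
      \<epsilon> < (1 - \<kappa>) n already suffices.\<close>
    define \<epsilon> where "\<epsilon> = (1 - \<kappa>) * n / 4"
    have \<epsilon>: "\<epsilon> > 0" using np \<kappa> by (simp add: \<epsilon>_def)
    have "n * n \<le> (\<epsilon> + \<kappa> * (n + \<epsilon>)) * n" using appr[OF \<epsilon>] by (simp add: algebra_simps)
    then have "n \<le> \<epsilon> + \<kappa> * (n + \<epsilon>)" using np by simp
    also have "\<kappa> * \<epsilon> \<le> 1 * \<epsilon>" using \<kappa> \<epsilon> by (intro mult_right_mono) auto
    then have "\<epsilon> + \<kappa> * (n + \<epsilon>) \<le> 2 * \<epsilon> + \<kappa> * n" by (simp add: algebra_simps)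
    finally have "(1 - \<kappa>) * n \<le> 2 * \<epsilon>" by (simp add: algebra_simps)
    moreover have "(1 - \<kappa>) * n = 4 * \<epsilon>" by (simp add: \<epsilon>_def)
    ultimately show False using \<epsilon> by linarith
  qed
  then show ?thesis using n by simp
qed

text \<open>Dense range gives approximate solutions, the lower bound makes them a Cauchy sequence,
  and the closed graph admits their limit.\<close>

lemma resolvent_surj:
  assumes a: "d < a" and z: "a \<noteq> 0 \<or> b \<noteq> 0" and h: "h1 \<in> H" "h2 \<in> H"
  shows "\<exists>f1 g1 f2 g2. (f1, g1) \<in> G \<and> (f2, g2) \<in> G \<and>
    a *\<^sub>R f1 - b *\<^sub>R f2 - g1 = h1 \<and> b *\<^sub>R f1 + a *\<^sub>R f2 - g2 = h2"
proof -
  interpret K: semi_hilbert "H \<times> H" "\<lambda>x y. ip (fst x) (fst y) + ip (snd x) (snd y)"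
    by (rule semi_hilbert_Times)
  define \<Phi> where "\<Phi> = (\<lambda>((f1 :: 'v, g1), (f2, g2)). (a *\<^sub>R f1 - b *\<^sub>R f2 - g1, b *\<^sub>R f1 + a *\<^sub>R f2 - g2))"
  define R where "R = \<Phi> ` (G \<times> G)"
  have lin: "linear \<Phi>" by (rule linearI) (auto simp: \<Phi>_def algebra_simps)
  then have sub: "subspace R" unfolding R_def
    by (rule linear_subspace_image) (intro subspace_Times G_subspace)
  have RH: "R \<subseteq> H \<times> H" using G_mem by (auto simp: R_def \<Phi>_def)
  have triv: "ip (fst u) (fst u) + ip (snd u) (snd u) = 0"
    if u: "u \<in> H \<times> H" "\<And>r. r \<in> R \<Longrightarrow> ip (fst r) (fst u) + ip (snd r) (snd u) = 0" for u
  proof (rule resolvent_range_dense[OF a z])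
    fix f1 g1 f2 g2 assume "(f1, g1) \<in> G" "(f2, g2) \<in> G"
    then have "\<Phi> ((f1, g1), (f2, g2)) \<in> R" by (auto simp: R_def)
    from u(2)[OF this]
    show "ip (a *\<^sub>R f1 - b *\<^sub>R f2 - g1) (fst u) + ip (b *\<^sub>R f1 + a *\<^sub>R f2 - g2) (snd u) = 0"
      by (simp add: \<Phi>_def)
  qed (use u(1) in auto)
  have hK: "(h1, h2) \<in> H \<times> H" using h by simp
  have "\<exists>r\<in>R. K.nrm ((h1, h2) - r) < 1 / Suc n" for n
    using K.dense_of_trivial_complement[OF sub RH triv hK, of "1 / Suc n"] by simp
  then have "\<forall>n. \<exists>x. x \<in> G \<times> G \<and> K.nrm ((h1, h2) - \<Phi> x) < 1 / Suc n"
    unfolding R_def by blast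
  from choice[OF this] obtain x where x: "\<And>n. x n \<in> G \<times> G"
    and xn: "\<And>n. K.nrm ((h1, h2) - \<Phi> (x n)) < 1 / Suc n"
    by blast
  have xG: "fst (x n) \<in> G" "snd (x n) \<in> G" for n using x[of n] by (auto simp: mem_Times_iff)
  define F where "F = (\<lambda>x :: ('v \<times> 'v) \<times> ('v \<times> 'v). (fst (fst x), fst (snd x)))"
  define C where "C = sqrt (1 / (a\<^sup>2 + b\<^sup>2) + 1 / (a - d)\<^sup>2) + 1"
  have C: "C > 0" by (simp add: C_def add_nonneg_pos)
  have FH: "F y \<in> H \<times> H" "\<Phi> y \<in> H \<times> H" if "y \<in> G \<times> G" for y
    using that RH G_mem by (auto simp: F_def R_def)
  have bound: "K.nrm (F y) \<le> C * K.nrm (\<Phi> y)" if y: "y \<in> G \<times> G" for y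
  proof -
    obtain f1 g1 f2 g2 where y_eq: "y = ((f1, g1), (f2, g2))" by (metis surj_pair)
    have "(K.nrm (F y))\<^sup>2 \<le> (1 / (a\<^sup>2 + b\<^sup>2) + 1 / (a - d)\<^sup>2) * (K.nrm (\<Phi> y))\<^sup>2"
      using resolvent_bound[OF _ _ a z refl refl, of f1 g1 f2 g2] y
      by (simp add: y_eq F_def \<Phi>_def K.nrm_sq)
    then have "sqrt ((K.nrm (F y))\<^sup>2) \<le> sqrt ((1 / (a\<^sup>2 + b\<^sup>2) + 1 / (a - d)\<^sup>2) * (K.nrm (\<Phi> y))\<^sup>2)"
      by (simp only: real_sqrt_le_iff)
    then have "K.nrm (F y) \<le> (C - 1) * K.nrm (\<Phi> y)" by (simp add: real_sqrt_mult C_def)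
    also have "\<dots> \<le> C * K.nrm (\<Phi> y)" by (intro mult_right_mono) auto
    finally show ?thesis .
  qed
  have cauchy: "\<exists>N. \<forall>m\<ge>N. \<forall>n\<ge>N. K.nrm (F (x m) - F (x n)) < \<epsilon>" if \<epsilon>: "\<epsilon> > 0" for \<epsilon>
  proof -
    obtain N where N: "1 / real (Suc N) < \<epsilon> / (2 * C)"
      using nat_approx_posE[of "\<epsilon> / (2 * C)"] \<epsilon> C by auto
    have "K.nrm (F (x m) - F (x n)) < \<epsilon>" if mn: "m \<ge> N" "n \<ge> N" for m n
    proof -
      have y: "x m - x n \<in> G \<times> G" using x by (intro subspace_diff subspace_Times G_subspace)
      have "K.nrm (F (x m) - F (x n)) = K.nrm (F (x m - x n))" by (simp add: F_def)
      also have "\<dots> \<le> C * K.nrm (\<Phi> (x m - x n))" by (rule bound[OF y])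
      also have "\<Phi> (x m - x n) = \<Phi> (x m) - \<Phi> (x n)" using lin by (rule linear_diff)
      also have "K.nrm (\<Phi> (x m) - \<Phi> (x n)) \<le> K.nrm (\<Phi> (x m) - (h1, h2)) + K.nrm ((h1, h2) - \<Phi> (x n))"
        by (intro K.nrm_triangle_mid FH x hK)
      also have "K.nrm (\<Phi> (x m) - (h1, h2)) = K.nrm ((h1, h2) - \<Phi> (x m))"
        by (intro K.nrm_diff_commute FH x hK)
      also have "K.nrm ((h1, h2) - \<Phi> (x m)) + K.nrm ((h1, h2) - \<Phi> (x n)) < 1 / Suc N + 1 / Suc N"
      proof -
        have "1 / real (Suc m) \<le> 1 / real (Suc N)" "1 / real (Suc n) \<le> 1 / real (Suc N)"
          using mn by (auto intro!: divide_left_mono)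
        then show ?thesis using xn[of m] xn[of n] by linarith
      qed
      also have "C * (1 / Suc N + 1 / Suc N) < \<epsilon>" using N C by (simp add: field_simps)
      finally show ?thesis using C by simp
    qed
    then show ?thesis by blast
  qed
  obtain p where p: "p \<in> H \<times> H" "(\<lambda>n. K.nrm (F (x n) - p)) \<longlonglongrightarrow> 0"
    using K.complete[of "\<lambda>n. F (x n)"] cauchy FH x by auto
  obtain f1 f2 where p_eq: "p = (f1, f2)" by (cases p)
  have fH: "f1 \<in> H" "f2 \<in> H" using p by (auto simp: p_eq)
  have xlim: "(\<lambda>n. nrm (fst (fst (x n)) - f1)) \<longlonglongrightarrow> 0" "(\<lambda>n. nrm (fst (snd (x n)) - f2)) \<longlonglongrightarrow> 0"
    by (rule tendsto_sandwich[OF _ _ tendsto_const p(2)]; simp add: p_eq F_def K.nrm_def nrm_def)+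
  have hlim_K: "(\<lambda>n. K.nrm ((h1, h2) - \<Phi> (x n))) \<longlonglongrightarrow> 0"
    by (rule tendsto_sandwich[OF _ _ tendsto_const LIMSEQ_Suc[OF lim_1_over_n]])
      (intro always_eventually allI K.nrm_nonneg less_imp_le[OF xn])+
  have hlim: "(\<lambda>n. nrm (h1 - fst (\<Phi> (x n)))) \<longlonglongrightarrow> 0" "(\<lambda>n. nrm (h2 - snd (\<Phi> (x n)))) \<longlonglongrightarrow> 0"
    by (rule tendsto_sandwich[OF _ _ tendsto_const hlim_K]; simp add: K.nrm_def nrm_def)+
  have xH: "fst (fst (x n)) \<in> H" "snd (fst (x n)) \<in> H" "fst (snd (x n)) \<in> H" "snd (snd (x n)) \<in> H" for n
    using xG[of n] G_subset by (auto simp: mem_Times_iff)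
  \<comment> \<open>The second components need no estimate of their own: they are combinations of
    the convergent first components and of the convergent values of \<Phi>.\<close>
  have "(f1, a *\<^sub>R f1 - b *\<^sub>R f2 - h1) \<in> G"
  proof (rule graph_closed[OF _ _ _ xlim(1)])
    show "(fst (fst (x n)), snd (fst (x n))) \<in> G" for n using xG[of n] by simp
    show "(\<lambda>n. nrm (snd (fst (x n)) - (a *\<^sub>R f1 - b *\<^sub>R f2 - h1))) \<longlonglongrightarrow> 0"
    proof (rule tendsto_sandwich[OF _ _ tendsto_const])
      have "(\<lambda>n. \<bar>a\<bar> * nrm (fst (fst (x n)) - f1) + \<bar>b\<bar> * nrm (fst (snd (x n)) - f2) + nrm (h1 - fst (\<Phi> (x n)))) \<longlonglongrightarrow> \<bar>a\<bar> * 0 + \<bar>b\<bar> * 0 + 0"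
        by (intro tendsto_intros xlim hlim)
      then show "(\<lambda>n. \<bar>a\<bar> * nrm (fst (fst (x n)) - f1) + \<bar>b\<bar> * nrm (fst (snd (x n)) - f2) + nrm (h1 - fst (\<Phi> (x n)))) \<longlonglongrightarrow> 0"
        by simp
      have "nrm (snd (fst (x n)) - (a *\<^sub>R f1 - b *\<^sub>R f2 - h1)) \<le>
          \<bar>a\<bar> * nrm (fst (fst (x n)) - f1) + \<bar>b\<bar> * nrm (fst (snd (x n)) - f2) + nrm (h1 - fst (\<Phi> (x n)))" for n
      proof -
        have "snd (fst (x n)) - (a *\<^sub>R f1 - b *\<^sub>R f2 - h1) =
          a *\<^sub>R (fst (fst (x n)) - f1) - b *\<^sub>R (fst (snd (x n)) - f2) + (h1 - fst (\<Phi> (x n)))"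
          by (simp add: \<Phi>_def case_prod_beta algebra_simps)
        also have "nrm \<dots> \<le> nrm (a *\<^sub>R (fst (fst (x n)) - f1)) + nrm (b *\<^sub>R (fst (snd (x n)) - f2)) + nrm (h1 - fst (\<Phi> (x n)))"
          using xH fH h FH(2)[OF x[of n]]
          by (intro order.trans[OF nrm_triangle] add_mono nrm_triangle_diff) (auto simp: mem_Times_iff)
        finally show ?thesis using xH fH by (simp add: nrm_scaleR)
      qed
      then show "\<forall>\<^sub>F n in sequentially. nrm (snd (fst (x n)) - (a *\<^sub>R f1 - b *\<^sub>R f2 - h1)) \<le>
          \<bar>a\<bar> * nrm (fst (fst (x n)) - f1) + \<bar>b\<bar> * nrm (fst (snd (x n)) - f2) + nrm (h1 - fst (\<Phi> (x n)))"
        by (intro always_eventually allI)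
    qed simp
  qed (use fH h in auto)
  moreover have "(f2, b *\<^sub>R f1 + a *\<^sub>R f2 - h2) \<in> G"
  proof (rule graph_closed[OF _ _ _ xlim(2)])
    show "(fst (snd (x n)), snd (snd (x n))) \<in> G" for n using xG[of n] by simp
    show "(\<lambda>n. nrm (snd (snd (x n)) - (b *\<^sub>R f1 + a *\<^sub>R f2 - h2))) \<longlonglongrightarrow> 0"
    proof (rule tendsto_sandwich[OF _ _ tendsto_const])
      have "(\<lambda>n. \<bar>b\<bar> * nrm (fst (fst (x n)) - f1) + \<bar>a\<bar> * nrm (fst (snd (x n)) - f2) + nrm (h2 - snd (\<Phi> (x n)))) \<longlonglongrightarrow> \<bar>b\<bar> * 0 + \<bar>a\<bar> * 0 + 0"
        by (intro tendsto_intros xlim hlim)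
      then show "(\<lambda>n. \<bar>b\<bar> * nrm (fst (fst (x n)) - f1) + \<bar>a\<bar> * nrm (fst (snd (x n)) - f2) + nrm (h2 - snd (\<Phi> (x n)))) \<longlonglongrightarrow> 0"
        by simp
      have "nrm (snd (snd (x n)) - (b *\<^sub>R f1 + a *\<^sub>R f2 - h2)) \<le>
          \<bar>b\<bar> * nrm (fst (fst (x n)) - f1) + \<bar>a\<bar> * nrm (fst (snd (x n)) - f2) + nrm (h2 - snd (\<Phi> (x n)))" for n
      proof -
        have "snd (snd (x n)) - (b *\<^sub>R f1 + a *\<^sub>R f2 - h2) =
          b *\<^sub>R (fst (fst (x n)) - f1) + a *\<^sub>R (fst (snd (x n)) - f2) + (h2 - snd (\<Phi> (x n)))"
          by (simp add: \<Phi>_def case_prod_beta algebra_simps)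
        also have "nrm \<dots> \<le> nrm (b *\<^sub>R (fst (fst (x n)) - f1)) + nrm (a *\<^sub>R (fst (snd (x n)) - f2)) + nrm (h2 - snd (\<Phi> (x n)))"
          using xH fH h FH(2)[OF x[of n]]
          by (intro order.trans[OF nrm_triangle] add_mono nrm_triangle) (auto simp: mem_Times_iff)
        finally show ?thesis using xH fH by (simp add: nrm_scaleR)
      qed
      then show "\<forall>\<^sub>F n in sequentially. nrm (snd (snd (x n)) - (b *\<^sub>R f1 + a *\<^sub>R f2 - h2)) \<le>
          \<bar>b\<bar> * nrm (fst (fst (x n)) - f1) + \<bar>a\<bar> * nrm (fst (snd (x n)) - f2) + nrm (h2 - snd (\<Phi> (x n)))"
        by (intro always_eventually allI)
    qed simp
  qed (use fH h in auto)
  ultimately show ?thesis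
    by (intro exI[of _ f1] exI[of _ f2] exI[of _ "a *\<^sub>R f1 - b *\<^sub>R f2 - h1"] exI[of _ "b *\<^sub>R f1 + a *\<^sub>R f2 - h2"]) auto
qed

end

section \<open>Square integrable functions and invariant kernels\<close>

instantiation "fun" :: (type, real_vector) real_vector
begin

definition scaleR_fun :: "real \<Rightarrow> ('a \<Rightarrow> 'b) \<Rightarrow> 'a \<Rightarrow> 'b" where
  "scaleR_fun c f = (\<lambda>x. c *\<^sub>R f x)"

instance
  by standard (simp_all add: scaleR_fun_def fun_eq_iff scaleR_add_left scaleR_add_right)

end

lemma scaleR_fun_apply [simp]: "(c *\<^sub>R f) x = c *\<^sub>R f x"
  by (simp add: scaleR_fun_def)

section \<open>The Hilbert space of square integrable functions\<close>

lemma L2D [measurable_dest]: "f \<in> L2 M \<Longrightarrow> f \<in> borel_measurable M"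
  by (simp add: L2_def)

lemma L2_real_iff: "f \<in> L2 M \<longleftrightarrow> f \<in> borel_measurable M \<and> integrable M (\<lambda>x. (f x :: real)\<^sup>2)"
  by (simp add: L2_def)

lemma L2_integrable_mult:
  fixes f g :: "'a \<Rightarrow> real"
  assumes "f \<in> L2 M" "g \<in> L2 M"
  shows "integrable M (\<lambda>x. f x * g x)"
proof (rule Bochner_Integration.integrable_bound)
  show "integrable M (\<lambda>x. (f x)\<^sup>2 + (g x)\<^sup>2)"
    using assms by (auto simp: L2_real_iff)
  show "(\<lambda>x. f x * g x) \<in> borel_measurable M"
    using assms by measurable
  show "AE x in M. norm (f x * g x) \<le> norm ((f x)\<^sup>2 + (g x)\<^sup>2)"
  proof (rule AE_I2)
    fix x
    have "0 \<le> (\<bar>f x\<bar> - \<bar>g x\<bar>)\<^sup>2" by simp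
    then have "2 * (\<bar>f x\<bar> * \<bar>g x\<bar>) \<le> (f x)\<^sup>2 + (g x)\<^sup>2" by (simp add: power2_diff)
    moreover have "0 \<le> \<bar>f x\<bar> * \<bar>g x\<bar>" by simp
    ultimately have "\<bar>f x\<bar> * \<bar>g x\<bar> \<le> (f x)\<^sup>2 + (g x)\<^sup>2" by linarith
    then show "norm (f x * g x) \<le> norm ((f x)\<^sup>2 + (g x)\<^sup>2)" by (simp add: abs_mult)
  qed
qed

lemma subspace_L2: "subspace (L2 M :: ('a \<Rightarrow> real) set)"
proof (rule subspaceI)
  show "(0 :: 'a \<Rightarrow> real) \<in> L2 M" by (simp add: L2_real_iff zero_fun_def)
next
  fix f g :: "'a \<Rightarrow> real" assume fg: "f \<in> L2 M" "g \<in> L2 M"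
  have "(\<lambda>x. (f x + g x)\<^sup>2) = (\<lambda>x. (f x)\<^sup>2 + (g x)\<^sup>2 + 2 * (f x * g x))"
    by (simp add: power2_sum mult.assoc)
  then show "f + g \<in> L2 M"
    using fg L2_integrable_mult[OF fg] by (auto simp: L2_real_iff plus_fun_def intro!: borel_measurable_add)
next
  fix c and f :: "'a \<Rightarrow> real" assume "f \<in> L2 M"
  then show "c *\<^sub>R f \<in> L2 M"
    by (auto simp: L2_real_iff scaleR_fun_def power_mult_distrib)
qed

lemma L2_inner_commute: "L2_inner M f g = L2_inner M g f"
  by (simp add: L2_inner_def mult.commute)

lemma L2_norm_eq_sqrt_inner: "L2_norm M f = sqrt (L2_inner M f f)"
  by (simp add: L2_norm_def L2_inner_def power2_eq_square flip: abs_mult)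

lemma L2_inner_cong_AE:
  assumes "f \<in> L2 M" "f' \<in> L2 M" "u \<in> L2 M" "AE x in M. f x = f' x"
  shows "L2_inner M f u = L2_inner M f' u"
  unfolding L2_inner_def by (rule integral_cong_AE) (use assms in auto)

lemma L2_null_iff:
  assumes "f \<in> L2 M"
  shows "L2_inner M f f = 0 \<longleftrightarrow> (AE x in M. f x = (0::real))"
  unfolding L2_inner_def
  by (subst integral_nonneg_eq_0_iff_AE[OF L2_integrable_mult[OF assms assms]]) auto

context prob_space
begin

lemma L2_const: "(\<lambda>x. c :: real) \<in> L2 M"
  by (simp add: L2_real_iff)

lemma L2_integrable: "f \<in> L2 M \<Longrightarrow> integrable M (f :: 'a \<Rightarrow> real)"
  using L2_integrable_mult[OF _ L2_const[of 1]] by simp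

text \<open>The difference of the two sides is the variance of \<open>f\<close>.\<close>

lemma square_integral_le:
  assumes "integrable M f" "integrable M (\<lambda>x. (f x :: real)\<^sup>2)"
  shows "(\<integral>x. f x \<partial>M)\<^sup>2 \<le> (\<integral>x. (f x)\<^sup>2 \<partial>M)"
  using variance_eq[OF assms] integral_nonneg_AE[of "\<lambda>x. (f x - expectation f)\<^sup>2" M] by simp

text \<open>Riesz-Fischer; Fatou's lemma is applied along an almost everywhere convergent subsequence.\<close>

lemma L2_complete:
  fixes X :: "nat \<Rightarrow> 'a \<Rightarrow> real"
  assumes X: "\<And>n. X n \<in> L2 M"
    and C: "\<And>e. 0 < e \<Longrightarrow> \<exists>N. \<forall>m\<ge>N. \<forall>n\<ge>N. L2_norm M (X m - X n) < e"
  shows "\<exists>f\<in>L2 M. (\<lambda>n. L2_norm M (X n - f)) \<longlonglongrightarrow> 0"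
proof -
  note [measurable] = L2D[OF X]
  have XD: "X m - X n \<in> L2 M" for m n using subspace_diff[OF subspace_L2 X X] .
  obtain r where r: "strict_mono r" "AE x in M. Cauchy (\<lambda>i. X (r i) x)"
  proof (rule cauchy_L1_AE_cauchy_subseq[of M X])
    show "integrable M (X n)" for n by (rule L2_integrable[OF X])
    fix e :: real assume "e > 0"
    then obtain N where N: "\<And>m n. \<lbrakk>m \<ge> N; n \<ge> N\<rbrakk> \<Longrightarrow> L2_norm M (X m - X n) < e" using C by blast
    have "(\<integral>x. norm (X m x - X n x) \<partial>M) < e" if "m \<ge> N" "n \<ge> N" for m n
    proof -
      \<comment> \<open>On a probability space the sequence is thus Cauchy in mean as well, which
        yields the almost everywhere Cauchy subsequence.\<close>
      have "(\<integral>x. norm (X m x - X n x) \<partial>M)\<^sup>2 \<le> (\<integral>x. (norm (X m x - X n x))\<^sup>2 \<partial>M)"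
        using L2_integrable[OF XD[of m n]] XD[of m n]
        by (intro square_integral_le integrable_norm) (auto simp: L2_real_iff fun_diff_def)
      then have "sqrt ((\<integral>x. norm (X m x - X n x) \<partial>M)\<^sup>2) \<le> sqrt (\<integral>x. (norm (X m x - X n x))\<^sup>2 \<partial>M)"
        by (simp only: real_sqrt_le_iff)
      also have "\<dots> = L2_norm M (X m - X n)" by (simp add: L2_norm_def)
      also have "\<dots> < e" using N that by auto
      finally show ?thesis by simp
    qed
    then show "\<exists>N. \<forall>i\<ge>N. \<forall>j\<ge>N. (\<integral>x. norm (X i x - X j x) \<partial>M) < e" by blast
  qed auto
  define f where "f = (\<lambda>x. lim (\<lambda>i. X (r i) x))"
  have [measurable]: "f \<in> borel_measurable M" unfolding f_def by measurable
  have conv: "AE x in M. (\<lambda>i. X (r i) x) \<longlonglongrightarrow> f x"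
    using r(2) by eventually_elim (auto simp: f_def Cauchy_convergent_iff convergent_LIMSEQ_iff)
  have nn: "(\<integral>\<^sup>+x. ennreal ((X n x - f x)\<^sup>2) \<partial>M) \<le> ennreal (e\<^sup>2)"
    if N: "\<And>m n. \<lbrakk>m \<ge> N; n \<ge> N\<rbrakk> \<Longrightarrow> L2_norm M (X m - X n) < e" and n: "n \<ge> N" and e: "e > 0" for n N e
  proof -
    have "(\<integral>\<^sup>+x. ennreal ((X n x - f x)\<^sup>2) \<partial>M) = (\<integral>\<^sup>+x. liminf (\<lambda>i. ennreal ((X n x - X (r i) x)\<^sup>2)) \<partial>M)"
    proof (rule nn_integral_cong_AE)
      show "AE x in M. ennreal ((X n x - f x)\<^sup>2) = liminf (\<lambda>i. ennreal ((X n x - X (r i) x)\<^sup>2))"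
        using conv
      proof eventually_elim
        fix x assume "(\<lambda>i. X (r i) x) \<longlonglongrightarrow> f x"
        then have "(\<lambda>i. ennreal ((X n x - X (r i) x)\<^sup>2)) \<longlonglongrightarrow> ennreal ((X n x - f x)\<^sup>2)"
          by (intro tendsto_intros)
        then show "ennreal ((X n x - f x)\<^sup>2) = liminf (\<lambda>i. ennreal ((X n x - X (r i) x)\<^sup>2))"
          by (intro lim_imp_Liminf[symmetric]) simp_all
      qed
    qed
    also have "\<dots> \<le> liminf (\<lambda>i. \<integral>\<^sup>+x. ennreal ((X n x - X (r i) x)\<^sup>2) \<partial>M)"
      by (rule nn_integral_liminf) measurable
    also have "\<dots> \<le> liminf (\<lambda>i::nat. ennreal (e\<^sup>2))"
    proof (rule Liminf_mono)
      have "(\<integral>\<^sup>+x. ennreal ((X n x - X (r i) x)\<^sup>2) \<partial>M) \<le> ennreal (e\<^sup>2)" if "i \<ge> N" for i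
      proof -
        have i: "r i \<ge> N" using seq_suble[OF r(1), of i] that by simp
        have "(\<integral>\<^sup>+x. ennreal ((X n x - X (r i) x)\<^sup>2) \<partial>M) = ennreal (\<integral>x. (X n x - X (r i) x)\<^sup>2 \<partial>M)"
          using XD[of n "r i"] by (intro nn_integral_eq_integral) (auto simp: L2_real_iff)
        also have "(\<integral>x. (X n x - X (r i) x)\<^sup>2 \<partial>M) = (L2_norm M (X n - X (r i)))\<^sup>2"
          by (simp add: L2_norm_def)
        also have "ennreal \<dots> \<le> ennreal (e\<^sup>2)"
          using N[OF n i] by (intro ennreal_leI power_mono) (auto simp: L2_norm_def)
        finally show ?thesis .
      qed
      then show "\<forall>\<^sub>F i in sequentially. (\<integral>\<^sup>+x. ennreal ((X n x - X (r i) x)\<^sup>2) \<partial>M) \<le> ennreal (e\<^sup>2)"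
        by (auto simp: eventually_sequentially)
    qed
    finally show ?thesis by (simp add: Liminf_const)
  qed
  have fin: "X n - f \<in> L2 M \<and> L2_norm M (X n - f) \<le> e"
    if "\<And>m n. \<lbrakk>m \<ge> N; n \<ge> N\<rbrakk> \<Longrightarrow> L2_norm M (X m - X n) < e" "n \<ge> N" "e > 0" for n N e
  proof -
    note * = nn[OF that]
    then have int: "integrable M (\<lambda>x. (X n x - f x)\<^sup>2)"
      by (intro integrableI_nonneg) (auto intro: le_less_trans)
    then have "ennreal (\<integral>x. (X n x - f x)\<^sup>2 \<partial>M) \<le> ennreal (e\<^sup>2)"
      using * by (simp add: nn_integral_eq_integral)
    then have "(\<integral>x. (X n x - f x)\<^sup>2 \<partial>M) \<le> e\<^sup>2" by (simp add: ennreal_le_iff)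
    then have "L2_norm M (X n - f) \<le> sqrt (e\<^sup>2)" unfolding L2_norm_def by (simp del: real_sqrt_abs)
    with int that(3) show ?thesis by (simp add: L2_real_iff fun_diff_def)
  qed
  obtain N where N: "\<And>m n. \<lbrakk>m \<ge> N; n \<ge> N\<rbrakk> \<Longrightarrow> L2_norm M (X m - X n) < 1"
    using C[of 1] by auto
  have "X N - f \<in> L2 M" using fin[OF N, of N N] by simp
  from subspace_diff[OF subspace_L2 X[of N] this] have "f \<in> L2 M" by simp
  moreover have "(\<lambda>n. L2_norm M (X n - f)) \<longlonglongrightarrow> 0"
  proof (rule LIMSEQ_I)
    fix e :: real assume e: "e > 0"
    then obtain N where N: "\<And>m n. \<lbrakk>m \<ge> N; n \<ge> N\<rbrakk> \<Longrightarrow> L2_norm M (X m - X n) < e / 2"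
      using C[of "e / 2"] by auto
    then have "L2_norm M (X n - f) \<le> e / 2" if "n \<ge> N" for n
      using fin[OF N that] e by simp
    then show "\<exists>N. \<forall>n\<ge>N. norm (L2_norm M (X n - f) - 0) < e"
      using e by (force simp: L2_norm_def)
  qed
  ultimately show ?thesis by blast
qed

lemma semi_hilbert_L2: "semi_hilbert (L2 M) (L2_inner M)"
proof
  show "subspace (L2 M :: ('a \<Rightarrow> real) set)" by (rule subspace_L2)
next
  fix x y :: "'a \<Rightarrow> real"
  show "L2_inner M x y = L2_inner M y x" by (rule L2_inner_commute)
  show "0 \<le> L2_inner M x x" by (simp add: L2_inner_def)
next
  fix x y z :: "'a \<Rightarrow> real" assume "x \<in> L2 M" "y \<in> L2 M" "z \<in> L2 M"
  then show "L2_inner M (x + y) z = L2_inner M x z + L2_inner M y z"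
    by (simp add: L2_inner_def distrib_right L2_integrable_mult)
next
  fix x y :: "'a \<Rightarrow> real" and c :: real
  show "L2_inner M (c *\<^sub>R x) y = c * L2_inner M x y"
    by (simp add: L2_inner_def mult.assoc)
next
  fix X :: "nat \<Rightarrow> 'a \<Rightarrow> real"
  assume "\<And>n. X n \<in> L2 M"
    "\<And>e. 0 < e \<Longrightarrow> \<exists>N. \<forall>m\<ge>N. \<forall>n\<ge>N. sqrt (L2_inner M (X m - X n) (X m - X n)) < e"
  then show "\<exists>x\<in>L2 M. (\<lambda>n. sqrt (L2_inner M (X n - x) (X n - x))) \<longlonglongrightarrow> 0"
    using L2_complete[of X] by (simp add: L2_norm_eq_sqrt_inner)
qed

end

text \<open>Unlike the library's \<open>integral_bind\<close>, this does not require the integrand to be bounded.\<close>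

lemma integral_bind_unbounded:
  fixes f :: "'b \<Rightarrow> real"
  assumes K [measurable]: "K \<in> measurable M (subprob_algebra N)" and ne: "space M \<noteq> {}"
    and f: "integrable (M \<bind> K) f"
  shows "AE x in M. integrable (K x) f"
    and "integrable M (\<lambda>x. \<integral>y. f y \<partial>K x)"
    and "(\<integral>x. \<integral>y. f y \<partial>K x \<partial>M) = (\<integral>y. f y \<partial>(M \<bind> K))"
proof -
  have sets_B: "sets (M \<bind> K) = sets N" by (intro sets_bind sets_kernel[OF K] ne)
  have f_meas: "f \<in> borel_measurable N" using borel_measurable_integrable[OF f] measurable_cong_sets[OF sets_B refl] by blast
  note [measurable] = f_meas
  have nn: "AE x in M. (\<integral>\<^sup>+y. ennreal (norm (f y)) \<partial>K x) \<noteq> \<infinity>"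
  proof (rule nn_integral_PInf_AE)
    have "(\<integral>\<^sup>+x. \<integral>\<^sup>+y. ennreal (norm (f y)) \<partial>K x \<partial>M) = (\<integral>\<^sup>+y. ennreal (norm (f y)) \<partial>(M \<bind> K))"
      by (rule nn_integral_bind[symmetric, OF _ K]) measurable
    then show "(\<integral>\<^sup>+x. \<integral>\<^sup>+y. ennreal (norm (f y)) \<partial>K x \<partial>M) \<noteq> \<infinity>"
      using f by (simp add: integrable_iff_bounded less_top)
  qed measurable
  have K_meas: "g \<in> borel_measurable (K x)" if "g \<in> borel_measurable N" "x \<in> space M"
    for g :: "'b \<Rightarrow> real" and x
    using that measurable_cong_sets[OF sets_kernel[OF K that(2)] refl] by blast
  show AE1: "AE x in M. integrable (K x) f"
    using nn AE_space by eventually_elim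
      (auto simp: integrable_iff_bounded K_meas less_top)
  have *: "integrable M (\<lambda>x. \<integral>y. g y \<partial>K x) \<and> (\<integral>x. \<integral>y. g y \<partial>K x \<partial>M) = (\<integral>y. g y \<partial>(M \<bind> K))"
    if g_int: "integrable (M \<bind> K) g" and g_nonneg: "\<And>y. 0 \<le> g y" and g_int': "AE x in M. integrable (K x) g" for g :: "'b \<Rightarrow> real"
  proof -
    have g_meas: "g \<in> borel_measurable N" using borel_measurable_integrable[OF g_int] measurable_cong_sets[OF sets_B refl] by blast
    note [measurable] = g_meas
    have "(\<integral>\<^sup>+x. ennreal (\<integral>y. g y \<partial>K x) \<partial>M) = (\<integral>\<^sup>+x. \<integral>\<^sup>+y. ennreal (g y) \<partial>K x \<partial>M)"
      using g_int' by (intro nn_integral_cong_AE) (auto simp: nn_integral_eq_integral g_nonneg)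
    also have "\<dots> = (\<integral>\<^sup>+y. ennreal (g y) \<partial>(M \<bind> K))"
      by (rule nn_integral_bind[symmetric, OF _ K]) measurable
    also have "\<dots> = ennreal (\<integral>y. g y \<partial>(M \<bind> K))"
      using g_int g_nonneg by (simp add: nn_integral_eq_integral)
    finally have eq: "(\<integral>\<^sup>+x. ennreal (\<integral>y. g y \<partial>K x) \<partial>M) = ennreal (\<integral>y. g y \<partial>(M \<bind> K))" .
    have meas: "(\<lambda>x. \<integral>y. g y \<partial>K x) \<in> borel_measurable M" by measurable
    have int: "integrable M (\<lambda>x. \<integral>y. g y \<partial>K x)"
      using eq meas by (intro integrableI_nonneg) (auto simp: g_nonneg)
    have "ennreal (\<integral>x. \<integral>y. g y \<partial>K x \<partial>M) = ennreal (\<integral>y. g y \<partial>(M \<bind> K))"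
      using eq nn_integral_eq_integral[OF int] by (simp add: g_nonneg)
    then show ?thesis using int by (simp add: g_nonneg)
  qed
  have p: "integrable M (\<lambda>x. \<integral>y. max 0 (f y) \<partial>K x) \<and> (\<integral>x. \<integral>y. max 0 (f y) \<partial>K x \<partial>M) = (\<integral>y. max 0 (f y) \<partial>(M \<bind> K))"
    using f AE1 by (intro *) auto
  have n: "integrable M (\<lambda>x. \<integral>y. max 0 (- f y) \<partial>K x) \<and> (\<integral>x. \<integral>y. max 0 (- f y) \<partial>K x \<partial>M) = (\<integral>y. max 0 (- f y) \<partial>(M \<bind> K))"
    using f AE1 by (intro *) auto
  have split: "(\<integral>y. f y \<partial>N) = (\<integral>y. max 0 (f y) \<partial>N) - (\<integral>y. max 0 (- f y) \<partial>N)" if "integrable N f" for N :: "'b measure"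
  proof -
    have "(\<integral>y. f y \<partial>N) = (\<integral>y. max 0 (f y) - max 0 (- f y) \<partial>N)"
      by (rule Bochner_Integration.integral_cong) auto
    also have "\<dots> = (\<integral>y. max 0 (f y) \<partial>N) - (\<integral>y. max 0 (- f y) \<partial>N)"
      using that by (intro Bochner_Integration.integral_diff) auto
    finally show ?thesis .
  qed
  \<comment> \<open>Where \<open>f\<close> is not integrable for \<open>K x\<close>, the integral of
    \<open>f\<close> has its default value 0 and the identity can fail; such \<open>x\<close> form a
    null set.\<close>
  have AE2: "AE x in M. (\<integral>y. max 0 (f y) \<partial>K x) - (\<integral>y. max 0 (- f y) \<partial>K x) = (\<integral>y. f y \<partial>K x)"
    using AE1 by eventually_elim (simp add: split)
  have D: "integrable M (\<lambda>x. (\<integral>y. max 0 (f y) \<partial>K x) - (\<integral>y. max 0 (- f y) \<partial>K x))"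
    using p n by auto
  have meas: "(\<lambda>x. \<integral>y. f y \<partial>K x) \<in> borel_measurable M" by measurable
  show "integrable M (\<lambda>x. \<integral>y. f y \<partial>K x)"
    using integrable_cong_AE_imp[OF D meas] AE2 by auto
  have "(\<integral>x. \<integral>y. f y \<partial>K x \<partial>M) = (\<integral>x. (\<integral>y. max 0 (f y) \<partial>K x) - (\<integral>y. max 0 (- f y) \<partial>K x) \<partial>M)"
    using AE2 D meas by (intro integral_cong_AE) auto
  also have "\<dots> = (\<integral>y. max 0 (f y) \<partial>(M \<bind> K)) - (\<integral>y. max 0 (- f y) \<partial>(M \<bind> K))"
    using p n by (simp add: Bochner_Integration.integral_diff)
  also have "\<dots> = (\<integral>y. f y \<partial>(M \<bind> K))" using split[OF f] by simp
  finally show "(\<integral>x. \<integral>y. f y \<partial>K x \<partial>M) = (\<integral>y. f y \<partial>(M \<bind> K))" .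
qed

section \<open>Operators induced by a kernel with an invariant measure\<close>

locale invariant_kernel = prob_space M for M :: "'a measure" +
  fixes K :: "'a \<Rightarrow> 'a measure"
  assumes K_measurable [measurable]: "K \<in> measurable M (subprob_algebra M)"
    and K_prob: "x \<in> space M \<Longrightarrow> prob_space (K x)"
    and K_invariant: "M \<bind> K = M"
begin

definition kernel_op :: "('a \<Rightarrow> real) \<Rightarrow> 'a \<Rightarrow> real" where
  "kernel_op f x = (\<integral>y. f y \<partial>K x)"

lemma kernel_op_integrable:
  assumes "integrable M f"
  shows "AE x in M. integrable (K x) f" "integrable M (kernel_op f)" "(\<integral>x. kernel_op f x \<partial>M) = (\<integral>x. f x \<partial>M)"
  using integral_bind_unbounded[OF K_measurable not_empty, unfolded K_invariant, OF assms] by (simp_all add: kernel_op_def[abs_def])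

lemma kernel_op_measurable [measurable]:
  assumes [measurable]: "f \<in> borel_measurable M"
  shows "kernel_op f \<in> borel_measurable M"
  unfolding kernel_op_def[abs_def] by measurable

text \<open>Nonnegativity of the variance of \<open>f\<close> under \<open>K x\<close>; integrated
  against the invariant measure, this is the contraction property.\<close>

lemma kernel_op_square_le:
  assumes f: "f \<in> L2 M"
  shows "AE x in M. (kernel_op f x)\<^sup>2 \<le> kernel_op (\<lambda>y. (f y)\<^sup>2) x"
proof -
  have "integrable M (\<lambda>y. (f y)\<^sup>2)" using f by (simp add: L2_real_iff)
  from kernel_op_integrable(1)[OF this] kernel_op_integrable(1)[OF L2_integrable[OF f]] AE_space
  show ?thesis
  proof eventually_elim
    fix x assume x: "integrable (K x) (\<lambda>y. (f y)\<^sup>2)" "integrable (K x) f" "x \<in> space M"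
    then interpret Kx: prob_space "K x" by (simp add: K_prob)
    show "(kernel_op f x)\<^sup>2 \<le> kernel_op (\<lambda>y. (f y)\<^sup>2) x"
      unfolding kernel_op_def by (rule Kx.square_integral_le) fact+
  qed
qed

lemma kernel_op_L2:
  assumes f: "f \<in> L2 M"
  shows "kernel_op f \<in> L2 M" "L2_norm M (kernel_op f) \<le> L2_norm M f"
proof -
  note [measurable] = L2D[OF f]
  have int: "integrable M (\<lambda>y. (f y)\<^sup>2)" using f by (simp add: L2_real_iff)
  note U = kernel_op_integrable[OF int]
  have "integrable M (\<lambda>x. (kernel_op f x)\<^sup>2)"
  proof (rule Bochner_Integration.integrable_bound[OF U(2)])
    show "AE x in M. norm ((kernel_op f x)\<^sup>2) \<le> norm (kernel_op (\<lambda>y. (f y)\<^sup>2) x)"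
      using kernel_op_square_le[OF f] by eventually_elim simp
  qed measurable
  then show "kernel_op f \<in> L2 M" by (simp add: L2_real_iff)
  have "(\<integral>x. (kernel_op f x)\<^sup>2 \<partial>M) \<le> (\<integral>x. kernel_op (\<lambda>y. (f y)\<^sup>2) x \<partial>M)"
    using kernel_op_square_le[OF f] \<open>kernel_op f \<in> L2 M\<close> by (intro integral_mono_AE U) (auto simp: L2_real_iff)
  also have "\<dots> = (\<integral>x. (f x)\<^sup>2 \<partial>M)" by (rule U)
  finally show "L2_norm M (kernel_op f) \<le> L2_norm M f" by (simp add: L2_norm_def)
qed

lemma kernel_op_linear:
  assumes f: "f \<in> L2 M" and g: "g \<in> L2 M"
  shows "AE x in M. kernel_op (\<lambda>x. f x + g x) x = kernel_op f x + kernel_op g x"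
    and "AE x in M. kernel_op (\<lambda>x. c * f x) x = c * kernel_op f x"
  using kernel_op_integrable(1)[OF L2_integrable[OF f]] kernel_op_integrable(1)[OF L2_integrable[OF g]]
  by (auto simp: kernel_op_def elim: eventually_elim2)

text \<open>
  \<open>\<integral> (f y - f x)\<^sup>2 K x (dy) = K f\<^sup>2 (x) - f (x)\<^sup>2\<close> if \<open>K f = f\<close>, and this has mean zero.
\<close>

lemma kernel_op_fixed_constant:
  assumes f: "f \<in> L2 M" and fix_f: "AE x in M. kernel_op f x = f x"
  shows "AE x in M. AE y in K x. f y = f x"
proof -
  note [measurable] = L2D[OF f]
  have int: "integrable M (\<lambda>y. (f y)\<^sup>2)" using f by (simp add: L2_real_iff)
  note U = kernel_op_integrable[OF int]
  have "AE x in M. kernel_op (\<lambda>y. (f y)\<^sup>2) x - (f x)\<^sup>2 = 0"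
  proof (subst integral_nonneg_eq_0_iff_AE[symmetric])
    show "integrable M (\<lambda>x. kernel_op (\<lambda>y. (f y)\<^sup>2) x - (f x)\<^sup>2)" using U(2) int by simp
    show "AE x in M. 0 \<le> kernel_op (\<lambda>y. (f y)\<^sup>2) x - (f x)\<^sup>2"
      using kernel_op_square_le[OF f] fix_f by eventually_elim simp
    show "(\<integral>x. kernel_op (\<lambda>y. (f y)\<^sup>2) x - (f x)\<^sup>2 \<partial>M) = 0" using U int by simp
  qed
  from this fix_f U(1) kernel_op_integrable(1)[OF L2_integrable[OF f]] AE_space
  show ?thesis
  proof eventually_elim
    fix x
    assume x: "kernel_op (\<lambda>y. (f y)\<^sup>2) x - (f x)\<^sup>2 = 0" "kernel_op f x = f x" "integrable (K x) (\<lambda>y. (f y)\<^sup>2)"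
      "integrable (K x) f" "x \<in> space M"
    then interpret Kx: prob_space "K x" by (simp add: K_prob)
    have eq: "(\<lambda>y. (f y - f x)\<^sup>2) = (\<lambda>y. (f y)\<^sup>2 - 2 * f x * f y + (f x)\<^sup>2)"
      by (simp add: power2_diff algebra_simps)
    have i: "integrable (K x) (\<lambda>y. (f y - f x)\<^sup>2)" unfolding eq using x by simp
    have "(\<integral>y. (f y - f x)\<^sup>2 \<partial>K x) = kernel_op (\<lambda>y. (f y)\<^sup>2) x - 2 * f x * kernel_op f x + (f x)\<^sup>2"
      unfolding eq kernel_op_def using x by (simp add: Kx.prob_space)
    also have "\<dots> = 0" using x(1,2) by (simp add: power2_eq_square)
    finally have "AE y in K x. (f y - f x)\<^sup>2 = 0"
      using integral_nonneg_eq_0_iff_AE[OF i] by simp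
    then show "AE y in K x. f y = f x" by eventually_elim simp
  qed
qed

end

section \<open>Semigroups of Markov processes\<close>

locale markov_semigroup = prob_space M for M :: "'a measure" +
  fixes W :: "'w measure" and Q :: "'a \<Rightarrow> 'w measure" and X :: "real \<Rightarrow> 'w \<Rightarrow> 'a"
  assumes markov: "markov_process M W Q X"
    and invariant: "invariant_measure M Q X"
    and strongly_cont: "strongly_continuous M (semigroup Q X)"
begin

text \<open>The transition probabilities as measures on the state space, so that composition in time
  becomes \<open>bind\<close>.\<close>

definition trans_kernel :: "real \<Rightarrow> 'a \<Rightarrow> 'a measure" where
  "trans_kernel t x = distr (Q x) M (X t)"

lemma Q_prob: "x \<in> space M \<Longrightarrow> prob_space (Q x)"
  and Q_sets: "x \<in> space M \<Longrightarrow> sets (Q x) = sets W"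
  and X_measurable_W: "0 \<le> t \<Longrightarrow> X t \<in> measurable W M"
  and trans_prob_measurable: "\<lbrakk>0 \<le> t; B \<in> sets M\<rbrakk> \<Longrightarrow> (\<lambda>x. trans_prob Q X t x B) \<in> borel_measurable M"
  and trans_prob_0: "\<lbrakk>x \<in> space M; B \<in> sets M\<rbrakk> \<Longrightarrow> trans_prob Q X 0 x B = indicator B x"
  and markov_property: "\<lbrakk>x \<in> space M; 0 \<le> s; 0 \<le> t; B \<in> sets M\<rbrakk> \<Longrightarrow> AE \<omega> in Q x.
    real_cond_exp (Q x) (natural_filtration M W X s) (indicator {\<omega> \<in> space W. X (s + t) \<omega> \<in> B}) \<omega>
      = trans_prob Q X t (X s \<omega>) B"
  using markov unfolding markov_process_def by blast+

lemma Q_space: "x \<in> space M \<Longrightarrow> space (Q x) = space W"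
  by (rule sets_eq_imp_space_eq[OF Q_sets])

lemma X_measurable: "\<lbrakk>0 \<le> t; x \<in> space M\<rbrakk> \<Longrightarrow> X t \<in> measurable (Q x) M"
  using X_measurable_W measurable_cong_sets[OF Q_sets refl] by blast

lemma trans_kernel_prob: "\<lbrakk>0 \<le> t; x \<in> space M\<rbrakk> \<Longrightarrow> prob_space (trans_kernel t x)"
  unfolding trans_kernel_def by (intro prob_space.prob_space_distr Q_prob X_measurable)

lemma emeasure_trans_kernel:
  assumes "0 \<le> t" "x \<in> space M" "B \<in> sets M"
  shows "emeasure (trans_kernel t x) B = ennreal (trans_prob Q X t x B)"
proof -
  interpret Qx: prob_space "Q x" by (rule Q_prob) fact
  have "X t -` B \<inter> space (Q x) = {\<omega> \<in> space (Q x). X t \<omega> \<in> B}" by auto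
  then show ?thesis
    unfolding trans_kernel_def trans_prob_def
    using assms by (simp add: emeasure_distr X_measurable Qx.emeasure_eq_measure)
qed

lemma trans_kernel_measurable: "0 \<le> t \<Longrightarrow> trans_kernel t \<in> measurable M (subprob_algebra M)"
proof (rule measurable_subprob_algebra)
  fix x assume "0 \<le> t" "x \<in> space M"
  then show "subprob_space (trans_kernel t x)"
    by (intro prob_space_imp_subprob_space trans_kernel_prob)
  show "sets (trans_kernel t x) = sets M" by (simp add: trans_kernel_def)
next
  fix B assume "0 \<le> t" "B \<in> sets M"
  then have "(\<lambda>x. ennreal (trans_prob Q X t x B)) \<in> borel_measurable M"
    using trans_prob_measurable by measurable
  then show "(\<lambda>x. emeasure (trans_kernel t x) B) \<in> borel_measurable M"
    using \<open>0 \<le> t\<close> \<open>B \<in> sets M\<close> by (subst measurable_cong[OF emeasure_trans_kernel])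
qed

lemma trans_prob_bounds: "x \<in> space M \<Longrightarrow> 0 \<le> trans_prob Q X t x B \<and> trans_prob Q X t x B \<le> 1"
  using prob_space.prob_le_1[OF Q_prob] by (auto simp: trans_prob_def)

lemma trans_kernel_invariant:
  assumes t: "0 \<le> t"
  shows "M \<bind> trans_kernel t = M"
proof (rule measure_eqI)
  show sets: "sets (M \<bind> trans_kernel t) = sets M"
    using not_empty by (intro sets_bind) (auto simp: trans_kernel_def)
  fix B assume "B \<in> sets (M \<bind> trans_kernel t)"
  then have B: "B \<in> sets M" by (simp add: sets)
  have int: "integrable M (\<lambda>x. trans_prob Q X t x B)"
    using trans_prob_measurable[OF t B] trans_prob_bounds
    by (intro integrable_const_bound[of _ 1]) auto
  have "emeasure (M \<bind> trans_kernel t) B = (\<integral>\<^sup>+x. emeasure (trans_kernel t x) B \<partial>M)"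
    by (rule emeasure_bind[OF not_empty trans_kernel_measurable[OF t] B])
  also have "\<dots> = (\<integral>\<^sup>+x. ennreal (trans_prob Q X t x B) \<partial>M)"
    using t B by (intro nn_integral_cong emeasure_trans_kernel)
  also have "\<dots> = ennreal (\<integral>x. trans_prob Q X t x B \<partial>M)"
    using trans_prob_bounds by (intro nn_integral_eq_integral int) auto
  also have "\<dots> = emeasure M B"
    using invariant t B by (simp add: invariant_measure_def emeasure_eq_measure)
  finally show "emeasure (M \<bind> trans_kernel t) B = emeasure M B" .
qed

lemma invariant_kernel_trans: "0 \<le> t \<Longrightarrow> invariant_kernel M (trans_kernel t)"
  by (intro invariant_kernel.intro invariant_kernel_axioms.intro prob_space_axioms)
    (simp_all add: trans_kernel_measurable trans_kernel_prob trans_kernel_invariant)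

text \<open>Take expectations in the Markov property: conditioning on the natural filtration
  preserves the expectation of the indicator, and the other side depends on the path only through
  \<open>X s\<close>.\<close>

lemma chapman_kolmogorov:
  assumes x: "x \<in> space M" and s: "0 \<le> s" and t: "0 \<le> t"
  shows "trans_kernel (s + t) x = trans_kernel s x \<bind> trans_kernel t"
proof (rule measure_eqI)
  interpret Qx: prob_space "Q x" by (rule Q_prob[OF x])
  have ne: "space (trans_kernel s x) \<noteq> {}" using not_empty by (simp add: trans_kernel_def)
  have meas: "trans_kernel t \<in> measurable (trans_kernel s x) (subprob_algebra M)"
    using trans_kernel_measurable[OF t] by (simp add: trans_kernel_def)
  have "sets (trans_kernel (s + t) x) = sets M" by (simp add: trans_kernel_def)
  then show "sets (trans_kernel (s + t) x) = sets (trans_kernel s x \<bind> trans_kernel t)"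
    using sets_bind[OF sets_kernel[OF meas] ne] by (simp only:)
  fix B assume "B \<in> sets (trans_kernel (s + t) x)"
  then have B: "B \<in> sets M" by (simp add: trans_kernel_def)
  let ?F = "natural_filtration M W X s"
  let ?A = "{\<omega> \<in> space W. X (s + t) \<omega> \<in> B}"
  have gen: "{{\<omega> \<in> space W. X u \<omega> \<in> B} | u B. 0 \<le> u \<and> u \<le> s \<and> B \<in> sets M} \<subseteq> Pow (space W)" by auto
  have "{\<omega> \<in> space W. X u \<omega> \<in> C} \<in> sets W" if "0 \<le> u" "C \<in> sets M" for u C
    using measurable_sets[OF X_measurable_W that(2)] that(1) by (simp add: vimage_def Int_def conj_commute)
  then have "sigma_sets (space W) {{\<omega> \<in> space W. X u \<omega> \<in> B} | u B. 0 \<le> u \<and> u \<le> s \<and> B \<in> sets M} \<subseteq> sets W"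
    by (intro sets.sigma_sets_subset) auto
  then have "subalgebra (Q x) ?F"
    using gen by (simp add: subalgebra_def natural_filtration_def space_measure_of sets_measure_of Q_space[OF x] Q_sets[OF x])
  then interpret sigma_finite_subalgebra "Q x" ?F
    by (intro finite_measure_subalgebra.axioms finite_measure_subalgebra_is_sigma_finite) (auto simp: finite_measure_subalgebra_def finite_measure_subalgebra_axioms_def Qx.finite_measure_axioms)
  have A: "?A \<in> sets (Q x)"
    using measurable_sets[OF X_measurable_W[of "s + t"] B] s t
    by (simp add: vimage_def Int_def conj_commute Q_sets[OF x])
  have ind: "integrable (Q x) (indicator ?A :: _ \<Rightarrow> real)"
    using A by (simp add: Qx.emeasure_eq_measure)
  have Xs: "X s \<in> measurable (Q x) M" by (rule X_measurable[OF s x])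
  have tp: "(\<lambda>\<omega>. trans_prob Q X t (X s \<omega>) B) \<in> borel_measurable (Q x)"
    using measurable_compose[OF Xs trans_prob_measurable[OF t B]] .
  have Xs_space: "X s \<omega> \<in> space M" if "\<omega> \<in> space (Q x)" for \<omega>
    using measurable_space[OF Xs that] .
  have int: "integrable (Q x) (\<lambda>\<omega>. trans_prob Q X t (X s \<omega>) B)"
    using tp trans_prob_bounds[OF Xs_space] by (intro Qx.integrable_const_bound[of _ 1]) auto
  have "(\<integral>\<omega>. trans_prob Q X t (X s \<omega>) B \<partial>Q x) = (\<integral>\<omega>. real_cond_exp (Q x) ?F (indicator ?A) \<omega> \<partial>Q x)"
    using markov_property[OF x s t B] tp by (intro integral_cong_AE) auto
  also have "\<dots> = (\<integral>\<omega>. indicator ?A \<omega> \<partial>Q x)" by (rule real_cond_exp_int(2)[OF ind])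
  also have "\<dots> = trans_prob Q X (s + t) x B"
    using A sets.sets_into_space[OF A] by (simp add: trans_prob_def Q_space[OF x] Int_absorb2)
  finally have eq: "(\<integral>\<omega>. trans_prob Q X t (X s \<omega>) B \<partial>Q x) = trans_prob Q X (s + t) x B" .
  have "emeasure (trans_kernel s x \<bind> trans_kernel t) B = (\<integral>\<^sup>+y. emeasure (trans_kernel t y) B \<partial>trans_kernel s x)"
    by (rule emeasure_bind[OF ne meas B])
  also have "\<dots> = (\<integral>\<^sup>+\<omega>. emeasure (trans_kernel t (X s \<omega>)) B \<partial>Q x)"
    unfolding trans_kernel_def[of s]
    by (rule nn_integral_distr[OF Xs])
      (use measurable_emeasure_kernel[OF trans_kernel_measurable[OF t] B] in simp)
  also have "\<dots> = (\<integral>\<^sup>+\<omega>. ennreal (trans_prob Q X t (X s \<omega>) B) \<partial>Q x)"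
    using Xs_space t B by (intro nn_integral_cong emeasure_trans_kernel)
  also have "\<dots> = ennreal (\<integral>\<omega>. trans_prob Q X t (X s \<omega>) B \<partial>Q x)"
    using trans_prob_bounds[OF Xs_space] by (intro nn_integral_eq_integral int) auto
  also have "\<dots> = emeasure (trans_kernel (s + t) x) B"
    using s t x B by (simp add: eq emeasure_trans_kernel)
  finally show "emeasure (trans_kernel (s + t) x) B = emeasure (trans_kernel s x \<bind> trans_kernel t) B" ..
qed

abbreviation T :: "real \<Rightarrow> ('a \<Rightarrow> real) \<Rightarrow> 'a \<Rightarrow> real" where
  "T \<equiv> semigroup Q X"

lemma semigroup_eq_kernel_op:
  assumes "0 \<le> t" "x \<in> space M" "f \<in> borel_measurable M"
  shows "T t f x = invariant_kernel.kernel_op (trans_kernel t) f x"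
  using assms X_measurable[OF assms(1,2)]
  by (simp add: semigroup_def invariant_kernel.kernel_op_def[OF invariant_kernel_trans] trans_kernel_def integral_distr)

lemma semigroup_AE_kernel_op:
  "\<lbrakk>0 \<le> t; f \<in> borel_measurable M\<rbrakk> \<Longrightarrow> AE x in M. T t f x = invariant_kernel.kernel_op (trans_kernel t) f x"
  by (intro AE_I2 semigroup_eq_kernel_op)

lemma semigroup_L2:
  assumes t: "0 \<le> t" and f: "f \<in> L2 M"
  shows "T t f \<in> L2 M" "L2_norm M (T t f) \<le> L2_norm M f"
proof -
  interpret k: invariant_kernel M "trans_kernel t" by (rule invariant_kernel_trans[OF t])
  have fm: "f \<in> borel_measurable M" using f by (rule L2D)
  have eq: "x \<in> space M \<Longrightarrow> T t f x = k.kernel_op f x" for x using semigroup_eq_kernel_op[OF t _ fm] .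
  have "(T t f \<in> borel_measurable M) = (k.kernel_op f \<in> borel_measurable M)"
    by (rule measurable_cong) (rule eq)
  moreover have "integrable M (\<lambda>x. (T t f x)\<^sup>2) = integrable M (\<lambda>x. (k.kernel_op f x)\<^sup>2)"
    by (rule Bochner_Integration.integrable_cong) (simp_all add: eq)
  ultimately show "T t f \<in> L2 M" using k.kernel_op_L2(1)[OF f] by (simp add: L2_real_iff)
  have "L2_norm M (T t f) = L2_norm M (k.kernel_op f)"
    unfolding L2_norm_def by (intro arg_cong[of _ _ sqrt] Bochner_Integration.integral_cong) (simp_all add: eq)
  then show "L2_norm M (T t f) \<le> L2_norm M f" using k.kernel_op_L2(2)[OF f] by simp
qed

text \<open>Chapman-Kolmogorov may be integrated against \<open>f\<close> at those \<open>x\<close>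
  where \<open>f\<close> is integrable for the kernel at time \<open>s + t\<close>; by invariance
  these are almost all.\<close>

lemma semigroup_compose:
  assumes s: "0 \<le> s" and t: "0 \<le> t" and f: "f \<in> L2 M"
  shows "AE x in M. T s (T t f) x = T (s + t) f x"
proof -
  interpret ks: invariant_kernel M "trans_kernel s" by (rule invariant_kernel_trans[OF s])
  interpret kt: invariant_kernel M "trans_kernel t" by (rule invariant_kernel_trans[OF t])
  have st: "0 \<le> s + t" using s t by simp
  interpret kst: invariant_kernel M "trans_kernel (s + t)" by (rule invariant_kernel_trans[OF st])
  have fm: "f \<in> borel_measurable M" using f by (rule L2D)
  have Tm: "T t f \<in> borel_measurable M" using semigroup_L2(1)[OF t f] by (rule L2D)
  from kst.kernel_op_integrable(1)[OF L2_integrable[OF f]] AE_space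
  show ?thesis
  proof eventually_elim
    fix x assume int: "integrable (trans_kernel (s + t) x) f" and x: "x \<in> space M"
    have ne: "space (trans_kernel s x) \<noteq> {}" using not_empty by (simp add: trans_kernel_def)
    have meas: "trans_kernel t \<in> measurable (trans_kernel s x) (subprob_algebra M)"
      using trans_kernel_measurable[OF t] by (simp add: trans_kernel_def)
    have "T s (T t f) x = (\<integral>y. T t f y \<partial>trans_kernel s x)"
      using semigroup_eq_kernel_op[OF s x Tm] by (simp add: ks.kernel_op_def)
    also have "\<dots> = (\<integral>y. \<integral>z. f z \<partial>trans_kernel t y \<partial>trans_kernel s x)"
      by (rule Bochner_Integration.integral_cong) (auto simp: trans_kernel_def[of s] semigroup_eq_kernel_op[OF t _ fm] kt.kernel_op_def)
    also have "\<dots> = (\<integral>z. f z \<partial>(trans_kernel s x \<bind> trans_kernel t))"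
      by (rule integral_bind_unbounded(3)[OF meas ne]) (use int chapman_kolmogorov[OF x s t] in simp)
    also have "\<dots> = T (s + t) f x"
      using semigroup_eq_kernel_op[OF st x fm] by (simp add: kst.kernel_op_def chapman_kolmogorov[OF x s t])
    finally show "T s (T t f) x = T (s + t) f x" .
  qed
qed

lemma semigroup_0:
  assumes f: "f \<in> L2 M"
  shows "AE x in M. T 0 f x = f x"
proof (rule AE_I2)
  fix x assume x: "x \<in> space M"
  have fm: "f \<in> borel_measurable M" using f by (rule L2D)
  have "trans_kernel 0 x = return M x"
    by (rule measure_eqI) (auto simp: trans_kernel_def[of 0] emeasure_trans_kernel[OF _ x, of 0, unfolded trans_kernel_def] trans_prob_0[OF x] split: split_indicator)
  then show "T 0 f x = f x"
    using semigroup_eq_kernel_op[OF _ x fm, of 0] x fm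
    by (simp add: invariant_kernel.kernel_op_def[OF invariant_kernel_trans] integral_return)
qed

sublocale semi_hilbert "L2 M" "L2_inner M"
  by (rule semi_hilbert_L2)

lemma nrm_eq_L2_norm: "nrm f = L2_norm M f"
  by (simp add: nrm_def L2_norm_eq_sqrt_inner)

sublocale contraction_semigroup "L2 M" "L2_inner M" "semigroup Q X"
proof
  fix t :: real and f :: "'a \<Rightarrow> real" assume t: "0 \<le> t" and f: "f \<in> L2 M"
  interpret k: invariant_kernel M "trans_kernel t" by (rule invariant_kernel_trans[OF t])
  have fm: "f \<in> borel_measurable M" using f by (rule L2D)
  show "T t f \<in> L2 M" "nrm (T t f) \<le> nrm f"
    using semigroup_L2[OF t f] by (simp_all add: nrm_eq_L2_norm)
  {
    fix g u :: "'a \<Rightarrow> real" assume g: "g \<in> L2 M" and u: "u \<in> L2 M"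
    have fgm: "(\<lambda>x. f x + g x) \<in> borel_measurable M" using f g by measurable
    have fg: "f + g \<in> L2 M" using f g by simp
    have "AE x in M. T t (f + g) x = (T t f + T t g) x"
      using semigroup_AE_kernel_op[OF t fm] semigroup_AE_kernel_op[OF t L2D[OF g]] semigroup_AE_kernel_op[OF t fgm] k.kernel_op_linear(1)[OF f g]
      by eventually_elim (simp add: plus_fun_def)
    then have "L2_inner M (T t (f + g)) u = L2_inner M (T t f + T t g) u"
      using f g u fg t by (intro L2_inner_cong_AE semigroup_L2 mem_H) auto
    then show "L2_inner M (T t (f + g)) u = L2_inner M (T t f) u + L2_inner M (T t g) u"
      using f g u t by (simp add: ip_add_left semigroup_L2)
  next
    fix c :: real and u :: "'a \<Rightarrow> real" assume u: "u \<in> L2 M"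
    have fgm: "(\<lambda>x. c * f x) \<in> borel_measurable M" using f by measurable
    have fg: "c *\<^sub>R f \<in> L2 M" using f by simp
    have "AE x in M. T t (c *\<^sub>R f) x = (c *\<^sub>R T t f) x"
      using semigroup_AE_kernel_op[OF t fm] semigroup_AE_kernel_op[OF t fgm] k.kernel_op_linear(2)[OF f f]
      by eventually_elim (simp add: scaleR_fun_def)
    then have "L2_inner M (T t (c *\<^sub>R f)) u = L2_inner M (c *\<^sub>R T t f) u"
      using f u fg t by (intro L2_inner_cong_AE semigroup_L2 mem_H) auto
    then show "L2_inner M (T t (c *\<^sub>R f)) u = c * L2_inner M (T t f) u"
      using f u t by (simp add: ip_scaleR_left semigroup_L2)
  }
next
  fix s t :: real and f u :: "'a \<Rightarrow> real" assume "0 \<le> s" "0 \<le> t" "f \<in> L2 M" "u \<in> L2 M"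
  then show "L2_inner M (T s (T t f)) u = L2_inner M (T (s + t) f) u"
    by (intro L2_inner_cong_AE semigroup_L2 semigroup_compose) auto
next
  fix f u :: "'a \<Rightarrow> real" assume "f \<in> L2 M" "u \<in> L2 M"
  then show "L2_inner M (T 0 f) u = L2_inner M f u"
    by (intro L2_inner_cong_AE semigroup_L2 semigroup_0) auto
next
  fix f :: "'a \<Rightarrow> real" assume "f \<in> L2 M"
  then show "((\<lambda>t. nrm (T t f - f)) \<longlongrightarrow> 0) (at_right 0)"
    using strongly_cont by (simp add: strongly_continuous_def nrm_eq_L2_norm fun_diff_def)
qed

lemma generator_iff: "(f, g) \<in> generator \<longleftrightarrow> f \<in> L2 M \<and> g \<in> L2 M \<and> has_L2_derivative M (semigroup Q X) f g"
proof -
  have "quot_err t f g = (\<lambda>x. (T t f x - f x) / t - g x)" for t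
    by (simp add: quot_err_def fun_eq_iff)
  then show ?thesis by (simp add: generator_def has_L2_derivative_def nrm_eq_L2_norm)
qed

lemma generator_one: "((\<lambda>x. 1), 0) \<in> generator"
proof (rule generatorI)
  fix t :: real assume t: "0 < t"
  have "AE x in M. quot_err t (\<lambda>x. 1) 0 x = 0"
  proof (rule AE_I2)
    fix x assume "x \<in> space M"
    then interpret Qx: prob_space "Q x" by (rule Q_prob)
    show "quot_err t (\<lambda>x. 1) 0 x = 0" by (simp add: quot_err_def semigroup_def Qx.prob_space)
  qed
  moreover have "quot_err t (\<lambda>x. 1) 0 \<in> L2 M" using t by (intro quot_err_mem L2_const mem_H) auto
  ultimately have "L2_inner M (quot_err t (\<lambda>x. 1) 0) (quot_err t (\<lambda>x. 1) 0) = 0"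
    by (subst L2_null_iff) auto
  then show "nrm (quot_err t (\<lambda>x. 1) 0) \<le> 0" by (simp add: nrm_def)
qed (auto simp: L2_const)

text \<open>Invariance preserves the mean under \<open>T t\<close>, so the difference quotients have
  mean zero. For the perturbed generator this takes the place of the symmetry argument that works
  for the reference generator.\<close>

lemma generator_range_mean_zero:
  assumes fg: "(f, g) \<in> generator"
  shows "L2_inner M g (\<lambda>x. 1) = 0"
proof -
  note m = generator_mem[OF fg]
  have "\<bar>L2_inner M g (\<lambda>x. 1)\<bar> \<le> nrm (quot_err t f g) * nrm (\<lambda>x. 1)" if t: "0 < t" for t
  proof -
    have t0: "0 \<le> t" using t by simp
    interpret k: invariant_kernel M "trans_kernel t" by (rule invariant_kernel_trans[OF t0])
    have "(\<integral>x. T t f x \<partial>M) = (\<integral>x. k.kernel_op f x \<partial>M)"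
      by (rule Bochner_Integration.integral_cong) (auto simp: semigroup_eq_kernel_op[OF t0 _ L2D[OF m(1)]])
    also have "\<dots> = (\<integral>x. f x \<partial>M)" by (rule k.kernel_op_integrable[OF L2_integrable[OF m(1)]])
    finally have "L2_inner M (T t f) (\<lambda>x. 1) = L2_inner M f (\<lambda>x. 1)" by (simp add: L2_inner_def)
    then have "L2_inner M (quot_err t f g) (\<lambda>x. 1) = - L2_inner M g (\<lambda>x. 1)"
      using m t L2_const[of 1] by (simp add: quot_err_def ip_simps)
    then show ?thesis
      using Cauchy_Schwarz[of "quot_err t f g" "\<lambda>x. 1"] m t L2_const[of 1] by simp
  qed
  then have "\<bar>L2_inner M g (\<lambda>x. 1)\<bar> \<le> 0 * nrm (\<lambda>x. 1)"
    by (intro tendsto_lowerbound[OF tendsto_mult[OF generator_lim[OF fg] tendsto_const]])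
      (auto intro: eventually_mono[OF at_right_0_pos])
  then show ?thesis by simp
qed

text \<open>A function in the kernel is fixed by every \<open>T t\<close>, hence almost surely
  constant along transitions, and the set where it is positive is invariant. By ergodicity the
  function has one sign almost everywhere, and its mean is zero.\<close>

lemma ergodic_kernel:
  assumes erg: "ergodic M Q X" and f0: "(f, 0) \<in> generator" and mean: "L2_inner M f (\<lambda>x. 1) = 0"
  shows "L2_inner M f f = 0"
proof -
  have f: "f \<in> L2 M" using generator_mem[OF f0] by simp
  note [measurable] = L2D[OF f]
  define B where "B = {x \<in> space M. f x > 0}"
  have B: "B \<in> sets M" unfolding B_def by measurable
  have inv: "AE x in M. trans_prob Q X t x B = indicator B x" if t: "0 \<le> t" for t
  proof -
    interpret k: invariant_kernel M "trans_kernel t" by (rule invariant_kernel_trans[OF t])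
    have "L2_inner M (T t f - f) (T t f - f) = 0"
      using T_fixed_of_kernel[OF f0 t] by (simp add: nrm_def)
    then have "AE x in M. (T t f - f) x = 0" using L2_null_iff[of "T t f - f" M] f t by simp
    then have "AE x in M. k.kernel_op f x = f x"
      using semigroup_AE_kernel_op[OF t L2D[OF f]] by eventually_elim simp
    from k.kernel_op_fixed_constant[OF f this] AE_space
    show ?thesis
    proof eventually_elim
      fix x assume AE: "AE y in trans_kernel t x. f y = f x" and x: "x \<in> space M"
      interpret Kx: prob_space "trans_kernel t x" by (rule trans_kernel_prob[OF t x])
      have sp: "space (trans_kernel t x) = space M" by (simp add: trans_kernel_def)
      have "AE y in trans_kernel t x. y \<in> B \<longleftrightarrow> x \<in> B"
        using AE AE_space by eventually_elim (auto simp: B_def sp x)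
      then have "Kx.prob B = indicator B x"
      proof (cases "x \<in> B")
        case True
        then have "AE y in trans_kernel t x. y \<in> B" using \<open>AE y in _. y \<in> B \<longleftrightarrow> x \<in> B\<close> by simp
        then have "Kx.prob B = 1" using B by (subst Kx.prob_eq_1) (auto simp: trans_kernel_def)
        then show ?thesis using True by simp
      next
        case False
        then have "AE y in trans_kernel t x. y \<notin> B" using \<open>AE y in _. y \<in> B \<longleftrightarrow> x \<in> B\<close> by simp
        then have "Kx.prob B = 0" using B by (subst Kx.prob_eq_0) (auto simp: trans_kernel_def)
        then show ?thesis using False by simp
      qed
      moreover have "Kx.prob B = trans_prob Q X t x B"
        using emeasure_trans_kernel[OF t x B] trans_prob_bounds[OF x] by (simp add: Kx.emeasure_eq_measure)
      ultimately show "trans_prob Q X t x B = indicator B x" by simp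
    qed
  qed
  have int: "integrable M f" by (rule L2_integrable[OF f])
  have mean0: "(\<integral>x. f x \<partial>M) = 0" using mean by (simp add: L2_inner_def)
  have "measure M B = 0 \<or> measure M B = 1" using erg B inv unfolding ergodic_def by blast
  then have "AE x in M. f x = 0"
  proof
    assume "measure M B = 0"
    then have "AE x in M. x \<notin> B" using B prob_eq_0 by blast
    then have AE: "AE x in M. 0 \<le> - f x" using AE_space by eventually_elim (auto simp: B_def not_less)
    have "AE x in M. - f x = 0"
      using integral_nonneg_eq_0_iff_AE[OF integrable_minus[OF int] AE] mean0 by simp
    then show ?thesis by eventually_elim simp
  next
    assume "measure M B = 1"
    then have "AE x in M. x \<in> B" using B prob_eq_1 by blast
    then have AE: "AE x in M. 0 \<le> f x" by eventually_elim (auto simp: B_def)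
    show ?thesis using integral_nonneg_eq_0_iff_AE[OF int AE] mean0 by simp
  qed
  then show ?thesis using L2_null_iff[OF f] by simp
qed

end

section \<open>Comparison of spectral gaps\<close>

lemma L2_norm_complex:
  fixes f :: "'a \<Rightarrow> complex"
  assumes "(\<lambda>x. Re (f x)) \<in> L2 M" "(\<lambda>x. Im (f x)) \<in> L2 M"
  shows "L2_norm M f = sqrt (L2_inner M (\<lambda>x. Re (f x)) (\<lambda>x. Re (f x)) + L2_inner M (\<lambda>x. Im (f x)) (\<lambda>x. Im (f x)))"
proof -
  have "(\<integral>x. (norm (f x))\<^sup>2 \<partial>M) = (\<integral>x. Re (f x) * Re (f x) + Im (f x) * Im (f x) \<partial>M)"
    by (rule Bochner_Integration.integral_cong) (simp_all add: cmod_power2 flip: power2_eq_square)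
  also have "\<dots> = (\<integral>x. Re (f x) * Re (f x) \<partial>M) + (\<integral>x. Im (f x) * Im (f x) \<partial>M)"
    using assms by (intro Bochner_Integration.integral_add L2_integrable_mult)
  finally show ?thesis by (simp add: L2_norm_def L2_inner_def)
qed

lemma L2_complex_parts:
  fixes f :: "'a \<Rightarrow> complex"
  assumes "f \<in> L2 M"
  shows "(\<lambda>x. Re (f x)) \<in> L2 M" "(\<lambda>x. Im (f x)) \<in> L2 M"
proof -
  have fm: "f \<in> borel_measurable M" using assms by (simp add: L2_def)
  have int: "integrable M (\<lambda>x. (norm (f x))\<^sup>2)" using assms by (simp add: L2_def)
  note [measurable] = fm
  show "(\<lambda>x. Re (f x)) \<in> L2 M" "(\<lambda>x. Im (f x)) \<in> L2 M"
    unfolding L2_real_iff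
    by (intro conjI Bochner_Integration.integrable_bound[OF int]; simp add: cmod_power2)+
qed

text \<open>The single bound serves twice: it gives injectivity modulo null sets and, after a square
  root, the bounded inverse.\<close>

lemma resolvent_setI:
  fixes L :: "('a \<Rightarrow> real) \<Rightarrow> 'a \<Rightarrow> real"
  assumes D: "D \<subseteq> L2 M" and L: "\<And>f. f \<in> D \<Longrightarrow> L f \<in> L2 M"
    and bound: "\<And>f1 f2 r1 r2. \<lbrakk>f1 \<in> D; f2 \<in> D; r1 = a *\<^sub>R f1 - b *\<^sub>R f2 - L f1; r2 = b *\<^sub>R f1 + a *\<^sub>R f2 - L f2\<rbrakk>
      \<Longrightarrow> L2_inner M f1 f1 + L2_inner M f2 f2 \<le> C * (L2_inner M r1 r1 + L2_inner M r2 r2)"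
    and surj: "\<And>h1 h2. \<lbrakk>h1 \<in> L2 M; h2 \<in> L2 M\<rbrakk> \<Longrightarrow> \<exists>f1\<in>D. \<exists>f2\<in>D.
      (AE x in M. a * f1 x - b * f2 x - L f1 x = h1 x) \<and> (AE x in M. b * f1 x + a * f2 x - L f2 x = h2 x)"
  shows "Complex a b \<in> resolvent_set M D L"
proof -
  define R where "R = (\<lambda>f x. Complex a b * f x - complex_extension L f x)"
  have sub: "subspace (L2 M :: ('a \<Rightarrow> real) set)" by (rule subspace_L2)
  have norms: "L2_norm M f \<le> sqrt C * L2_norm M (R f)"
    and zero: "(AE x in M. R f x = 0) \<Longrightarrow> (AE x in M. f x = 0)"
    if f: "f \<in> complex_domain D" for f
  proof -
    define f1 where "f1 = (\<lambda>x. Re (f x))"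
    define f2 where "f2 = (\<lambda>x. Im (f x))"
    define r1 where "r1 = a *\<^sub>R f1 - b *\<^sub>R f2 - L f1"
    define r2 where "r2 = b *\<^sub>R f1 + a *\<^sub>R f2 - L f2"
    have fD: "f1 \<in> D" "f2 \<in> D" using f by (auto simp: complex_domain_def f1_def f2_def)
    have fL: "f1 \<in> L2 M" "f2 \<in> L2 M" using fD D by auto
    have rL: "r1 \<in> L2 M" "r2 \<in> L2 M"
      using fL fD L by (simp_all add: r1_def r2_def subspace_diff[OF sub] subspace_add[OF sub] subspace_scale[OF sub])
    have Rf: "(\<lambda>x. Re (R f x)) = r1" "(\<lambda>x. Im (R f x)) = r2"
      by (auto simp: R_def complex_extension_def r1_def r2_def f1_def[symmetric] f2_def[symmetric] fun_eq_iff)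
        (auto simp: f1_def f2_def)
    have nf: "L2_norm M f = sqrt (L2_inner M f1 f1 + L2_inner M f2 f2)"
      using L2_norm_complex[of f M] fL by (simp add: f1_def f2_def)
    have nR: "L2_norm M (R f) = sqrt (L2_inner M r1 r1 + L2_inner M r2 r2)"
      using L2_norm_complex[of "R f" M] rL by (simp add: Rf)
    note b = bound[OF fD r1_def r2_def]
    then have "sqrt (L2_inner M f1 f1 + L2_inner M f2 f2) \<le> sqrt (C * (L2_inner M r1 r1 + L2_inner M r2 r2))"
      by (simp only: real_sqrt_le_iff)
    then show "L2_norm M f \<le> sqrt C * L2_norm M (R f)" by (simp add: nf nR real_sqrt_mult)
    assume AE: "AE x in M. R f x = 0"
    have "AE x in M. r1 x = 0" "AE x in M. r2 x = 0"
      using AE by (auto simp flip: Rf elim: eventually_mono)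
    then have "L2_inner M r1 r1 = 0" "L2_inner M r2 r2 = 0" using rL by (auto simp: L2_null_iff)
    with b have "L2_inner M f1 f1 + L2_inner M f2 f2 \<le> 0" by simp
    moreover have "0 \<le> L2_inner M f1 f1" "0 \<le> L2_inner M f2 f2" by (auto simp: L2_inner_def)
    ultimately have "L2_inner M f1 f1 = 0" "L2_inner M f2 f2 = 0" by linarith+
    then have "AE x in M. f1 x = 0" "AE x in M. f2 x = 0" using fL by (auto simp: L2_null_iff)
    then show "AE x in M. f x = 0"
      by eventually_elim (simp add: f1_def f2_def complex_eq_iff)
  qed
  moreover have "\<exists>f\<in>complex_domain D. AE x in M. R f x = h x" if h: "h \<in> L2 M" for h :: "'a \<Rightarrow> complex"
  proof -
    obtain f1 f2 where f: "f1 \<in> D" "f2 \<in> D" "AE x in M. a * f1 x - b * f2 x - L f1 x = Re (h x)"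
      "AE x in M. b * f1 x + a * f2 x - L f2 x = Im (h x)"
      using surj[OF L2_complex_parts[OF h]] by blast
    have "(\<lambda>x. Complex (f1 x) (f2 x)) \<in> complex_domain D" using f by (simp add: complex_domain_def)
    moreover have "AE x in M. R (\<lambda>x. Complex (f1 x) (f2 x)) x = h x"
      using f(3,4) by eventually_elim (simp add: R_def complex_extension_def complex_eq_iff add.commute)
    ultimately show ?thesis by blast
  qed
  ultimately show ?thesis
    unfolding resolvent_set_def R_def[symmetric] by (auto simp: Let_def R_def)
qed

text \<open>For real \<open>s\<close> the real part of a complex solution solves the real equation.
  Conversely a real \<open>f\<close> is embedded with imaginary part 0; the imaginary part of the
  result is then \<open>- L (\<lambda>x. 0)\<close>, which is only almost everywhere 0.\<close>

lemma resolvent_set_realD: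
  fixes L :: "('a \<Rightarrow> real) \<Rightarrow> 'a \<Rightarrow> real"
  assumes s: "complex_of_real s \<in> resolvent_set M D L"
    and D: "D \<subseteq> L2 M" and L: "\<And>f. f \<in> D \<Longrightarrow> L f \<in> L2 M"
    and zero: "(\<lambda>x. 0) \<in> D" "AE x in M. L (\<lambda>x. 0) x = 0"
  shows "h \<in> L2 M \<Longrightarrow> \<exists>f\<in>D. AE x in M. s * f x - L f x = h x"
    and "\<exists>C. \<forall>f\<in>D. L2_norm M f \<le> C * L2_norm M (s *\<^sub>R f - L f)"
proof -
  define R where "R = (\<lambda>f x. complex_of_real s * f x - complex_extension L f x)"
  have surj: "\<And>h. h \<in> L2 M \<Longrightarrow> \<exists>f\<in>complex_domain D. AE x in M. R f x = h x"
    and bdd: "\<exists>C. \<forall>f\<in>complex_domain D. L2_norm M f \<le> C * L2_norm M (R f)"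
    using s unfolding resolvent_set_def R_def by (auto simp: Let_def)
  show "\<exists>f\<in>D. AE x in M. s * f x - L f x = h x" if h: "h \<in> L2 M"
  proof -
    have "(\<lambda>x. complex_of_real (h x)) \<in> L2 M" using h by (auto simp: L2_def)
    from surj[OF this] obtain f where f: "f \<in> complex_domain D" "AE x in M. R f x = complex_of_real (h x)" by blast
    have "AE x in M. s * Re (f x) - L (\<lambda>x. Re (f x)) x = h x"
      using f(2)
    proof eventually_elim
      fix x assume "R f x = complex_of_real (h x)"
      then have "Re (R f x) = h x" by simp
      then show "s * Re (f x) - L (\<lambda>x. Re (f x)) x = h x" by (simp add: R_def complex_extension_def)
    qed
    then show ?thesis using f(1) by (intro bexI[of _ "\<lambda>x. Re (f x)"]) (auto simp: complex_domain_def)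
  qed
  obtain C where C: "\<And>f. f \<in> complex_domain D \<Longrightarrow> L2_norm M f \<le> C * L2_norm M (R f)" using bdd by blast
  have "L2_norm M f \<le> C * L2_norm M (s *\<^sub>R f - L f)" if f: "f \<in> D" for f
  proof -
    define F where "F = (\<lambda>x. complex_of_real (f x))"
    have F: "F \<in> complex_domain D" using f zero by (simp add: complex_domain_def F_def)
    have rL: "s *\<^sub>R f - L f \<in> L2 M"
      using f D by (intro subspace_diff[OF subspace_L2] subspace_scale[OF subspace_L2] L) auto
    have "L2_norm M (R F) = L2_norm M (s *\<^sub>R f - L f)"
      unfolding L2_norm_def
    proof (intro arg_cong[of _ _ sqrt] integral_cong_AE)
      have RF: "R F x = Complex ((s *\<^sub>R f - L f) x) (- L (\<lambda>x. 0) x)" for x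
        by (simp add: R_def F_def complex_extension_def complex_eq_iff)
      have m1: "s *\<^sub>R f - L f \<in> borel_measurable M" using rL by (rule L2D)
      have m2: "L (\<lambda>x. 0) \<in> borel_measurable M" using L[OF zero(1)] by (rule L2D)
      note [measurable] = m1 m2
      have "R F = (\<lambda>x. complex_of_real ((s *\<^sub>R f - L f) x) - \<i> * complex_of_real (L (\<lambda>x. 0) x))"
        by (auto simp: fun_eq_iff RF complex_eq_iff)
      then have m3: "R F \<in> borel_measurable M" by (simp del: minus_apply fun_diff_def scaleR_fun_apply) measurable
      show "(\<lambda>x. (norm (R F x))\<^sup>2) \<in> borel_measurable M" using m3 by measurable
      show "(\<lambda>x. (norm ((s *\<^sub>R f - L f) x))\<^sup>2) \<in> borel_measurable M" by measurable
      show "AE x in M. (norm (R F x))\<^sup>2 = (norm ((s *\<^sub>R f - L f) x))\<^sup>2"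
        using zero(2) by eventually_elim (simp add: RF cmod_power2)
    qed
    moreover have "L2_norm M F = L2_norm M f" by (simp add: L2_norm_def F_def)
    ultimately show ?thesis using C[OF F] by simp
  qed
  then show "\<exists>C. \<forall>f\<in>D. L2_norm M f \<le> C * L2_norm M (s *\<^sub>R f - L f)" by blast
qed

lemma real_mem_resolvent_set:
  assumes "spectral_gap M D L \<le> ereal d" "d < s" "s \<noteq> 0"
  shows "complex_of_real s \<in> resolvent_set M D L"
proof (rule ccontr)
  assume "complex_of_real s \<notin> resolvent_set M D L"
  then have "complex_of_real s \<in> spectrum M D L - {0}" using assms by (simp add: spectrum_def)
  then have "ereal (Re (complex_of_real s)) \<le> spectral_gap M D L"
    unfolding spectral_gap_def by (rule SUP_upper)
  then show False using assms by (auto dest: order.trans)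
qed

lemma linear_operatorD:
  assumes "linear_operator M D L"
  shows "D \<subseteq> L2 M" "f \<in> D \<Longrightarrow> L f \<in> L2 M"
  using assms by (simp_all add: linear_operator_def)

lemma markov_generator_semigroup:
  "prob_space M \<Longrightarrow> markov_generator M W Q X D L \<Longrightarrow> markov_semigroup M W Q X"
  by (auto simp: markov_generator_def markov_semigroup_def markov_semigroup_axioms_def)

section \<open>From the spectrum to a Poincare inequality and back\<close>

context markov_semigroup
begin

text \<open>\<open>L\<close> picks one representative of each derivative; the abstract generator
  contains all of them.\<close>

lemma markov_generator_graph:
  assumes "markov_generator M W Q X D L"
  shows "(f, g) \<in> generator \<longleftrightarrow> f \<in> D \<and> g \<in> L2 M \<and> (AE x in M. g x = L f x)"
proof -
  have D: "D = {f \<in> L2 M. \<exists>g\<in>L2 M. has_L2_derivative M (semigroup Q X) f g}"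
    and L: "\<And>f. f \<in> D \<Longrightarrow> L f \<in> L2 M \<and> has_L2_derivative M (semigroup Q X) f (L f)"
    using assms unfolding markov_generator_def is_generator_def by blast+
  have gr: "(f, L f) \<in> generator" if "f \<in> D" for f
    using L[OF that] that D by (auto simp: generator_iff)
  show ?thesis
  proof safe
    assume fg: "(f, g) \<in> generator"
    then show fD: "f \<in> D" by (auto simp: generator_iff D)
    show g: "g \<in> L2 M" using generator_mem[OF fg] by simp
    have "nrm (g - L f) = 0" by (rule generator_unique[OF fg gr[OF fD]])
    then have "AE x in M. (g - L f) x = 0"
      using L2_null_iff[of "g - L f" M] g L[OF fD] by (simp add: nrm_def)
    then show "AE x in M. g x = L f x" by eventually_elim simp
  next
    assume f: "f \<in> D" and g: "g \<in> L2 M" and AE: "AE x in M. g x = L f x"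
    have "AE x in M. (L f - g) x = 0" using AE by eventually_elim simp
    moreover have "L f - g \<in> L2 M" using g L[OF f] by simp
    ultimately have "nrm (L f - g) = 0" using L2_null_iff[of "L f - g" M] by (simp add: nrm_def)
    then show "(f, g) \<in> generator" by (rule generator_cong[OF gr[OF f] g])
  qed
qed

text \<open>Each hypothesis of the form bound has its own source: the sign of the form is the
  contraction property, the trivial kernel is ergodicity, and the real resolvents in (d, 0) are the
  spectral gap.\<close>

lemma spectral_gap_poincare:
  assumes gen: "markov_generator M W Q X D L" and erg: "ergodic M Q X" and sa: "self_adjoint M D L"
    and d: "spectral_gap M D L \<le> ereal d" "d < 0"
    and f: "f \<in> D" "L2_inner M f (\<lambda>x. 1) = 0"
  shows "L2_inner M f (L f) \<le> d * L2_inner M f f"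
proof (rule spectral_gap_form_bound)
  note gr = markov_generator_graph[OF gen]
  have lin: "linear_operator M D L" using sa by (simp add: self_adjoint_def)
  have DL: "D \<subseteq> L2 M" "\<And>f. f \<in> D \<Longrightarrow> L f \<in> L2 M" using linear_operatorD[OF lin] by auto
  have adj: "\<lbrakk>u \<in> L2 M; v \<in> L2 M\<rbrakk> \<Longrightarrow>
    (\<forall>f\<in>D. L2_inner M (L f) u = L2_inner M f v) \<longleftrightarrow> (u \<in> D \<and> (AE x in M. v x = L u x))" for u v
    using sa by (simp add: self_adjoint_def)
  have grL: "(f, L f) \<in> generator" if "f \<in> D" for f using that DL by (simp add: gr)
  have "(0, 0) \<in> generator" using subspace_0[OF subspace_generator] by (simp add: zero_prod_def)
  then have zero: "(\<lambda>x. 0) \<in> D" "AE x in M. L (\<lambda>x. 0) x = 0"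
    by (auto simp: gr zero_fun_def elim: eventually_mono)
  show "subspace generator" by (rule subspace_generator)
  show "generator \<subseteq> L2 M \<times> L2 M" using generator_mem by auto
  show "(u, v) \<in> generator" if "u \<in> L2 M" "v \<in> L2 M" "\<And>f g. (f, g) \<in> generator \<Longrightarrow> L2_inner M g u = L2_inner M f v" for u v
    using adj[OF that(1,2)] that(3)[OF grL] that(2) by (simp add: gr)
  show "L2_inner M g f' = L2_inner M f g'" if "(f, g) \<in> generator" "(f', g') \<in> generator" for f g f' g'
  proof -
    have *: "f \<in> D" "g \<in> L2 M" "AE x in M. g x = L f x" "f' \<in> D" "g' \<in> L2 M" "AE x in M. g' x = L f' x"
      using that by (auto simp: gr)
    have "L2_inner M g f' = L2_inner M (L f) f'"
      using * DL by (intro L2_inner_cong_AE) auto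
    also have "\<dots> = L2_inner M f g'" using adj[of f' g'] * DL by auto
    finally show ?thesis .
  qed
  show "L2_inner M f g \<le> 0" if "(f, g) \<in> generator" for f g using that by (rule generator_dissipative)
  show "((\<lambda>x. 1), 0) \<in> generator" by (rule generator_one)
  show "L2_inner M (\<lambda>x. 1) (\<lambda>x. 1) = 1" by (simp add: L2_inner_def prob_space)
  show "L2_inner M f f = 0" if "(f, 0) \<in> generator" "L2_inner M f (\<lambda>x. 1) = 0" for f
    using ergodic_kernel[OF erg that] .
  show "\<exists>(f, g)\<in>generator. s *\<^sub>R f - g = h" if s: "d < s" "s < 0" and h: "h \<in> L2 M" for s h
  proof -
    have "complex_of_real s \<in> resolvent_set M D L" using d s by (intro real_mem_resolvent_set) auto
    from resolvent_set_realD(1)[OF this DL zero h]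
    obtain f where f: "f \<in> D" "AE x in M. s * f x - L f x = h x" by blast
    have "(f, s *\<^sub>R f - h) \<in> generator"
      unfolding gr using f h DL by (auto elim: eventually_mono)
    then show ?thesis by force
  qed
  show "\<exists>C. \<forall>(f, g)\<in>generator. nrm f \<le> C * nrm (s *\<^sub>R f - g)" if s: "d < s" "s < 0" for s
  proof -
    have "complex_of_real s \<in> resolvent_set M D L" using d s by (intro real_mem_resolvent_set) auto
    from resolvent_set_realD(2)[OF this DL zero]
    obtain C where C: "\<And>f. f \<in> D \<Longrightarrow> L2_norm M f \<le> C * L2_norm M (s *\<^sub>R f - L f)" by blast
    have "nrm f \<le> C * nrm (s *\<^sub>R f - g)" if "(f, g) \<in> generator" for f g
    proof -
      have *: "f \<in> D" "g \<in> L2 M" "AE x in M. g x = L f x" using that by (auto simp: gr)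
      have fL: "f \<in> L2 M" "L f \<in> L2 M" using * DL by auto
      have "nrm (s *\<^sub>R f - L f) = nrm (s *\<^sub>R f - g)"
      proof (rule nrm_cong_weak(1))
        fix u :: "'a \<Rightarrow> real" assume u: "u \<in> L2 M"
        show "L2_inner M (s *\<^sub>R f - L f) u = L2_inner M (s *\<^sub>R f - g) u"
          using * fL u by (intro L2_inner_cong_AE) (auto elim: eventually_mono)
      qed (use * fL in auto)
      then show ?thesis using C[OF *(1)] by (simp add: nrm_eq_L2_norm)
    qed
    then show ?thesis by blast
  qed
  show "d < 0" by fact
  show "(f, L f) \<in> generator" by (rule grL[OF f(1)])
  show "L2_inner M f (\<lambda>x. 1) = 0" by fact
qed

text \<open>Applies to non-symmetric \<open>L\<close>: with the Poincare inequality as its only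
  spectral input, the generator becomes an instance of \<open>coercive_generator\<close>.\<close>

lemma resolvent_of_poincare:
  assumes gen: "markov_generator M W Q X D L" and dense: "densely_defined M D"
    and poincare: "\<And>f. \<lbrakk>f \<in> D; L2_inner M f (\<lambda>x. 1) = 0\<rbrakk> \<Longrightarrow> L2_inner M f (L f) \<le> d * L2_inner M f f"
    and d: "d < 0" and z: "d < Re z" "z \<noteq> 0"
  shows "z \<in> resolvent_set M D L"
proof -
  note gr = markov_generator_graph[OF gen]
  have L: "L f \<in> L2 M" if "f \<in> D" for f
    using gen that by (auto simp: markov_generator_def is_generator_def)
  have D: "D \<subseteq> L2 M" using gen by (auto simp: markov_generator_def is_generator_def)
  have grL: "(f, L f) \<in> generator" if "f \<in> D" for f using that L by (simp add: gr)
  interpret coercive_generator "L2 M" "L2_inner M" generator "\<lambda>x. 1" d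
  proof
    show "subspace generator" by (rule subspace_generator)
    show "generator \<subseteq> L2 M \<times> L2 M" using generator_mem by auto
    show "((\<lambda>x. 1), 0) \<in> generator" by (rule generator_one)
    show "L2_inner M (\<lambda>x. 1) (\<lambda>x. 1) = 1" by (simp add: L2_inner_def prob_space)
    show "L2_inner M g (\<lambda>x. 1) = 0" if "(f, g) \<in> generator" for f g
      using that by (rule generator_range_mean_zero)
    show "d < 0" by fact
    show "L2_inner M f g \<le> d * L2_inner M f f" if "(f, g) \<in> generator" "L2_inner M f (\<lambda>x. 1) = 0" for f g
    proof -
      have *: "f \<in> D" "g \<in> L2 M" "AE x in M. g x = L f x" using that by (auto simp: gr)
      have "L2_inner M g f = L2_inner M (L f) f"
        using * L D by (intro L2_inner_cong_AE) auto
      then show ?thesis using poincare[OF *(1) that(2)] by (simp add: L2_inner_commute)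
    qed
    show "(f, g) \<in> generator" if "\<And>n. (F n, K n) \<in> generator" "f \<in> L2 M" "g \<in> L2 M"
      "(\<lambda>n. nrm (F n - f)) \<longlonglongrightarrow> 0" "(\<lambda>n. nrm (K n - g)) \<longlonglongrightarrow> 0" for F K f g
      using that by (rule generator_closed)
    show "L2_inner M u u = 0" if w: "0 < w" and u: "u \<in> L2 M"
      and orth: "\<And>f g. (f, g) \<in> generator \<Longrightarrow> L2_inner M (w *\<^sub>R f - g) u = 0" for w u
    proof (rule ccontr)
      assume nz: "L2_inner M u u \<noteq> 0"
      then have pos: "nrm u > 0" using nrm_null[of u] nrm_nonneg[of u] by linarith
      then obtain v where v: "v \<in> D" "L2_norm M (\<lambda>x. u x - v x) < nrm u"
        using dense u unfolding densely_defined_def by blast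
      have vL: "v \<in> L2 M" using v D by auto
      \<comment> \<open>The semigroup makes \<open>u\<close> orthogonal to the domain; density of
        the domain makes it null.\<close>
      have "L2_inner M v u = 0" by (rule generator_range_orth[OF w u orth grL[OF v(1)]])
      then have "L2_inner M u u = L2_inner M (u - v) u" using u vL by (simp add: ip_simps)
      also have "\<dots> \<le> nrm (u - v) * nrm u" using u vL by (intro Cauchy_Schwarz_le) auto
      also have "\<dots> < nrm u * nrm u"
        using v(2) pos by (intro mult_strict_right_mono) (simp_all add: nrm_eq_L2_norm fun_diff_def)
      finally show False using nrm_sq[of u] by (simp add: power2_eq_square)
    qed
  qed
  have nz: "Re z \<noteq> 0 \<or> Im z \<noteq> 0" using z by (auto simp: complex_eq_iff)
  have "Complex (Re z) (Im z) \<in> resolvent_set M D L"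
  proof (rule resolvent_setI[OF D L])
    fix f1 f2 r1 r2 assume f: "f1 \<in> D" "f2 \<in> D"
      and r: "r1 = Re z *\<^sub>R f1 - Im z *\<^sub>R f2 - L f1" "r2 = Im z *\<^sub>R f1 + Re z *\<^sub>R f2 - L f2"
    show "L2_inner M f1 f1 + L2_inner M f2 f2
      \<le> (1 / ((Re z)\<^sup>2 + (Im z)\<^sup>2) + 1 / (Re z - d)\<^sup>2) * (L2_inner M r1 r1 + L2_inner M r2 r2)"
      by (rule resolvent_bound[OF grL[OF f(1)] grL[OF f(2)] z(1) nz r])
  next
    fix h1 h2 :: "'a \<Rightarrow> real" assume h: "h1 \<in> L2 M" "h2 \<in> L2 M"
    obtain f1 g1 f2 g2 where f: "(f1, g1) \<in> generator" "(f2, g2) \<in> generator"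
      "Re z *\<^sub>R f1 - Im z *\<^sub>R f2 - g1 = h1" "Im z *\<^sub>R f1 + Re z *\<^sub>R f2 - g2 = h2"
      using resolvent_surj[OF z(1) nz h] by blast
    have "AE x in M. Re z * f1 x - Im z * f2 x - L f1 x = h1 x"
      "AE x in M. Im z * f1 x + Re z * f2 x - L f2 x = h2 x"
      using f(1,2) unfolding gr by (auto simp flip: f(3,4) elim: eventually_mono)
    then show "\<exists>f1\<in>D. \<exists>f2\<in>D. (AE x in M. Re z * f1 x - Im z * f2 x - L f1 x = h1 x) \<and>
        (AE x in M. Im z * f1 x + Re z * f2 x - L f2 x = h2 x)"
      using f(1,2) unfolding gr by blast
  qed
  then show ?thesis by simp
qed

end

theorem lemma1:
  fixes \<pi> :: "'e measure"
    and W\<^sub>0 :: "'w0 measure" and Q\<^sub>0 :: "'e \<Rightarrow> 'w0 measure" and X\<^sub>0 :: "real \<Rightarrow> 'w0 \<Rightarrow> 'e"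
    and W\<^sub>1 :: "'w1 measure" and Q\<^sub>1 :: "'e \<Rightarrow> 'w1 measure" and X\<^sub>1 :: "real \<Rightarrow> 'w1 \<Rightarrow> 'e"
    and W :: "'w measure" and Q :: "'e \<Rightarrow> 'w measure" and X :: "real \<Rightarrow> 'w \<Rightarrow> 'e"
    and D\<^sub>0 D\<^sub>S D\<^sub>A :: "('e \<Rightarrow> real) set"
    and L\<^sub>0 S A :: "('e \<Rightarrow> real) \<Rightarrow> 'e \<Rightarrow> real"
  assumes "prob_space \<pi>"
    and "markov_generator \<pi> W\<^sub>0 Q\<^sub>0 X\<^sub>0 D\<^sub>0 L\<^sub>0"
    and "ergodic \<pi> Q\<^sub>0 X\<^sub>0"
    and "time_reversible \<pi> Q\<^sub>0 X\<^sub>0"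
    and "self_adjoint \<pi> D\<^sub>0 L\<^sub>0"
    and "spectral_gap \<pi> D\<^sub>0 L\<^sub>0 < 0"
    and "reversible_perturbation \<pi> W\<^sub>1 Q\<^sub>1 X\<^sub>1 D\<^sub>0 L\<^sub>0 D\<^sub>S S"
    and "irreversible_perturbation \<pi> W Q X (D\<^sub>0 \<inter> D\<^sub>S) (\<lambda>f x. L\<^sub>0 f x + S f x) D\<^sub>A A"
  shows "spectral_gap \<pi> (D\<^sub>0 \<inter> D\<^sub>S \<inter> D\<^sub>A) (\<lambda>f x. L\<^sub>0 f x + S f x + A f x) \<le> spectral_gap \<pi> D\<^sub>0 L\<^sub>0"
proof -
  let ?L = "\<lambda>f x. L\<^sub>0 f x + S f x + A f x"
  interpret prob_space \<pi> by fact
  interpret M0: markov_semigroup \<pi> W\<^sub>0 Q\<^sub>0 X\<^sub>0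
    by (rule markov_generator_semigroup) fact+
  have DS: "D\<^sub>0 \<subseteq> D\<^sub>S" and S: "linear_operator \<pi> D\<^sub>S S" "\<And>f. f \<in> D\<^sub>S \<Longrightarrow> L2_inner \<pi> f (S f) \<le> 0"
    using assms(7) unfolding reversible_perturbation_def by blast+
  have "D\<^sub>0 \<inter> D\<^sub>S \<subseteq> D\<^sub>A" and A: "linear_operator \<pi> D\<^sub>A A"
    "\<And>f g. \<lbrakk>f \<in> D\<^sub>A; g \<in> D\<^sub>A\<rbrakk> \<Longrightarrow> L2_inner \<pi> f (A g) = - L2_inner \<pi> (A f) g"
    and gen: "markov_generator \<pi> W Q X (D\<^sub>0 \<inter> D\<^sub>S \<inter> D\<^sub>A) ?L"
    using assms(8) unfolding irreversible_perturbation_def by blast+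
  \<comment> \<open>All three operators live on \<open>D\<^sub>0\<close>, whose density is part of
    the self-adjointness of \<open>L\<^sub>0\<close>.\<close>
  with DS have D: "D\<^sub>0 \<inter> D\<^sub>S \<inter> D\<^sub>A = D\<^sub>0" and DA: "D\<^sub>0 \<subseteq> D\<^sub>A" by auto
  note gen = gen[unfolded D]
  interpret M: markov_semigroup \<pi> W Q X
    by (rule markov_generator_semigroup[OF _ gen]) fact
  have lin0: "linear_operator \<pi> D\<^sub>0 L\<^sub>0" and dense: "densely_defined \<pi> D\<^sub>0"
    using assms(5) by (auto simp: self_adjoint_def)
  show ?thesis
    unfolding D
  proof (rule ccontr)
    assume "\<not> spectral_gap \<pi> D\<^sub>0 ?L \<le> spectral_gap \<pi> D\<^sub>0 L\<^sub>0"
    then obtain z where z: "z \<in> spectrum \<pi> D\<^sub>0 ?L - {0}" "spectral_gap \<pi> D\<^sub>0 L\<^sub>0 < ereal (Re z)"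
      unfolding spectral_gap_def[of \<pi> D\<^sub>0 ?L] by (auto simp: SUP_le_iff not_le)
    \<comment> \<open>The minimum with 0 keeps \<open>d\<close> negative also when
      \<open>Re z\<close> is not; strictness leaves room for a real \<open>d\<close>.\<close>
    have "spectral_gap \<pi> D\<^sub>0 L\<^sub>0 < min (ereal (Re z)) 0" using z(2) assms(6) by simp
    then obtain d where d: "spectral_gap \<pi> D\<^sub>0 L\<^sub>0 < ereal d" "ereal d < min (ereal (Re z)) 0"
      using ereal_dense2 by blast
    then have d': "d < Re z" "d < 0" by auto
    have "z \<in> resolvent_set \<pi> D\<^sub>0 ?L"
    proof (rule M.resolvent_of_poincare[OF gen dense _ d'(2,1)])
      fix f assume f: "f \<in> D\<^sub>0" "L2_inner \<pi> f (\<lambda>x. 1) = 0"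
      have m: "f \<in> L2 \<pi>" "L\<^sub>0 f \<in> L2 \<pi>" "S f \<in> L2 \<pi>" "A f \<in> L2 \<pi>"
        using f(1) DS DA lin0 S(1) A(1) by (auto dest: linear_operatorD)
      \<comment> \<open>Antisymmetry at a single real function makes the value equal to its own
        negative.\<close>
      have "L2_inner \<pi> f (A f) = 0"
        using A(2)[of f f] f(1) DA by (auto simp: L2_inner_commute[of \<pi> "A f"])
      moreover have "L2_inner \<pi> f (S f) \<le> 0" using S(2) f(1) DS by auto
      moreover have "L2_inner \<pi> f (L\<^sub>0 f) \<le> d * L2_inner \<pi> f f"
        using d(1) by (intro M0.spectral_gap_poincare[OF assms(2,3,5) _ d'(2) f]) simp
      moreover have "L2_inner \<pi> f (L\<^sub>0 f + S f + A f) = L2_inner \<pi> f (L\<^sub>0 f) + L2_inner \<pi> f (S f) + L2_inner \<pi> f (A f)"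
        using m by (simp add: M0.ip_right)
      ultimately show "L2_inner \<pi> f (?L f) \<le> d * L2_inner \<pi> f f"
        by (simp add: plus_fun_def)
    qed (use z in auto)
    then show False using z by (simp add: spectrum_def)
  qed
qed

end
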